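(* Let $G$ be a connected graph with $n\ge 3$ vertices and $t$ spanning trees. Let $\Delta_1$, $\Delta_2$ and $\delta$ be the maximum, the second maximum and the minimum vertex degrees of $G$, respectively, and let $$t_1=\frac{2\,t(G\times K_2)}{t(G)},\qquad T=\frac12\left[\Delta_1+\delta+\sqrt{(\Delta_1-\delta)^2+4\Delta_1}\right].$$ Let $IE(G)$ be the incidence energy and $LEL(G)$ the Laplacian energy like invariant of $G$. Then: (i) if $G$ is bipartite, then $$IE(G)=LEL(G)\ge\sqrt{T}+(n-2)\left(\frac{nt}{T}\right)^{1/(2(n-2))}+\left(\Delta_2^{1/4}-\delta^{1/4}\right)^2;$$ (ii) if $G$ is non-bipartite, then $$IE(G)>\sqrt{T}+(n-1)\left(\frac{t_1}{T}\right)^{1/(2(n-1))}+\left((\Delta_2-1)^{1/4}-\delta^{1/4}\right)^2.$$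
   Context: Graphs are simple. For a graph $G$ with $n$ vertices, adjacency matrix $A(G)$ and diagonal matrix of vertex degrees $D(G)$, let $\mu_1\ge\cdots\ge\mu_n=0$ be the eigenvalues of the Laplacian matrix $L(G)=D(G)-A(G)$ and $q_1\ge\cdots\ge q_n$ the eigenvalues of the signless Laplacian matrix $Q(G)=D(G)+A(G)$. Then $IE(G)=\sum_{i=1}^n\sqrt{q_i}$ and $LEL(G)=\sum_{i=1}^{n-1}\sqrt{\mu_i}$. The second maximum degree $\Delta_2$ is the second entry of the degree sequence in non-increasing order (so $\Delta_2=\Delta_1$ is possible). $t(H)$ denotes the number of spanning trees of a graph $H$, and $t=t(G)$. $G\times K_2$ denotes the Cartesian product of $G$ and the complete graph $K_2$ on two vertices.
   Formalization: In t_1, G×K_2 is taken as the tensor (direct) product, i.e. the bipartite double cover of G, not the Cartesian product (prism); with the prism, part (ii) fails for G=K_3 (t_1=50, right side about 5.80, IE=4). *)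

theory Defs
  imports "Jordan_Normal_Form.Char_Poly"
begin

record 'a ugraph =
  verts :: "'a set"
  edges :: "'a set set"

definition simple_graph :: "'a ugraph \<Rightarrow> bool" where
  "simple_graph G \<longleftrightarrow> finite (verts G) \<and>
     edges G \<subseteq> {{u, v} | u v. u \<in> verts G \<and> v \<in> verts G \<and> u \<noteq> v}"

definition connected_graph :: "'a ugraph \<Rightarrow> bool" where
  "connected_graph G \<longleftrightarrow> verts G \<noteq> {} \<and>
     (\<forall>u \<in> verts G. \<forall>v \<in> verts G. (u, v) \<in> {(x, y). {x, y} \<in> edges G}\<^sup>*)"

definition bipartite :: "'a ugraph \<Rightarrow> bool" where
  "bipartite G \<longleftrightarrow> (\<exists>X Y. X \<union> Y = verts G \<and> X \<inter> Y = {} \<and>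
     (\<forall>e \<in> edges G. \<exists>x \<in> X. \<exists>y \<in> Y. e = {x, y}))"

definition vdegree :: "'a ugraph \<Rightarrow> 'a \<Rightarrow> nat" where
  "vdegree G v = card {e \<in> edges G. v \<in> e}"

definition max_degree :: "'a ugraph \<Rightarrow> nat" where
  "max_degree G = Max (vdegree G ` verts G)"

definition min_degree :: "'a ugraph \<Rightarrow> nat" where
  "min_degree G = Min (vdegree G ` verts G)"

definition degree_sequence :: "'a ugraph \<Rightarrow> nat list" where
  "degree_sequence G =
     rev (sorted_list_of_multiset (image_mset (vdegree G) (mset_set (verts G))))"

(* Indices start at 0, so index 1 is the second entry of the non-increasing sequence. *)
definition second_max_degree :: "'a ugraph \<Rightarrow> nat" where
  "second_max_degree G = degree_sequence G ! 1"

(* A cycle is given by its list of distinct vertices; it closes up from the last to the first. *)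
definition is_cycle :: "'a ugraph \<Rightarrow> 'a list \<Rightarrow> bool" where
  "is_cycle G p \<longleftrightarrow> 3 \<le> length p \<and> distinct p \<and>
     (\<forall>i < length p. {p ! i, p ! (Suc i mod length p)} \<in> edges G)"

definition is_tree :: "'a ugraph \<Rightarrow> bool" where
  "is_tree G \<longleftrightarrow> simple_graph G \<and> connected_graph G \<and> (\<nexists>p. is_cycle G p)"

definition num_spanning_trees :: "'a ugraph \<Rightarrow> nat" where
  "num_spanning_trees G =
     card {F. F \<subseteq> edges G \<and> is_tree \<lparr>verts = verts G, edges = F\<rparr>}"

definition K2 :: "bool ugraph" where
  "K2 = \<lparr>verts = UNIV, edges = {{False, True}}\<rparr>"

(* The product whose adjacency relation is the Cartesian product of the two adjacency
   relations: (u, x) ~ (v, y) iff u ~ v and x ~ y (also called tensor, Kronecker or direct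
   product). With K2 it is the bipartite double cover of G, whose Laplacian spectrum is the
   union of the spectra of D - A and D + A; hence 2 t(G x K2) / t(G) is the product of the
   signless Laplacian eigenvalues of G. This is not the product in which one coordinate is
   kept fixed along each edge (the prism over G, for the factor K2). For the triangle,
   2 t(G x K2) / t(G) is 4 with the product used here and 50 for the prism; the lower bound
   on the incidence energy for non-bipartite graphs fails with 50. *)
definition tensor_product :: "'a ugraph \<Rightarrow> 'b ugraph \<Rightarrow> ('a \<times> 'b) ugraph" where
  "tensor_product G H = \<lparr>verts = verts G \<times> verts H,
     edges = {{(u, x), (v, y)} | u v x y. {u, v} \<in> edges G \<and> {x, y} \<in> edges H}\<rparr>"

(* An arbitrary enumeration of the vertices, used to index the matrices below; the
   characteristic polynomials do not depend on it. *)
definition vertex_list :: "'a ugraph \<Rightarrow> 'a list" where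
  "vertex_list G = (SOME vs. distinct vs \<and> set vs = verts G)"

definition adjacency_matrix :: "'a ugraph \<Rightarrow> real mat" where
  "adjacency_matrix G = (let vs = vertex_list G in
     mat (card (verts G)) (card (verts G)) (\<lambda>(i, j). if {vs ! i, vs ! j} \<in> edges G then 1 else 0))"

definition degree_matrix :: "'a ugraph \<Rightarrow> real mat" where
  "degree_matrix G = (let vs = vertex_list G in
     mat (card (verts G)) (card (verts G)) (\<lambda>(i, j). if i = j then real (vdegree G (vs ! i)) else 0))"

definition laplacian :: "'a ugraph \<Rightarrow> real mat" where
  "laplacian G = degree_matrix G - adjacency_matrix G"

definition signless_laplacian :: "'a ugraph \<Rightarrow> real mat" where
  "signless_laplacian G = degree_matrix G + adjacency_matrix G"

(* Real eigenvalues with algebraic multiplicity, in non-increasing order. For a symmetric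
   real n x n matrix, as here, the list has length n. *)
definition eigenvalue_list :: "real mat \<Rightarrow> real list" where
  "eigenvalue_list A = rev (sorted_list_of_multiset (proots (char_poly A)))"

definition incidence_energy :: "'a ugraph \<Rightarrow> real" where
  "incidence_energy G =
     (\<Sum>i < card (verts G). sqrt (eigenvalue_list (signless_laplacian G) ! i))"

definition laplacian_energy_like :: "'a ugraph \<Rightarrow> real" where
  "laplacian_energy_like G =
     (\<Sum>i < card (verts G) - 1. sqrt (eigenvalue_list (laplacian G) ! i))"

end

theory Submission
  imports Defs
begin

text \<open>Let \<open>e\<^sub>0 \<ge> \<dots> \<ge> e\<^sub>N\<close> be the eigenvalues (without the last one, \<open>0\<close>, in the
  bipartite case) and \<open>R\<close> their product. Refined AM-GM on \<open>\<surd>e\<^sub>1, \<dots>, \<surd>e\<^sub>N\<close> gives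
  \<open>\<Sum>\<surd>e\<^sub>i \<ge> \<surd>e\<^sub>0 + N (R / e\<^sub>0)\<^bsup>1/2N\<^esup> + (root 4 e\<^sub>1 - root 4 e\<^sub>N)\<^sup>2\<close>. The first two terms increase
  with \<open>e\<^sub>0\<close> above \<open>R\<^bsup>1/(N+1)\<^esup>\<close>, and \<open>e\<^sub>0 \<ge> T \<ge> R\<^bsup>1/(N+1)\<^esup>\<close>, because \<open>T\<close> is the largest value of
  the signless form on vectors supported on a star with \<open>\<Delta>\<^sub>1\<close> leaves of degree \<open>\<delta>\<close>; moreover
  \<open>e\<^sub>0 > T\<close> unless the graph is bipartite. Test vectors also bound \<open>e\<^sub>1\<close> from below and \<open>e\<^sub>N\<close>
  from above, and the matrix-tree theorem, applied to the graph and to its bipartite double cover,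
  evaluates \<open>R\<close>. If \<open>\<Delta>\<^sub>2 = \<delta>\<close> in the non-bipartite case, then \<open>\<Delta>\<^sub>2 - 1 < \<delta>\<close> and the bounds
  \<open>e\<^sub>1 \<ge> \<Delta>\<^sub>2 - 1\<close>, \<open>e\<^sub>N \<le> \<delta>\<close> do not separate \<open>e\<^sub>1\<close> from \<open>e\<^sub>N\<close>; non-complete graphs then satisfy
  \<open>e\<^sub>1 \<ge> \<delta>\<close> and \<open>e\<^sub>N \<le> \<delta> - 1\<close>, while for complete graphs \<open>e\<^sub>0 \<ge> 2 \<delta>\<close> exceeds \<open>T\<close> by enough to absorb
  the last term.\<close>

section \<open>Diagonalization of real symmetric matrices\<close>

text \<open>Trading \<open>e_0\<close> for \<open>T\<close> requires \<open>R <= T^(N+1)\<close>,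
  which AM-GM draws from the trace. In the bipartite case the zero eigenvalue leaves only n - 1
  values to share the sum of n degrees; T \<ge> \<open>\<Delta>\<^sub>1\<close> + 1 together with
  \<open>\<Delta>\<^sub>1\<close> \<le> n - 1 makes up for this. A plane supported on the two
  vertices of largest degree loses 1 if they are adjacent; this is the origin of
  \<open>\<Delta>\<^sub>2\<close> - 1 in (ii). In (i) the loss is regained from further neighbours
  of the two vertices, which are disjoint sets because a bipartite graph has no triangle. In a
  complete graph \<open>e_1\<close>, ..., \<open>e_N\<close> all equal n - 2, so the refined AM-GM
  gains nothing there although the claimed last term is positive. The whole gain then has to come
  from \<open>e_0\<close>, and this needs explicit numerical margins. Spanning trees are matched
  with eigenvalues through the derivative of a characteristic polynomial at 0. It multiplies well
  under the factorization for the double cover, so that no eigenvalue of the cover is ever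
  computed.\<close>

text \<open>The reflection that exchanges \<open>v\<close> with the first coordinate vector. Being
  symmetric and its own inverse, it gives conjugations that preserve symmetry and are similarities
  at once.\<close>

lemma householder:
  fixes v :: "real vec"
  assumes v: "v \<in> carrier_vec (Suc m)" and v1: "v \<bullet> v = 1"
  obtains W where "W \<in> carrier_mat (Suc m) (Suc m)" "transpose_mat W = W" "W * W = 1\<^sub>m (Suc m)" "col W 0 = v"
proof -
  let ?n = "Suc m"
  define u where "u i = v $ i - (if i = 0 then 1 else 0)" for i
  define s where "s = (\<Sum>k<?n. u k * u k)"
  define c where "c = 2 / s" \<comment> \<open>\<open>0\<close> if \<open>v\<close> is the first unit vector, and then \<open>W\<close> is the identity\<close>
  define W where "W = mat ?n ?n (\<lambda>(i,j). (if i = j then 1 else 0) - c * u i * u j)"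
  have vv: "(\<Sum>k<?n. v $ k * v $ k) = 1"
    using v1 v by (simp add: scalar_prod_def atLeast0LessThan)
  have "s = (\<Sum>k<?n. v $ k * v $ k - (if k = 0 then 2 * v $ 0 - 1 else 0))"
    unfolding s_def u_def by (rule sum.cong) (auto simp: algebra_simps)
  also have "\<dots> = (\<Sum>k<?n. v $ k * v $ k) - (\<Sum>k<?n. if k = 0 then 2 * v $ 0 - 1 else 0)"
    by (rule sum_subtractf)
  finally have s: "s = 2 - 2 * v $ 0" using vv by (simp del: sum.lessThan_Suc)
  have s0: "u k = 0" if "s = 0" "k < ?n" for k
    using that unfolding s_def by (subst (asm) sum_nonneg_eq_0_iff) auto
  have cs: "c * c * s = 2 * c" unfolding c_def by (cases "s = 0") (auto simp: field_simps)
  have W: "W \<in> carrier_mat ?n ?n" unfolding W_def by auto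
  moreover have "transpose_mat W = W" unfolding W_def by (rule eq_matI) auto
  moreover have "W * W = 1\<^sub>m ?n"
  proof (rule eq_matI)
    fix i j assume "i < dim_row (1\<^sub>m ?n)" "j < dim_col (1\<^sub>m ?n)"
    then have i: "i < ?n" and j: "j < ?n" by auto
    have "(W * W) $$ (i,j) = (\<Sum>k<?n. W $$ (i,k) * W $$ (k,j))"
      using i j W by (simp add: scalar_prod_def atLeast0LessThan del: sum.lessThan_Suc)
    also have "\<dots> = (\<Sum>k<?n. (if k = i then (if i = j then 1 else 0) - c * u i * u j else 0)
        - (if k = j then c * u i * u j else 0) + c * c * u i * u j * (u k * u k))"
      unfolding W_def using i j by (intro sum.cong) (auto simp: algebra_simps)
    also have "\<dots> = (if i = j then 1 else 0) - c * u i * u j - c * u i * u j + c * c * u i * u j * s"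
      unfolding s_def sum.distrib sum_subtractf sum_distrib_left using i j
      by (simp add: sum.delta del: sum.lessThan_Suc)
    also have "\<dots> = (if i = j then 1 else 0) + (c * c * s - 2 * c) * (u i * u j)"
      by (simp add: algebra_simps)
    finally show "(W * W) $$ (i,j) = 1\<^sub>m ?n $$ (i,j)" using i j cs by simp
  qed (use W in auto)
  moreover have "col W 0 = v"
  proof (rule eq_vecI)
    fix i assume "i < dim_vec v"
    then have i: "i < ?n" using v by auto
    have "col W 0 $ i = (if i = 0 then 1 else 0) - c * u 0 * u i"
      using i unfolding W_def by (auto simp: mult.commute mult.left_commute)
    moreover have "c * u 0 * u i = - u i"
    proof (cases "s = 0")
      case True then show ?thesis using s0 i by simp
    next
      case False
      have "c * u 0 = -1" using False unfolding c_def u_def s by (simp add: field_simps)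
      then show ?thesis by simp
    qed
    ultimately show "col W 0 $ i = v $ i" unfolding u_def by auto
  qed (use W v in auto)
  ultimately show ?thesis using that by blast
qed

lemma prod_list_linear_factors_length:
  fixes A :: "'a :: idom mat"
  assumes "A \<in> carrier_mat n n" "char_poly A = (\<Prod>a\<leftarrow>es. [:- a, 1:])"
  shows "length es = n"
  using degree_monic_char_poly[OF assms(1)] degree_linear_factors[of uminus es] assms(2) by simp

text \<open>Deflation: reflecting a unit eigenvector for the head of \<open>es\<close> to the first
  coordinate vector leaves, by symmetry, a block diagonal matrix whose lower block has the tail as
  its roots. Induction over the root list instead of the dimension keeps the diagonal in the given
  order, later the decreasing one.\<close>

lemma real_symmetric_diagonalization:
  fixes A :: "real mat"
  assumes "A \<in> carrier_mat n n" "transpose_mat A = A" "char_poly A = (\<Prod>a\<leftarrow>es. [:- a, 1:])"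
  shows "\<exists>P. P \<in> carrier_mat n n \<and> transpose_mat P * P = 1\<^sub>m n \<and>
             transpose_mat P * A * P = mat_diag n (\<lambda>i. es ! i)"
  using assms
proof (induction es arbitrary: A n)
  case Nil
  then have "n = 0" using prod_list_linear_factors_length[OF Nil(1,3)] by simp
  then show ?case using Nil(1) by (intro exI[of _ "1\<^sub>m 0"]) (auto intro!: eq_matI simp: mat_diag_def)
next
  case (Cons e es)
  note A = Cons.prems(1) and sym = Cons.prems(2) and cp = Cons.prems(3)
  have "length (e # es) = n" by (rule prod_list_linear_factors_length[OF A cp])
  then obtain m where n: "n = Suc m" by (cases n) auto
  have "poly (char_poly A) e = 0" unfolding cp by simp
  then obtain v0 where v0: "v0 \<in> carrier_vec n" "v0 \<noteq> 0\<^sub>v n" "A *\<^sub>v v0 = e \<cdot>\<^sub>v v0"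
    using A eigenvalue_root_char_poly[OF A] unfolding eigenvalue_def eigenvector_def by auto
  define l where "l = v0 \<bullet> v0"
  have "l \<noteq> 0" unfolding l_def
    using v0(1,2) conjugate_square_eq_0_vec[OF v0(1)] by simp
  moreover have "l \<ge> 0" unfolding l_def scalar_prod_def by (intro sum_nonneg) auto
  ultimately have l: "l > 0" by simp
  define v where "v = (1 / sqrt l) \<cdot>\<^sub>v v0"
  have v: "v \<in> carrier_vec (Suc m)" using v0 n unfolding v_def by auto
  have Av: "A *\<^sub>v v = e \<cdot>\<^sub>v v" unfolding v_def
    using v0 A by (simp add: mult_mat_vec smult_smult_assoc mult.commute)
  have "v \<bullet> v = 1" unfolding v_def using v0 l
    by (simp add: l_def[symmetric])
  then obtain W where W: "W \<in> carrier_mat n n" and WT: "transpose_mat W = W"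
    and WW: "W * W = 1\<^sub>m n" and W0: "col W 0 = v"
    using householder[OF v] n by metis
  define B where "B = W * A * W"
  have B: "B \<in> carrier_mat n n" unfolding B_def using W A by auto
  have BT: "transpose_mat B = B"
    unfolding B_def using W A
    by (simp add: transpose_mult[of _ n n _ n] WT sym assoc_mult_mat[of _ n n _ n _ n])
  have colB: "col B 0 = e \<cdot>\<^sub>v unit_vec n 0"
  proof -
    have "col B 0 = (W * A) *\<^sub>v v" unfolding B_def
      using W A n W0 by (subst col_mult2[of _ n n _ n]) auto
    also have "\<dots> = W *\<^sub>v (e \<cdot>\<^sub>v v)" using W A v n Av by (subst assoc_mult_mat_vec[of _ n n _ n]) auto
    also have "\<dots> = e \<cdot>\<^sub>v (W *\<^sub>v v)" using W v n by (subst mult_mat_vec[of _ n n]) auto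
    also have "W *\<^sub>v v = col (W * W) 0" using W n unfolding W0[symmetric] by (subst col_mult2[of _ n n _ n]) auto
    also have "\<dots> = unit_vec n 0" unfolding WW using n by simp
    finally show ?thesis .
  qed
  have Bi0: "B $$ (i,0) = (if i = 0 then e else 0)" if "i < n" for i
    using arg_cong[OF colB, of "\<lambda>x. x $ i"] that B n by (auto split: if_splits)
  have B0i: "B $$ (0,i) = (if i = 0 then e else 0)" if "i < n" for i
    using Bi0[OF that] arg_cong[OF BT, of "\<lambda>x. x $$ (i,0)"] that B n by simp
  define D where "D = mat m m (\<lambda>(i,j). B $$ (Suc i, Suc j))"
  define E where "E = mat 1 1 (\<lambda>_. e)"
  have D: "D \<in> carrier_mat m m" and E: "E \<in> carrier_mat 1 1" unfolding D_def E_def by auto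
  have Bb: "B = four_block_mat E (0\<^sub>m 1 m) (0\<^sub>m m 1) D"
    by (rule eq_matI, insert B n Bi0 B0i, auto simp: D_def E_def)
  have DT: "transpose_mat D = D"
    by (rule eq_matI, insert arg_cong[OF BT, of "\<lambda>x. x $$ (Suc _, Suc _)"] B n, auto simp: D_def)
      (metis BT Suc_less_eq carrier_matD index_transpose_mat(1))
  have "similar_mat A B"
  proof -
    have "W * B * W = (W * W) * A * (W * W)"
      unfolding B_def using W A by (simp add: assoc_mult_mat[of _ n n _ n _ n])
    also have "\<dots> = A" unfolding WW using A by simp
    finally have "A = W * B * W" ..
    then have "similar_mat_wit A B W W" by (rule similar_mat_witI[OF WW WW _ A B W W])
    then show ?thesis unfolding similar_mat_def by blast
  qed
  then have "char_poly A = char_poly B" by (rule char_poly_similar)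
  also have "\<dots> = char_poly E * char_poly D"
    unfolding Bb by (rule char_poly_four_block_zeros_col[OF E _ D]) simp
  also have "char_poly E = [:- e, 1:]"
    using char_poly_upper_triangular[OF E] unfolding E_def upper_triangular_def diag_mat_def by simp
  finally have "[:- e, 1:] * char_poly D = [:- e, 1:] * (\<Prod>a\<leftarrow>es. [:- a, 1:])" using cp by simp
  then have "char_poly D = (\<Prod>a\<leftarrow>es. [:- a, 1:])" by (subst (asm) mult_left_cancel) auto
  from Cons.IH[OF D DT this] obtain P where P: "P \<in> carrier_mat m m"
    and PP: "transpose_mat P * P = 1\<^sub>m m" and PD: "transpose_mat P * D * P = mat_diag m (\<lambda>i. es ! i)"
    by blast
  define F where "F = four_block_mat (1\<^sub>m 1) (0\<^sub>m 1 m) (0\<^sub>m m 1) P"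
  have F: "F \<in> carrier_mat n n" unfolding F_def n using P by auto
  have FT: "transpose_mat F = four_block_mat (1\<^sub>m 1) (0\<^sub>m 1 m) (0\<^sub>m m 1) (transpose_mat P)"
    unfolding F_def using P by (subst transpose_four_block_mat[of _ 1 1 _ m _ m]) auto
  have "transpose_mat F * F = four_block_mat (1\<^sub>m 1) (0\<^sub>m 1 m) (0\<^sub>m m 1) (transpose_mat P * P)"
    unfolding FT unfolding F_def using P
    by (subst mult_four_block_mat[of _ 1 1 _ m _ m _ _ 1 _ m]) auto
  then have FF: "transpose_mat F * F = 1\<^sub>m n" unfolding PP n by simp
  have "transpose_mat F * B = four_block_mat E (0\<^sub>m 1 m) (0\<^sub>m m 1) (transpose_mat P * D)"
    unfolding FT Bb using P E D
    by (subst mult_four_block_mat[of _ 1 1 _ m _ m _ _ 1 _ m]) auto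
  moreover have "\<dots> * F = four_block_mat E (0\<^sub>m 1 m) (0\<^sub>m m 1) (transpose_mat P * D * P)"
    unfolding F_def using P E D
    by (subst mult_four_block_mat[of _ 1 1 _ m _ m _ _ 1 _ m]) auto
  ultimately have "transpose_mat F * B * F = four_block_mat E (0\<^sub>m 1 m) (0\<^sub>m m 1) (transpose_mat P * D * P)"
    by simp
  also have "\<dots> = mat_diag n (\<lambda>i. (e # es) ! i)"
    unfolding PD n by (rule eq_matI) (auto simp: E_def mat_diag_def nth_Cons')
  finally have FBF: "transpose_mat F * B * F = mat_diag n (\<lambda>i. (e # es) ! i)" .
  show ?case
  proof (intro exI[of _ "W * F"] conjI)
    show "W * F \<in> carrier_mat n n" using W F by auto
    have T: "transpose_mat (W * F) = transpose_mat F * W" using W F WT by (simp add: transpose_mult)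
    have "transpose_mat (W * F) * (W * F) = transpose_mat F * (W * W) * F"
      unfolding T using W F by (simp add: assoc_mult_mat[of _ n n _ n _ n])
    then show "transpose_mat (W * F) * (W * F) = 1\<^sub>m n" unfolding WW using F FF by simp
    have "transpose_mat (W * F) * A * (W * F) = transpose_mat F * B * F"
      unfolding T B_def using W F A by (simp add: assoc_mult_mat[of _ n n _ n _ n])
    then show "transpose_mat (W * F) * A * (W * F) = mat_diag n (\<lambda>i. (e # es) ! i)" using FBF by simp
  qed
qed

text \<open>Over the complex numbers the polynomial splits. For an eigenvector \<open>x\<close> with
  eigenvalue \<open>a\<close>, the number \<open>z\<close>, which is the Hermitian form of
  \<open>A\<close> at \<open>x\<close>, is its own conjugate and equals \<open>a\<close> times the
  squared norm of \<open>x\<close>; hence \<open>a\<close> is real.\<close>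

lemma real_symmetric_char_poly_splits:
  fixes A :: "real mat"
  assumes A: "A \<in> carrier_mat n n" and sym: "transpose_mat A = A"
  shows "\<exists>es. char_poly A = (\<Prod>a\<leftarrow>es. [:- a, 1:])"
proof -
  let ?C = "map_mat complex_of_real A"
  have C: "?C \<in> carrier_mat n n" using A by auto
  have cpC: "char_poly ?C = map_poly complex_of_real (char_poly A)"
    using of_real_hom.char_poly_hom[OF A] by simp
  obtain as where as: "char_poly ?C = (\<Prod>a\<leftarrow>as. [:- a, 1:])"
    using char_poly_factorized[OF C] by blast
  have real: "cnj a = a" if "a \<in> set as" for a
  proof -
    have "poly (char_poly ?C) a = 0" unfolding as using that
      by (induction as) auto
    then obtain x where x: "x \<in> carrier_vec n" "x \<noteq> 0\<^sub>v n" "?C *\<^sub>v x = a \<cdot>\<^sub>v x"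
      using A eigenvalue_root_char_poly[OF C] unfolding eigenvalue_def eigenvector_def by auto
    have row: "(\<Sum>j<n. complex_of_real (A $$ (i,j)) * x $ j) = a * x $ i" if "i < n" for i
      using arg_cong[OF x(3), of "\<lambda>y. y $ i"] that x(1) A
      by (simp add: scalar_prod_def atLeast0LessThan)
    define z where "z = (\<Sum>i<n. \<Sum>j<n. cnj (x $ i) * complex_of_real (A $$ (i,j)) * x $ j)"
    define w where "w = (\<Sum>i<n. (cmod (x $ i))\<^sup>2)"
    have "z = (\<Sum>i<n. cnj (x $ i) * (\<Sum>j<n. complex_of_real (A $$ (i,j)) * x $ j))"
      unfolding z_def by (simp add: sum_distrib_left mult.assoc)
    also have "\<dots> = (\<Sum>i<n. a * complex_of_real ((cmod (x $ i))\<^sup>2))"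
    proof (rule sum.cong)
      fix i assume "i \<in> {..<n}"
      then show "cnj (x $ i) * (\<Sum>j<n. complex_of_real (A $$ (i,j)) * x $ j) = a * complex_of_real ((cmod (x $ i))\<^sup>2)"
        using row[of i] by (simp only: complex_norm_square lessThan_iff) (simp add: mult_ac)
    qed simp
    finally have z: "z = a * complex_of_real w" unfolding w_def by (simp add: sum_distrib_left)
    have "cnj z = (\<Sum>i<n. \<Sum>j<n. cnj (x $ j) * complex_of_real (A $$ (i,j)) * x $ i)"
      unfolding z_def by (simp add: mult_ac)
    also have "\<dots> = (\<Sum>j<n. \<Sum>i<n. cnj (x $ j) * complex_of_real (A $$ (i,j)) * x $ i)"
      by (rule sum.swap)
    also have "\<dots> = z" unfolding z_def
    proof (intro sum.cong refl)
      fix i j assume "i \<in> {..<n}" "j \<in> {..<n}"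
      then have "A $$ (j,i) = A $$ (i,j)" using sym A by (metis carrier_matD index_transpose_mat(1) lessThan_iff)
      then show "cnj (x $ i) * complex_of_real (A $$ (j, i)) * x $ j = cnj (x $ i) * complex_of_real (A $$ (i, j)) * x $ j" by simp
    qed
    finally have "cnj a * complex_of_real w = a * complex_of_real w" using z by simp
    moreover have "w \<noteq> 0"
    proof
      assume "w = 0"
      then have "\<forall>i<n. x $ i = 0" unfolding w_def by (subst (asm) sum_nonneg_eq_0_iff) auto
      then have "x = 0\<^sub>v n" using x(1) by (intro eq_vecI) auto
      then show False using x(2) by simp
    qed
    ultimately show ?thesis by simp
  qed
  have "map_poly complex_of_real (\<Prod>a\<leftarrow>map Re as. [:- a, 1:]) = (\<Prod>a\<leftarrow>as. [:- a, 1:])"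
    using real
  proof (induction as)
    case (Cons a as)
    interpret h: map_poly_comm_ring_hom complex_of_real ..
    have "complex_of_real (Re a) = a" using Cons.prems[of a] by (simp add: complex_eq_iff)
    then have l: "map_poly complex_of_real [:- Re a, 1:] = [:- a, 1:]" by (simp add: map_poly_pCons)
    have "map_poly complex_of_real (\<Prod>a\<leftarrow>map Re as. [:- a, 1:]) = (\<Prod>a\<leftarrow>as. [:- a, 1:])"
      by (rule Cons.IH) (rule Cons.prems, simp)
    then show ?case by (simp only: list.map prod_list.Cons h.hom_mult l)
  qed simp
  then have "map_poly complex_of_real (char_poly A) = map_poly complex_of_real (\<Prod>a\<leftarrow>map Re as. [:- a, 1:])"
    using as cpC by simp
  then have "char_poly A = (\<Prod>a\<leftarrow>map Re as. [:- a, 1:])"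
  proof (intro poly_eqI)
    fix i assume "map_poly complex_of_real (char_poly A) = map_poly complex_of_real (\<Prod>a\<leftarrow>map Re as. [:- a, 1:])"
    from arg_cong[OF this, of "\<lambda>p. coeff p i"]
    show "coeff (char_poly A) i = coeff (\<Prod>a\<leftarrow>map Re as. [:- a, 1:]) i"
      by (simp only: coeff_map_poly of_real_0 of_real_eq_iff)
  qed
  then show ?thesis by blast
qed

text \<open>\<open>proots\<close> collects real roots only; the splitting over the reals is what
  makes the list complete, so that indices below \<open>n\<close> really address
  eigenvalues.\<close>

lemma eigenvalue_list_real_symmetric:
  fixes A :: "real mat"
  assumes A: "A \<in> carrier_mat n n" and sym: "transpose_mat A = A"
  shows "char_poly A = (\<Prod>a\<leftarrow>eigenvalue_list A. [:- a, 1:])"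
    and "length (eigenvalue_list A) = n"
    and "i \<le> j \<Longrightarrow> j < n \<Longrightarrow> eigenvalue_list A ! j \<le> eigenvalue_list A ! i"
proof -
  obtain es where es: "char_poly A = (\<Prod>a\<leftarrow>es. [:- a, 1:])"
    using real_symmetric_char_poly_splits[OF assms] by blast
  have "proots (char_poly A) = mset es" unfolding es
  proof (induction es)
    case (Cons a es)
    have "(\<Prod>a\<leftarrow>es. [:- a, 1:]) \<noteq> 0" by (auto simp: prod_list_zero_iff)
    then have "proots ([:- a, 1:] * (\<Prod>a\<leftarrow>es. [:- a, 1:])) = proots [:- a, 1:] + proots (\<Prod>a\<leftarrow>es. [:- a, 1:])"
      by (intro proots_mult) auto
    then show ?case using Cons by simp
  qed simp
  then have ms: "mset (eigenvalue_list A) = mset es" unfolding eigenvalue_list_def by simp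
  have "mset (map (\<lambda>a. [:- a, 1:]) (eigenvalue_list A)) = mset (map (\<lambda>a. [:- a, 1:]) es)"
    using ms by simp
  then show cp: "char_poly A = (\<Prod>a\<leftarrow>eigenvalue_list A. [:- a, 1:])"
    unfolding es by (metis prod_mset_prod_list)
  show len: "length (eigenvalue_list A) = n" by (rule prod_list_linear_factors_length[OF A cp])
  have "sorted (rev (eigenvalue_list A))" unfolding eigenvalue_list_def by simp
  then show "i \<le> j \<Longrightarrow> j < n \<Longrightarrow> eigenvalue_list A ! j \<le> eigenvalue_list A ! i"
    using len by (simp add: sorted_rev_iff_nth_mono)
qed

section \<open>Quadratic forms and extremal eigenvalues\<close>

definition qform :: "'a set \<Rightarrow> ('a \<Rightarrow> 'a \<Rightarrow> real) \<Rightarrow> ('a \<Rightarrow> real) \<Rightarrow> real" where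
  "qform V f x = (\<Sum>u\<in>V. \<Sum>v\<in>V. f u v * x u * x v)"

definition sqnorm :: "'a set \<Rightarrow> ('a \<Rightarrow> real) \<Rightarrow> real" where
  "sqnorm V x = (\<Sum>v\<in>V. (x v)\<^sup>2)"

text \<open>The bridge from functions on vertices to matrices. Forms and test vectors stay indexed
  by vertices; the enumeration \<open>vs\<close> enters only here.\<close>

definition fun_mat :: "'a list \<Rightarrow> ('a \<Rightarrow> 'a \<Rightarrow> real) \<Rightarrow> real mat" where
  "fun_mat vs f = mat (length vs) (length vs) (\<lambda>(i, j). f (vs ! i) (vs ! j))"

lemma sum_set_conv_nth:
  assumes "distinct vs"
  shows "(\<Sum>v\<in>set vs. g v) = (\<Sum>i<length vs. g (vs ! i))"
  by (rule sum.reindex_bij_betw[symmetric]) (rule bij_betw_nth[OF assms], auto)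

lemma fun_mat_carrier [simp]: "fun_mat vs f \<in> carrier_mat (length vs) (length vs)"
  unfolding fun_mat_def by simp

lemma transpose_fun_mat:
  assumes "\<And>u v. u \<in> set vs \<Longrightarrow> v \<in> set vs \<Longrightarrow> f u v = f v u"
  shows "transpose_mat (fun_mat vs f) = fun_mat vs f"
  unfolding fun_mat_def by (rule eq_matI) (auto intro: assms)

locale symmetric_form =
  fixes vs :: "'a list" and f :: "'a \<Rightarrow> 'a \<Rightarrow> real"
  assumes dist: "distinct vs"
    and symf: "\<And>u v. u \<in> set vs \<Longrightarrow> v \<in> set vs \<Longrightarrow> f u v = f v u"
begin

abbreviation "V \<equiv> set vs"
abbreviation "n \<equiv> length vs"
abbreviation "es \<equiv> eigenvalue_list (fun_mat vs f)"

lemma transpose_form_mat: "transpose_mat (fun_mat vs f) = fun_mat vs f"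
  by (rule transpose_fun_mat) (rule symf)

lemmas es_facts = eigenvalue_list_real_symmetric[OF fun_mat_carrier[of vs f] transpose_form_mat]

lemma spectral_basis:
  obtains c :: "nat \<Rightarrow> 'a \<Rightarrow> real" where
    "\<And>k l. k < n \<Longrightarrow> l < n \<Longrightarrow> (\<Sum>v\<in>V. c k v * c l v) = (if k = l then 1 else 0)"
    "\<And>u v. u \<in> V \<Longrightarrow> v \<in> V \<Longrightarrow> (\<Sum>k<n. c k u * c k v) = (if u = v then 1 else 0)"
    "\<And>u v. u \<in> V \<Longrightarrow> v \<in> V \<Longrightarrow> f u v = (\<Sum>k<n. es ! k * c k u * c k v)"
proof -
  define A where "A = fun_mat vs f"
  define D where "D = mat_diag n (\<lambda>i. es ! i)"
  have Ac: "A \<in> carrier_mat n n" unfolding A_def by simp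
  obtain P where P: "P \<in> carrier_mat n n" and PP: "transpose_mat P * P = 1\<^sub>m n"
    and PA: "transpose_mat P * A * P = D"
    using real_symmetric_diagonalization[OF fun_mat_carrier transpose_form_mat es_facts(1)]
    unfolding A_def D_def by metis
  have PP': "P * transpose_mat P = 1\<^sub>m n"
    using mat_mult_left_right_inverse[OF _ P PP] P by auto
  have "P * (transpose_mat P * A * P) * transpose_mat P = (P * transpose_mat P) * A * (P * transpose_mat P)"
    using P Ac by (simp add: assoc_mult_mat[of _ n n _ n _ n])
  moreover define M where "M = P * D"
  ultimately have A: "A = M * transpose_mat P" unfolding PA PP' using Ac by simp
  have M: "M \<in> carrier_mat n n" unfolding M_def D_def using P by simp
  define idx where "idx = inv_into {..<n} ((!) vs)"
  have idx: "idx (vs ! i) = i" if "i < n" for i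
    unfolding idx_def using that dist by (intro inv_into_f_f) (auto simp: inj_on_def nth_eq_iff_index_eq)
  define c where "c k v = P $$ (idx v, k)" for k v
  have c: "c k (vs ! i) = P $$ (i, k)" if "i < n" for i k unfolding c_def using idx that by simp
  show ?thesis
  proof (rule that[of c])
    fix k l assume kl: "k < n" "l < n"
    have "(\<Sum>v\<in>V. c k v * c l v) = (transpose_mat P * P) $$ (k, l)"
      unfolding sum_set_conv_nth[OF dist] using kl P
      by (simp add: scalar_prod_def c atLeast0LessThan)
    then show "(\<Sum>v\<in>V. c k v * c l v) = (if k = l then 1 else 0)" unfolding PP using kl by simp
  next
    fix u v assume "u \<in> V" "v \<in> V"
    then obtain i j where ij: "i < n" "j < n" "u = vs ! i" "v = vs ! j" by (metis in_set_conv_nth)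
    have "(\<Sum>k<n. c k u * c k v) = (P * transpose_mat P) $$ (i, j)"
      using ij P by (simp add: scalar_prod_def c atLeast0LessThan)
    also have "\<dots> = (if u = v then 1 else 0)"
      unfolding PP' using ij dist by (simp add: nth_eq_iff_index_eq)
    finally show "(\<Sum>k<n. c k u * c k v) = (if u = v then 1 else 0)" .
    have "f u v = A $$ (i, j)" using ij unfolding A_def fun_mat_def by simp
    also have "\<dots> = (\<Sum>k<n. M $$ (i, k) * P $$ (j, k))"
      unfolding A using ij P M by (simp add: scalar_prod_def atLeast0LessThan)
    also have "\<dots> = (\<Sum>k<n. es ! k * c k u * c k v)"
      using ij P c by (intro sum.cong) (auto simp: M_def D_def mat_diag_mult_right[OF P])
    finally show "f u v = (\<Sum>k<n. es ! k * c k u * c k v)" .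
  qed
qed

text \<open>\<open>y x k\<close> is the coordinate of \<open>x\<close> along the \<open>k\<close>-th
  vector \<open>c k\<close> of an orthonormal eigenbasis, so the form becomes diagonal. Linearity of
  \<open>y\<close> is what the two-dimensional tests need in order to find a vector of a plane with
  one coordinate equal to 0.\<close>

lemma spectral_coordinates:
  obtains y :: "('a \<Rightarrow> real) \<Rightarrow> nat \<Rightarrow> real" and c :: "nat \<Rightarrow> 'a \<Rightarrow> real" where
    "\<And>x. qform V f x = (\<Sum>k<n. es ! k * (y x k)\<^sup>2)"
    "\<And>x. sqnorm V x = (\<Sum>k<n. (y x k)\<^sup>2)"
    "\<And>a b x z k. y (\<lambda>v. a * x v + b * z v) k = a * y x k + b * y z k"
    "\<And>k. k < n \<Longrightarrow> qform V f (c k) = es ! k"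
    "(\<Sum>v\<in>V. f v v) = (\<Sum>k<n. es ! k)"
proof -
  obtain c where c: "\<And>k l. k < n \<Longrightarrow> l < n \<Longrightarrow> (\<Sum>v\<in>V. c k v * c l v) = (if k = l then 1 else 0)"
    "\<And>u v. u \<in> V \<Longrightarrow> v \<in> V \<Longrightarrow> (\<Sum>k<n. c k u * c k v) = (if u = v then 1 else 0)"
    "\<And>u v. u \<in> V \<Longrightarrow> v \<in> V \<Longrightarrow> f u v = (\<Sum>k<n. es ! k * c k u * c k v)"
    using spectral_basis by blast
  define y where "y x k = (\<Sum>v\<in>V. c k v * x v)" for x k
  have sq: "(y x k)\<^sup>2 = (\<Sum>u\<in>V. \<Sum>v\<in>V. c k u * c k v * x u * x v)" for x k
    unfolding y_def power2_eq_square sum_product by (simp add: mult_ac)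
  have q: "qform V f x = (\<Sum>k<n. es ! k * (y x k)\<^sup>2)" for x
  proof -
    have "qform V f x = (\<Sum>u\<in>V. \<Sum>v\<in>V. \<Sum>k<n. es ! k * c k u * c k v * x u * x v)"
      unfolding qform_def by (intro sum.cong refl) (simp add: c(3) sum_distrib_right)
    also have "\<dots> = (\<Sum>u\<in>V. \<Sum>k<n. \<Sum>v\<in>V. es ! k * c k u * c k v * x u * x v)"
      by (intro sum.cong refl) (rule sum.swap)
    also have "\<dots> = (\<Sum>k<n. \<Sum>u\<in>V. \<Sum>v\<in>V. es ! k * c k u * c k v * x u * x v)"
      by (rule sum.swap)
    also have "\<dots> = (\<Sum>k<n. es ! k * (y x k)\<^sup>2)"
      unfolding sq sum_distrib_left by (simp add: mult_ac)
    finally show ?thesis .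
  qed
  show ?thesis
  proof (rule that[of y c])
    show "qform V f x = (\<Sum>k<n. es ! k * (y x k)\<^sup>2)" for x by (rule q)
    show "sqnorm V x = (\<Sum>k<n. (y x k)\<^sup>2)" for x
    proof -
      have "(\<Sum>k<n. (y x k)\<^sup>2) = (\<Sum>u\<in>V. \<Sum>k<n. \<Sum>v\<in>V. c k u * c k v * x u * x v)"
        unfolding sq by (rule sum.swap)
      also have "\<dots> = (\<Sum>u\<in>V. \<Sum>v\<in>V. \<Sum>k<n. c k u * c k v * x u * x v)"
        by (intro sum.cong refl) (rule sum.swap)
      also have "\<dots> = (\<Sum>u\<in>V. \<Sum>v\<in>V. (if u = v then 1 else 0) * x u * x v)"
        unfolding sum_distrib_right[symmetric] using c(2) by (intro sum.cong refl) auto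
      also have "\<dots> = (\<Sum>u\<in>V. \<Sum>v\<in>V. if u = v then x u * x v else 0)"
        by (intro sum.cong refl) auto
      also have "\<dots> = sqnorm V x"
        unfolding sqnorm_def by (intro sum.cong refl) (simp add: power2_eq_square)
      finally show ?thesis by simp
    qed
    show "y (\<lambda>v. a * x v + b * z v) k = a * y x k + b * y z k" for a b x z k
      unfolding y_def by (simp add: algebra_simps sum.distrib sum_distrib_left)
    show "qform V f (c k) = es ! k" if "k < n" for k
    proof -
      have "qform V f (c k) = (\<Sum>l<n. if l = k then es ! k else 0)"
        unfolding q y_def using that by (intro sum.cong refl) (simp add: c(1))
      then show ?thesis using that by simp
    qed
    have "(\<Sum>v\<in>V. f v v) = (\<Sum>v\<in>V. \<Sum>k<n. es ! k * (c k v * c k v))"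
      by (intro sum.cong refl) (simp add: c(3) mult.assoc)
    also have "\<dots> = (\<Sum>k<n. es ! k * (\<Sum>v\<in>V. c k v * c k v))"
      unfolding sum_distrib_left by (rule sum.swap)
    finally show "(\<Sum>v\<in>V. f v v) = (\<Sum>k<n. es ! k)" by (simp add: c(1))
  qed
qed

lemma sum_eigenvalues: "(\<Sum>k<n. es ! k) = (\<Sum>v\<in>V. f v v)"
  by (rule spectral_coordinates) (rule sym)

lemma eigenvalues_nonneg:
  assumes "\<And>x. qform V f x \<ge> 0" "k < n"
  shows "es ! k \<ge> 0"
proof -
  obtain y c where q: "\<And>x. qform V f x = (\<Sum>k<n. es ! k * (y x k)\<^sup>2)"
    and s: "\<And>x. sqnorm V x = (\<Sum>k<n. (y x k :: real)\<^sup>2)"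
    and lin: "\<And>a b x z k. y (\<lambda>v. a * x v + b * z v) k = a * y x k + b * y z k"
    and c: "\<And>k. k < n \<Longrightarrow> qform V f (c k) = es ! k" and tr: "(\<Sum>v\<in>V. f v v) = (\<Sum>k<n. es ! k)"
    by (rule spectral_coordinates, rule that)
  show ?thesis using c[OF assms(2)] assms(1)[of "c k"] by simp
qed

lemma largest_eigenvalue_ge:
  assumes "sqnorm V x > 0" "qform V f x \<ge> C * sqnorm V x"
  shows "es ! 0 \<ge> C"
proof -
  obtain y c where q: "\<And>x. qform V f x = (\<Sum>k<n. es ! k * (y x k)\<^sup>2)"
    and s: "\<And>x. sqnorm V x = (\<Sum>k<n. (y x k :: real)\<^sup>2)"
    and lin: "\<And>a b x z k. y (\<lambda>v. a * x v + b * z v) k = a * y x k + b * y z k"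
    and c: "\<And>k. k < n \<Longrightarrow> qform V f (c k) = es ! k" and tr: "(\<Sum>v\<in>V. f v v) = (\<Sum>k<n. es ! k)"
    by (rule spectral_coordinates, rule that)
  have "C * sqnorm V x \<le> es ! 0 * sqnorm V x"
    using assms(2) unfolding q s sum_distrib_left
    by (rule order_trans) (intro sum_mono mult_right_mono es_facts(3), auto)
  then show ?thesis using assms(1) by simp
qed

lemma largest_eigenvalue_gt:
  assumes "sqnorm V x > 0" "qform V f x > C * sqnorm V x"
  shows "es ! 0 > C"
proof -
  have "es ! 0 \<ge> qform V f x / sqnorm V x"
    by (rule largest_eigenvalue_ge[of x]) (use assms in auto)
  moreover have "qform V f x / sqnorm V x > C" using assms by (simp add: field_simps)
  ultimately show ?thesis by simp
qed

lemma smallest_eigenvalue_le: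
  assumes "sqnorm V x > 0" "qform V f x \<le> C * sqnorm V x"
  shows "es ! (n - 1) \<le> C"
proof -
  obtain y c where q: "\<And>x. qform V f x = (\<Sum>k<n. es ! k * (y x k)\<^sup>2)"
    and s: "\<And>x. sqnorm V x = (\<Sum>k<n. (y x k :: real)\<^sup>2)"
    and lin: "\<And>a b x z k. y (\<lambda>v. a * x v + b * z v) k = a * y x k + b * y z k"
    and c: "\<And>k. k < n \<Longrightarrow> qform V f (c k) = es ! k" and tr: "(\<Sum>v\<in>V. f v v) = (\<Sum>k<n. es ! k)"
    by (rule spectral_coordinates, rule that)
  have "es ! (n - 1) * sqnorm V x \<le> qform V f x"
    unfolding q s sum_distrib_left by (intro sum_mono mult_right_mono es_facts(3)) auto
  then show ?thesis using assms by (meson mult_le_cancel_right_pos order_trans)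
qed

text \<open>Courant-Fischer for a plane: some nontrivial combination of \<open>x\<close> and
  \<open>z\<close> has no component along the first eigenvector, and on it the form is at most
  \<open>es ! 1\<close> times the squared norm. The hypothesis \<open>pos\<close> expresses that
  \<open>x\<close> and \<open>z\<close> are linearly independent.\<close>

lemma second_largest_eigenvalue_ge:
  assumes "n \<ge> 2"
    and pos: "\<And>a b. (a, b) \<noteq> (0, 0) \<Longrightarrow> sqnorm V (\<lambda>v. a * x v + b * z v) > 0"
    and form: "\<And>a b. qform V f (\<lambda>v. a * x v + b * z v) \<ge> C * sqnorm V (\<lambda>v. a * x v + b * z v)"
  shows "es ! 1 \<ge> C"
proof -
  obtain y c where q: "\<And>x. qform V f x = (\<Sum>k<n. es ! k * (y x k)\<^sup>2)"
    and s: "\<And>x. sqnorm V x = (\<Sum>k<n. (y x k :: real)\<^sup>2)"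
    and lin: "\<And>a b x z k. y (\<lambda>v. a * x v + b * z v) k = a * y x k + b * y z k"
    and "\<And>k. k < n \<Longrightarrow> qform V f (c k) = es ! k" "(\<Sum>v\<in>V. f v v) = (\<Sum>k<n. es ! k)"
    by (rule spectral_coordinates, rule that)
  obtain a b where ab: "(a, b) \<noteq> (0, 0)" "a * y x 0 + b * y z 0 = 0"
  proof (cases "y x 0 = 0")
    case True
    then show ?thesis using that[of 1 0] by simp
  next
    case False
    then show ?thesis using that[of "y z 0" "- y x 0"] by (simp add: mult.commute)
  qed
  define w where "w = (\<lambda>v. a * x v + b * z v)"
  have w0: "y w 0 = 0" unfolding w_def lin using ab by simp
  have "qform V f w \<le> es ! 1 * sqnorm V w"
    unfolding q s sum_distrib_left
  proof (rule sum_mono)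
    fix k assume k: "k \<in> {..<n}"
    show "es ! k * (y w k)\<^sup>2 \<le> es ! 1 * (y w k)\<^sup>2"
      by (cases "k = 0") (use w0 k in \<open>auto intro!: mult_right_mono es_facts(3)\<close>)
  qed
  then have "C * sqnorm V w \<le> es ! 1 * sqnorm V w" using form[of a b] unfolding w_def by simp
  then show ?thesis using pos[OF ab(1)] unfolding w_def by simp
qed

lemma second_smallest_eigenvalue_le:
  assumes n2: "n \<ge> 2"
    and pos: "\<And>a b. (a, b) \<noteq> (0, 0) \<Longrightarrow> sqnorm V (\<lambda>v. a * x v + b * z v) > 0"
    and form: "\<And>a b. qform V f (\<lambda>v. a * x v + b * z v) \<le> C * sqnorm V (\<lambda>v. a * x v + b * z v)"
  shows "es ! (n - 2) \<le> C"
proof -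
  obtain y c where q: "\<And>x. qform V f x = (\<Sum>k<n. es ! k * (y x k)\<^sup>2)"
    and s: "\<And>x. sqnorm V x = (\<Sum>k<n. (y x k :: real)\<^sup>2)"
    and lin: "\<And>a b x z k. y (\<lambda>v. a * x v + b * z v) k = a * y x k + b * y z k"
    and "\<And>k. k < n \<Longrightarrow> qform V f (c k) = es ! k" "(\<Sum>v\<in>V. f v v) = (\<Sum>k<n. es ! k)"
    by (rule spectral_coordinates, rule that)
  let ?l = "n - 1"
  obtain a b where ab: "(a, b) \<noteq> (0, 0)" "a * y x ?l + b * y z ?l = 0"
  proof (cases "y x ?l = 0")
    case True
    then show ?thesis using that[of 1 0] by simp
  next
    case False
    then show ?thesis using that[of "y z ?l" "- y x ?l"] by (simp add: mult.commute)
  qed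
  define w where "w = (\<lambda>v. a * x v + b * z v)"
  have w0: "y w ?l = 0" unfolding w_def lin using ab by simp
  have "es ! (n - 2) * sqnorm V w \<le> qform V f w"
    unfolding q s sum_distrib_left
  proof (rule sum_mono)
    fix k assume k: "k \<in> {..<n}"
    show "es ! (n - 2) * (y w k)\<^sup>2 \<le> es ! k * (y w k)\<^sup>2"
    proof (cases "k = ?l")
      case False
      then have "k \<le> n - 2" using k n2 by auto
      then show ?thesis using n2 by (intro mult_right_mono es_facts(3)) auto
    qed (simp only: w0, simp)
  qed
  then have "es ! (n - 2) * sqnorm V w \<le> C * sqnorm V w" using form[of a b] unfolding w_def by (rule order_trans)
  moreover have "sqnorm V w > 0" using pos[OF ab(1)] unfolding w_def .
  ultimately show ?thesis by (rule mult_right_le_imp_le)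
qed

end

section \<open>Adjacency and Laplacians as functions on vertices\<close>

definition adj_fun :: "'a ugraph \<Rightarrow> 'a \<Rightarrow> 'a \<Rightarrow> real" where
  "adj_fun G u v = (if {u, v} \<in> edges G then 1 else 0)"

definition laplace_fun :: "'a ugraph \<Rightarrow> 'a \<Rightarrow> 'a \<Rightarrow> real" where
  "laplace_fun G u v = (if u = v then real (vdegree G u) else 0) - adj_fun G u v"

definition signless_fun :: "'a ugraph \<Rightarrow> 'a \<Rightarrow> 'a \<Rightarrow> real" where
  "signless_fun G u v = (if u = v then real (vdegree G u) else 0) + adj_fun G u v"

definition nbrs :: "'a ugraph \<Rightarrow> 'a \<Rightarrow> 'a set" where
  "nbrs G v = {u \<in> verts G. {v, u} \<in> edges G}"

lemma edge_verts:
  assumes "simple_graph G" "{u, v} \<in> edges G"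
  shows "u \<in> verts G" "v \<in> verts G" "u \<noteq> v"
  using assms unfolding simple_graph_def by (auto simp: doubleton_eq_iff)

lemma finite_nbrs: "simple_graph G \<Longrightarrow> finite (nbrs G v)"
  unfolding nbrs_def simple_graph_def by auto

lemma vdegree_eq_card_nbrs:
  assumes "simple_graph G"
  shows "vdegree G v = card (nbrs G v)"
proof -
  have "bij_betw (\<lambda>u. {v, u}) (nbrs G v) {e \<in> edges G. v \<in> e}"
    unfolding bij_betw_def
  proof
    show "inj_on (\<lambda>u. {v, u}) (nbrs G v)" by (auto simp: inj_on_def doubleton_eq_iff)
    show "(\<lambda>u. {v, u}) ` nbrs G v = {e \<in> edges G. v \<in> e}"
    proof (intro equalityI subsetI)
      fix e assume e: "e \<in> {e \<in> edges G. v \<in> e}"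
      then obtain a b where "e = {a, b}" "a \<in> verts G" "b \<in> verts G"
        using assms unfolding simple_graph_def by blast
      then show "e \<in> (\<lambda>u. {v, u}) ` nbrs G v"
        using e unfolding nbrs_def by (auto simp: image_iff insert_commute)
    qed (auto simp: nbrs_def)
  qed
  then show ?thesis unfolding vdegree_def by (simp add: bij_betw_same_card)
qed

lemma sum_adj_fun:
  assumes "simple_graph G"
  shows "(\<Sum>k\<in>verts G. adj_fun G u k) = real (vdegree G u)"
proof -
  have "(\<Sum>k\<in>verts G. adj_fun G u k) = (\<Sum>k\<in>nbrs G u. 1)"
    using assms unfolding adj_fun_def nbrs_def simple_graph_def
    by (intro sum.mono_neutral_cong_right) auto
  then show ?thesis using vdegree_eq_card_nbrs[OF assms] by simp
qed

lemma adj_fun_commute: "adj_fun G u v = adj_fun G v u"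
  unfolding adj_fun_def by (simp add: insert_commute)

lemma adj_fun_self: "simple_graph G \<Longrightarrow> adj_fun G v v = 0"
  unfolding adj_fun_def using edge_verts(3)[of G v v] by auto

section \<open>Parent maps and spanning trees\<close>

text \<open>\<open>d\<close> acts as the depth in a rooted forest: its existence means that
  iterating \<open>\<phi>\<close> from a point of \<open>W\<close> eventually leaves
  \<open>W\<close>. With \<open>W\<close> all vertices but the root, the only exit is the
  root.\<close>

definition well_founded_map :: "'a set \<Rightarrow> ('a \<Rightarrow> 'a) \<Rightarrow> bool" where
  "well_founded_map W \<phi> \<longleftrightarrow> (\<exists>d :: 'a \<Rightarrow> nat. \<forall>w\<in>W. d (\<phi> w) < d w)"

definition parent_edges :: "'a set \<Rightarrow> ('a \<Rightarrow> 'a) \<Rightarrow> 'a set set" where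
  "parent_edges W \<phi> = (\<lambda>w. {w, \<phi> w}) ` W"

lemma path_of_rtrancl:
  assumes "(a, b) \<in> {(x, y). {x, y} \<in> F}\<^sup>*"
  shows "\<exists>p. p \<noteq> [] \<and> hd p = a \<and> last p = b \<and> distinct p \<and> successively (\<lambda>x y. {x, y} \<in> F) p"
  using assms
proof (induction rule: rtrancl_induct)
  case base
  show ?case by (intro exI[of _ "[a]"]) auto
next
  case (step y z)
  then obtain p where p: "p \<noteq> []" "hd p = a" "last p = y" "distinct p"
    "successively (\<lambda>x y. {x, y} \<in> F) p" and yz: "{y, z} \<in> F" by auto
  show ?case
  proof (cases "z \<in> set p")
    case True
    then obtain xs ys where "p = xs @ z # ys" by (meson split_list)
    then show ?thesis using p
      by (intro exI[of _ "xs @ [z]"]) (auto simp: hd_append successively_append_iff)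
  next
    case False
    then show ?thesis using p yz
      by (intro exI[of _ "p @ [z]"]) (auto simp: successively_append_iff)
  qed
qed

lemma parent_edges_connected:
  assumes "well_founded_map (V - {r}) \<phi>" "r \<in> V" "\<And>w. w \<in> V - {r} \<Longrightarrow> \<phi> w \<in> V"
    and "u \<in> V" "v \<in> V"
  shows "(u, v) \<in> {(x, y). {x, y} \<in> parent_edges (V - {r}) \<phi>}\<^sup>*"
proof -
  let ?R = "{(x, y). {x, y} \<in> parent_edges (V - {r}) \<phi>}"
  obtain d :: "'a \<Rightarrow> nat" where d: "\<And>w. w \<in> V - {r} \<Longrightarrow> d (\<phi> w) < d w"
    using assms(1) unfolding well_founded_map_def by blast
  have root: "(v, r) \<in> ?R\<^sup>*" if "v \<in> V" for v
    using that
  proof (induction "d v" arbitrary: v rule: less_induct)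
    case less
    show ?case
    proof (cases "v = r")
      case False
      then have v: "v \<in> V - {r}" using less by simp
      then have "(v, \<phi> v) \<in> ?R" unfolding parent_edges_def by auto
      then show ?thesis using less(1)[OF d[OF v] assms(3)[OF v]] by (rule converse_rtrancl_into_rtrancl)
    qed simp
  qed
  have "sym ?R" by (auto intro!: symI simp: insert_commute)
  then have "sym (?R\<^sup>*)" by (rule sym_rtrancl)
  then have "(r, v) \<in> ?R\<^sup>*" using root[OF assms(5)] by (rule symD)
  then show ?thesis using root[OF assms(4)] by simp
qed

text \<open>Take a vertex of maximal rank on the cycle. It is not the parent of a cycle neighbour,
  since a parent has smaller rank; so both of its cycle neighbours are its parent, although they are
  distinct because the length is at least 3.\<close>

lemma parent_edges_acyclic:
  assumes "well_founded_map W \<phi>"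
  shows "\<not> is_cycle \<lparr>verts = V, edges = parent_edges W \<phi>\<rparr> p"
proof
  assume "is_cycle \<lparr>verts = V, edges = parent_edges W \<phi>\<rparr> p"
  then have len: "3 \<le> length p" and dist: "distinct p"
    and edge: "\<And>i. i < length p \<Longrightarrow> {p ! i, p ! (Suc i mod length p)} \<in> parent_edges W \<phi>"
    unfolding is_cycle_def by auto
  obtain d :: "'a \<Rightarrow> nat" where d: "\<And>w. w \<in> W \<Longrightarrow> d (\<phi> w) < d w"
    using assms unfolding well_founded_map_def by blast
  let ?L = "length p"
  let ?M = "(\<lambda>i. d (p ! i)) ` {..<?L}"
  have fin: "finite ?M" by simp
  have "0 < ?L" using len by linarith
  then have "0 \<in> {..<?L}" by blast
  then have "?M \<noteq> {}" by blast
  then have "Max ?M \<in> ?M" using fin by (intro Max_in)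
  then obtain i where i: "i < ?L" "Max ?M = d (p ! i)" by auto
  have max: "d (p ! j) \<le> d (p ! i)" if "j < ?L" for j
    unfolding i(2)[symmetric] by (rule Max_ge[OF fin]) (use that in simp)
  have parent: "y = \<phi> (p ! i)" if a: "{p ! i, y} \<in> parent_edges W \<phi>" "y = p ! j" "j < ?L" for y j
  proof -
    obtain w where w: "w \<in> W" "{p ! i, y} = {w, \<phi> w}" using a(1) unfolding parent_edges_def by auto
    then show ?thesis using d[OF w(1)] max[OF a(3)] a(2) by (auto simp: doubleton_eq_iff)
  qed
  define j where "j = (if i = 0 then ?L - 1 else i - 1)"
  have j: "j < ?L" "Suc j mod ?L = i" using i(1) len unfolding j_def by auto
  have k: "Suc i mod ?L < ?L" using len by (intro mod_less_divisor) linarith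
  have "j \<noteq> Suc i mod ?L"
    using i(1) len unfolding j_def by (cases "Suc i = ?L") auto
  moreover have "p ! (Suc i mod ?L) = \<phi> (p ! i)" using parent[OF edge[OF i(1)] refl k] .
  moreover have "p ! j = \<phi> (p ! i)"
    using parent[of "p ! j" j] edge[OF j(1)] j by (simp add: insert_commute)
  ultimately show False using nth_eq_iff_index_eq[OF dist j(1) k] by simp
qed

text \<open>Expanding every row of the reduced Laplacian along the edges at its vertex yields one summand
  per choice of a neighbour of each non-root vertex; exactly the well-founded choices survive.\<close>

definition parent_maps :: "'a ugraph \<Rightarrow> 'a \<Rightarrow> ('a \<Rightarrow> 'a) set" where
  "parent_maps G r = {\<phi> \<in> PiE (verts G - {r}) (\<lambda>_. verts G).
     (\<forall>w\<in>verts G - {r}. {w, \<phi> w} \<in> edges G) \<and> well_founded_map (verts G - {r}) \<phi>}"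

text \<open>Induction on the rank. If the edge between \<open>w\<close> and \<open>\<phi> w\<close>
  arose under \<open>\<psi>\<close> from its other end, then \<open>\<psi>\<close> would send
  \<open>\<phi> w\<close> back to \<open>w\<close>; by induction so would \<open>\<phi>\<close>, and
  ranks would decrease in a circle.\<close>

lemma parent_edges_inj:
  assumes "well_founded_map W \<phi>" "parent_edges W \<phi> = parent_edges W \<psi>" "w \<in> W"
  shows "\<phi> w = \<psi> w"
proof -
  obtain d :: "'a \<Rightarrow> nat" where d: "\<And>w. w \<in> W \<Longrightarrow> d (\<phi> w) < d w"
    using assms(1) unfolding well_founded_map_def by blast
  show ?thesis using assms(3)
  proof (induction "d w" arbitrary: w rule: less_induct)
    case less
    have "{w, \<phi> w} \<in> parent_edges W \<psi>"
      using less(2) assms(2) unfolding parent_edges_def by blast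
    then obtain w' where w': "w' \<in> W" "{w, \<phi> w} = {w', \<psi> w'}" unfolding parent_edges_def by auto
    show ?case
    proof (rule ccontr)
      assume "\<phi> w \<noteq> \<psi> w"
      then have e: "\<phi> w = w'" "\<psi> w' = w" using w'(2) by (auto simp: doubleton_eq_iff)
      then have "\<phi> w' = w" using less(1)[of w'] d[OF less(2)] w'(1) by simp
      then show False using d[OF less(2)] d[OF w'(1)] e by simp
    qed
  qed
qed

text \<open>Each vertex chooses a neighbour in \<open>F\<close> that is closer to \<open>r\<close>.
  The chosen edges already connect everything, so an edge of \<open>F\<close> outside them would
  close a path of chosen edges to a cycle in \<open>F\<close>.\<close>

lemma spanning_tree_parent_map:
  assumes sg: "simple_graph G" and r: "r \<in> verts G" and F: "F \<subseteq> edges G"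
    and tree: "is_tree \<lparr>verts = verts G, edges = F\<rparr>"
  shows "\<exists>\<phi>\<in>parent_maps G r. parent_edges (verts G - {r}) \<phi> = F"
proof -
  let ?V = "verts G" and ?W = "verts G - {r}"
  let ?R = "{(x, y). {x, y} \<in> F}"
  have conn: "(u, v) \<in> ?R\<^sup>*" if "u \<in> ?V" "v \<in> ?V" for u v
    using tree that unfolding is_tree_def connected_graph_def by simp
  define dist where "dist v = (LEAST k. (v, r) \<in> ?R ^^ k)" for v
  have ex: "\<exists>y. {w, y} \<in> F \<and> dist y < dist w" if w: "w \<in> ?W" for w
  proof -
    have "\<exists>k. (w, r) \<in> ?R ^^ k" using conn[of w r] w r by (auto intro: rtrancl_imp_relpow)
    then have l: "(w, r) \<in> ?R ^^ dist w" unfolding dist_def by (rule LeastI_ex)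
    then have "dist w \<noteq> 0" using w by (metis DiffE relpow_0_E singletonI)
    then obtain k where k: "dist w = Suc k" by (cases "dist w") auto
    then obtain y where "(w, y) \<in> ?R" "(y, r) \<in> ?R ^^ k" using l relpow_Suc_D2[of w r k ?R] by auto
    then show ?thesis using k unfolding dist_def
      by (intro exI[of _ y]) (auto intro: Least_le le_imp_less_Suc)
  qed
  \<comment> \<open>Restriction makes the map extensional; otherwise one tree would correspond to
    many maps differing at the root or outside the graph.\<close>
  define \<phi> where "\<phi> = restrict (\<lambda>w. SOME y. {w, y} \<in> F \<and> dist y < dist w) ?W"
  have \<phi>: "{w, \<phi> w} \<in> F" "dist (\<phi> w) < dist w" if "w \<in> ?W" for w
    using someI_ex[OF ex[OF that]] that unfolding \<phi>_def by auto
  have \<phi>V: "\<phi> w \<in> ?V" if "w \<in> ?W" for w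
    using \<phi>(1)[OF that] F edge_verts[OF sg] by blast
  have wf: "well_founded_map ?W \<phi>" unfolding well_founded_map_def using \<phi>(2) by blast
  have "\<phi> \<in> parent_maps G r"
    unfolding parent_maps_def using wf \<phi>(1) \<phi>V F by (auto simp: \<phi>_def)
  moreover have sub: "parent_edges ?W \<phi> \<subseteq> F" unfolding parent_edges_def using \<phi>(1) by auto
  moreover have "F \<subseteq> parent_edges ?W \<phi>"
  proof (rule ccontr)
    assume "\<not> F \<subseteq> parent_edges ?W \<phi>"
    then obtain e where e: "e \<in> F" "e \<notin> parent_edges ?W \<phi>" by blast
    then obtain a b where ab: "e = {a, b}" "a \<in> ?V" "b \<in> ?V" "a \<noteq> b"
      using F sg unfolding simple_graph_def by blast
    have "(a, b) \<in> {(x, y). {x, y} \<in> parent_edges ?W \<phi>}\<^sup>*"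
      by (rule parent_edges_connected[OF wf r \<phi>V ab(2,3)])
    then obtain p where p: "p \<noteq> []" "hd p = a" "last p = b" "distinct p"
      "successively (\<lambda>x y. {x, y} \<in> parent_edges ?W \<phi>) p" using path_of_rtrancl by metis
    have nth: "{p ! i, p ! Suc i} \<in> parent_edges ?W \<phi>" if "Suc i < length p" for i
      using p(5) that by (rule successively_nth)
    have ends: "p ! 0 = a" "p ! (length p - 1) = b" using p by (auto simp: hd_conv_nth last_conv_nth)
    have "length p \<noteq> 1" using ends ab by auto
    moreover have "length p \<noteq> 2" using nth[of 0] ends e ab by auto
    moreover have "length p \<noteq> 0" using p by simp
    ultimately have len: "3 \<le> length p" by linarith
    have "is_cycle \<lparr>verts = ?V, edges = F\<rparr> p"
      unfolding is_cycle_def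
    proof (intro conjI allI impI)
      fix i assume i: "i < length p"
      show "{p ! i, p ! (Suc i mod length p)} \<in> edges \<lparr>verts = ?V, edges = F\<rparr>"
      proof (cases "Suc i < length p")
        case True
        then show ?thesis using nth sub by auto
      next
        case False
        then have "i = length p - 1" "Suc i = length p" using i by auto
        then show ?thesis using ends e ab by (simp add: insert_commute)
      qed
    qed (use len p in auto)
    then show False using tree unfolding is_tree_def by blast
  qed
  ultimately show ?thesis by blast
qed

lemma card_parent_maps:
  assumes sg: "simple_graph G" and r: "r \<in> verts G"
  shows "card (parent_maps G r) = num_spanning_trees G"
proof -
  let ?W = "verts G - {r}"
  have "bij_betw (parent_edges ?W) (parent_maps G r)
      {F. F \<subseteq> edges G \<and> is_tree \<lparr>verts = verts G, edges = F\<rparr>}"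
    unfolding bij_betw_def
  proof
    show "inj_on (parent_edges ?W) (parent_maps G r)"
    proof (rule inj_onI)
      fix \<phi> \<psi> assume a: "\<phi> \<in> parent_maps G r" "\<psi> \<in> parent_maps G r" "parent_edges ?W \<phi> = parent_edges ?W \<psi>"
      then have "\<phi> \<in> PiE ?W (\<lambda>_. verts G)" "\<psi> \<in> PiE ?W (\<lambda>_. verts G)" "well_founded_map ?W \<phi>"
        unfolding parent_maps_def by auto
      then show "\<phi> = \<psi>" using parent_edges_inj[OF _ a(3)] by (intro PiE_ext) auto
    qed
    show "parent_edges ?W ` parent_maps G r = {F. F \<subseteq> edges G \<and> is_tree \<lparr>verts = verts G, edges = F\<rparr>}"
    proof (intro equalityI subsetI)
      fix F assume "F \<in> parent_edges ?W ` parent_maps G r"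
      then obtain \<phi> where \<phi>: "\<phi> \<in> parent_maps G r" "F = parent_edges ?W \<phi>" by auto
      then have FE: "F \<subseteq> edges G" and wf: "well_founded_map ?W \<phi>" and V: "\<And>w. w \<in> ?W \<Longrightarrow> \<phi> w \<in> verts G"
        unfolding parent_maps_def parent_edges_def by auto
      have "is_tree \<lparr>verts = verts G, edges = F\<rparr>"
        unfolding is_tree_def
      proof (intro conjI)
        show "simple_graph \<lparr>verts = verts G, edges = F\<rparr>"
          using sg FE unfolding simple_graph_def by auto
        show "connected_graph \<lparr>verts = verts G, edges = F\<rparr>"
          unfolding connected_graph_def using parent_edges_connected[OF wf r V] r \<phi>(2) by auto
        show "\<nexists>p. is_cycle \<lparr>verts = verts G, edges = F\<rparr> p"
          unfolding \<phi>(2) using parent_edges_acyclic[OF wf] by blast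
      qed
      then show "F \<in> {F. F \<subseteq> edges G \<and> is_tree \<lparr>verts = verts G, edges = F\<rparr>}" using FE by simp
    next
      fix F assume "F \<in> {F. F \<subseteq> edges G \<and> is_tree \<lparr>verts = verts G, edges = F\<rparr>}"
      then show "F \<in> parent_edges ?W ` parent_maps G r"
        using spanning_tree_parent_map[OF sg r, of F] by auto
    qed
  qed
  then show ?thesis unfolding num_spanning_trees_def by (simp add: bij_betw_same_card)
qed

section \<open>The matrix-tree theorem\<close>

lemma det_fun_mat:
  "det (fun_mat ws f) =
     (\<Sum>p | p permutes {0..<length ws}. signof p * (\<Prod>i<length ws. f (ws ! i) (ws ! (p i))))"
proof -
  have "(\<Prod>i = 0..<length ws. fun_mat ws f $$ (i, p i)) = (\<Prod>i<length ws. f (ws ! i) (ws ! (p i)))"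
    if "p permutes {0..<length ws}" for p
    unfolding atLeast0LessThan
    by (rule prod.cong) (use permutes_in_image[OF that] in \<open>auto simp: fun_mat_def\<close>)
  then show ?thesis unfolding det_def'[OF fun_mat_carrier] by simp
qed

lemma prod_set_conv_nth:
  assumes "distinct vs"
  shows "(\<Prod>v\<in>set vs. g v) = (\<Prod>i<length vs. g (vs ! i))"
  by (rule prod.reindex_bij_betw[symmetric]) (rule bij_betw_nth[OF assms], auto)

text \<open>Multilinearity in all rows at once: the distributive law turns a product over rows of
  sums over \<open>K\<close> into a sum over functions \<open>g\<close> that choose one summand per
  row.\<close>

lemma det_fun_mat_row_expansion:
  fixes a :: "'a \<Rightarrow> 'b \<Rightarrow> real" and h :: "'a \<Rightarrow> 'b \<Rightarrow> 'a \<Rightarrow> real"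
  assumes dist: "distinct ws" and fin: "finite K"
  shows "det (fun_mat ws (\<lambda>u v. \<Sum>k\<in>K. a u k * h u k v)) =
    (\<Sum>g\<in>PiE (set ws) (\<lambda>_. K). (\<Prod>w\<in>set ws. a w (g w)) * det (fun_mat ws (\<lambda>u v. h u (g u) v)))"
proof -
  let ?m = "length ws"
  let ?P = "{p. p permutes {0..<?m}}"
  \<comment> \<open>Reindexes the Leibniz products by vertices, so that the choice functions have
    vertices as their domain.\<close>
  define idx where "idx = inv_into {..<?m} ((!) ws)"
  have idx: "idx (ws ! i) = i" if "i < ?m" for i
    unfolding idx_def using that dist by (intro inv_into_f_f) (auto simp: inj_on_def nth_eq_iff_index_eq)
  have det: "det (fun_mat ws F) = (\<Sum>p\<in>?P. signof p * (\<Prod>w\<in>set ws. F w (ws ! (p (idx w)))))" for F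
  proof -
    have "(\<Prod>i<?m. F (ws ! i) (ws ! (p i))) = (\<Prod>w\<in>set ws. F w (ws ! (p (idx w))))" for p
      unfolding prod_set_conv_nth[OF dist] using idx by (intro prod.cong) auto
    then show ?thesis unfolding det_fun_mat by simp
  qed
  have "det (fun_mat ws (\<lambda>u v. \<Sum>k\<in>K. a u k * h u k v)) =
    (\<Sum>p\<in>?P. signof p * (\<Sum>g\<in>PiE (set ws) (\<lambda>_. K). \<Prod>w\<in>set ws. a w (g w) * h w (g w) (ws ! (p (idx w)))))"
    unfolding det using fin by (subst prod_sum_PiE) auto
  also have "\<dots> = (\<Sum>g\<in>PiE (set ws) (\<lambda>_. K). \<Sum>p\<in>?P. signof p * (\<Prod>w\<in>set ws. a w (g w) * h w (g w) (ws ! (p (idx w)))))"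
    unfolding sum_distrib_left by (rule sum.swap)
  also have "\<dots> = (\<Sum>g\<in>PiE (set ws) (\<lambda>_. K). (\<Prod>w\<in>set ws. a w (g w)) * det (fun_mat ws (\<lambda>u v. h u (g u) v)))"
    unfolding det prod.distrib sum_distrib_left
    by (intro sum.cong refl) (simp add: mult_ac)
  finally show ?thesis .
qed

text \<open>Sorted by rank the matrix would be unitriangular. Without sorting: among the indices
  moved by a permutation \<open>p\<close>, one of least rank is sent to an index of no smaller rank,
  whereas a nonzero entry there would require its parent, which has smaller rank. So only the
  identity contributes.\<close>

lemma det_parent_map_wf:
  assumes dist: "distinct ws" and wf: "well_founded_map (set ws) \<phi>"
  shows "det (fun_mat ws (\<lambda>u v. (if u = v then 1 else 0) - (if \<phi> u = v then 1 else 0))) = 1"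
proof -
  let ?m = "length ws"
  let ?N = "\<lambda>u v. (if u = v then 1 else 0) - (if \<phi> u = v then 1 else 0 :: real)"
  let ?t = "\<lambda>p. signof p * (\<Prod>i<?m. ?N (ws ! i) (ws ! (p i)))"
  obtain d :: "'a \<Rightarrow> nat" where d: "\<And>w. w \<in> set ws \<Longrightarrow> d (\<phi> w) < d w"
    using wf unfolding well_founded_map_def by blast
  have zero: "?t p = 0" if p: "p permutes {0..<?m}" and "p \<noteq> id" for p
  proof (rule ccontr)
    assume "?t p \<noteq> 0"
    then have nz: "?N (ws ! i) (ws ! (p i)) \<noteq> 0" if "i < ?m" for i
      using that by (auto simp: prod_zero_iff)
    obtain i0 where i0: "p i0 \<noteq> i0" using \<open>p \<noteq> id\<close> by (metis eq_id_iff)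
    obtain i where i: "p i \<noteq> i" and min: "\<And>j. p j \<noteq> j \<Longrightarrow> d (ws ! i) \<le> d (ws ! j)"
      using ex_has_least_nat[of "\<lambda>i. p i \<noteq> i" i0 "\<lambda>i. d (ws ! i)"] i0 by blast
    have im: "i < ?m" using i p by (metis atLeastLessThan_iff permutes_not_in zero_le)
    have pm: "p i < ?m" using im permutes_in_image[OF p, of i] by simp
    have "p (p i) \<noteq> p i" using i permutes_inj[OF p] by (simp add: inj_eq)
    then have "d (ws ! i) \<le> d (ws ! (p i))" by (rule min)
    moreover have "ws ! i \<noteq> ws ! (p i)" using i im pm dist by (simp add: nth_eq_iff_index_eq)
    then have "\<phi> (ws ! i) = ws ! (p i)" using nz[OF im] by (auto split: if_splits)
    ultimately show False using d[of "ws ! i"] im by simp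
  qed
  have "det (fun_mat ws ?N) = (\<Sum>p | p permutes {0..<?m}. if p = id then ?t id else 0)"
    unfolding det_fun_mat by (rule sum.cong) (auto simp: zero)
  also have "\<dots> = ?t id" by (simp add: finite_permutations permutes_id)
  also have "\<dots> = 1"
  proof -
    have "?N (ws ! i) (ws ! i) = 1" if "i < ?m" for i
      using d[of "ws ! i"] that by auto
    then show ?thesis by simp
  qed
  finally show ?thesis .
qed

text \<open>The indicator of the set \<open>C\<close> of vertices from which \<open>\<phi>\<close>
  never leads to \<open>r\<close> lies in the kernel, because a vertex is in \<open>C\<close>
  exactly if its parent is. \<open>C\<close> is nonempty, since otherwise the number of steps to
  \<open>r\<close> would be a rank.\<close>

lemma det_parent_map_not_wf:
  assumes dist: "distinct ws" and r: "r \<notin> set ws"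
    and \<phi>: "\<And>w. w \<in> set ws \<Longrightarrow> \<phi> w \<in> insert r (set ws)"
    and nwf: "\<not> well_founded_map (set ws) \<phi>"
  shows "det (fun_mat ws (\<lambda>u v. (if u = v then 1 else 0) - (if \<phi> u = v then 1 else 0))) = 0"
proof -
  let ?m = "length ws"
  let ?N = "\<lambda>u v. (if u = v then 1 else 0) - (if \<phi> u = v then 1 else 0 :: real)"
  let ?S = "{(w, \<phi> w) | w. w \<in> set ws}"
  define C where "C = {w \<in> set ws. (w, r) \<notin> ?S\<^sup>*}"
  have "C \<noteq> {}"
  proof
    assume "C = {}"
    define d where "d w = (LEAST k. (w, r) \<in> ?S ^^ k)" for w
    have "d (\<phi> w) < d w" if w: "w \<in> set ws" for w
    proof -
      have "\<exists>k. (w, r) \<in> ?S ^^ k" using \<open>C = {}\<close> w unfolding C_def by (auto intro: rtrancl_imp_relpow)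
      then have l: "(w, r) \<in> ?S ^^ d w" unfolding d_def by (rule LeastI_ex)
      have "d w \<noteq> 0"
      proof
        assume "d w = 0"
        then have "w = r" using l by simp
        then show False using w r by simp
      qed
      then obtain k where k: "d w = Suc k" by (cases "d w") auto
      then obtain y where "(w, y) \<in> ?S" "(y, r) \<in> ?S ^^ k" using l relpow_Suc_D2[of w r k ?S] by auto
      then have "(\<phi> w, r) \<in> ?S ^^ k" by auto
      then show ?thesis using k unfolding d_def by (auto intro: Least_le le_imp_less_Suc)
    qed
    then show False using nwf unfolding well_founded_map_def by blast
  qed
  have C: "\<phi> w \<in> C \<longleftrightarrow> w \<in> C" if w: "w \<in> set ws" for w
  proof -
    have "(w, r) \<in> ?S\<^sup>* \<longleftrightarrow> (\<phi> w, r) \<in> ?S\<^sup>*"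
    proof
      assume "(w, r) \<in> ?S\<^sup>*"
      then show "(\<phi> w, r) \<in> ?S\<^sup>*"
        by (cases rule: converse_rtranclE) (use w r in auto)
    next
      assume "(\<phi> w, r) \<in> ?S\<^sup>*"
      moreover have "(w, \<phi> w) \<in> ?S" using w by auto
      ultimately show "(w, r) \<in> ?S\<^sup>*" by (rule converse_rtrancl_into_rtrancl[rotated])
    qed
    then show ?thesis using \<phi>[OF w] w unfolding C_def by auto
  qed
  define x where "x = vec ?m (\<lambda>j. if ws ! j \<in> C then 1 else 0 :: real)"
  have "fun_mat ws ?N *\<^sub>v x = 0\<^sub>v ?m"
  proof (rule eq_vecI)
    fix i assume "i < dim_vec (0\<^sub>v ?m :: real vec)"
    then have i: "i < ?m" by simp
    have "(fun_mat ws ?N *\<^sub>v x) $ i = (\<Sum>j<?m. ?N (ws ! i) (ws ! j) * (if ws ! j \<in> C then 1 else 0))"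
      using i by (simp add: fun_mat_def x_def scalar_prod_def atLeast0LessThan)
    also have "\<dots> = (\<Sum>v\<in>set ws. ?N (ws ! i) v * (if v \<in> C then 1 else 0))"
      by (rule sum_set_conv_nth[OF dist, symmetric])
    also have "\<dots> = (\<Sum>v\<in>set ws. (if v = ws ! i then if ws ! i \<in> C then 1 else 0 else 0)
        - (if v = \<phi> (ws ! i) then if \<phi> (ws ! i) \<in> C then 1 else 0 else 0))"
      by (intro sum.cong) auto
    also have "\<dots> = (if ws ! i \<in> C then 1 else 0) - (if \<phi> (ws ! i) \<in> C then 1 else 0)"
      unfolding sum_subtractf using i by (auto simp: C_def)
    also have "\<dots> = 0" using C[of "ws ! i"] i by simp
    finally show "(fun_mat ws ?N *\<^sub>v x) $ i = 0\<^sub>v ?m $ i" using i by simp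
  qed (simp add: fun_mat_def)
  moreover have "x \<noteq> 0\<^sub>v ?m"
  proof
    assume x: "x = 0\<^sub>v ?m"
    obtain w where "w \<in> C" using \<open>C \<noteq> {}\<close> by blast
    then obtain j where "j < ?m" "ws ! j \<in> C" unfolding C_def by (auto simp: in_set_conv_nth)
    then show False using arg_cong[OF x, of "\<lambda>x. x $ j"] by (simp add: x_def)
  qed
  moreover have "x \<in> carrier_vec ?m" unfolding x_def by simp
  ultimately show ?thesis
    unfolding det_0_iff_vec_prod_zero[OF fun_mat_carrier[of ws ?N]] by (intro exI[of _ x] conjI)
qed

lemma fun_mat_cong:
  assumes "\<And>u v. u \<in> set ws \<Longrightarrow> v \<in> set ws \<Longrightarrow> f u v = g u v"
  shows "fun_mat ws f = fun_mat ws g"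
  unfolding fun_mat_def by (rule eq_matI) (auto intro: assms)

theorem matrix_tree:
  assumes sg: "simple_graph G" and r: "r \<in> verts G"
    and dist: "distinct ws" and ws: "set ws = verts G - {r}"
  shows "det (fun_mat ws (laplace_fun G)) = real (num_spanning_trees G)"
proof -
  let ?V = "verts G" and ?N = "\<lambda>\<phi> u v. (if u = v then 1 else 0) - (if \<phi> u = v then 1 else 0 :: real)"
  let ?M = "PiE (set ws) (\<lambda>_. ?V)"
  have fin: "finite ?V" using sg unfolding simple_graph_def by simp
  \<comment> \<open>Row \<open>u\<close> as the sum, over the neighbours \<open>k\<close>, of the
    unit row at \<open>u\<close> minus the unit row at \<open>k\<close>; for \<open>k = r\<close>
    the second part is missing because the column of the root is deleted.\<close>
  have "laplace_fun G u v = (\<Sum>k\<in>?V. adj_fun G u k * ((if u = v then 1 else 0) - (if k = v then 1 else 0)))"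
    if "v \<in> set ws" for u v
  proof -
    have "(\<Sum>k\<in>?V. adj_fun G u k * ((if u = v then 1 else 0) - (if k = v then 1 else 0)))
       = (\<Sum>k\<in>?V. (if u = v then 1 else 0) * adj_fun G u k - (if k = v then adj_fun G u v else 0))"
      by (intro sum.cong) auto
    also have "\<dots> = laplace_fun G u v"
      unfolding sum_subtractf sum_distrib_left[symmetric] sum_adj_fun[OF sg] laplace_fun_def
      using that ws fin by auto
    finally show ?thesis by simp
  qed
  then have "fun_mat ws (laplace_fun G) = fun_mat ws (\<lambda>u v. \<Sum>k\<in>?V. adj_fun G u k * ((if u = v then 1 else 0) - (if k = v then 1 else 0)))"
    by (intro fun_mat_cong)
  then have "det (fun_mat ws (laplace_fun G)) = (\<Sum>\<phi>\<in>?M. (\<Prod>w\<in>set ws. adj_fun G w (\<phi> w)) * det (fun_mat ws (?N \<phi>)))"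
    using det_fun_mat_row_expansion[OF dist fin] by simp
  also have "\<dots> = (\<Sum>\<phi>\<in>?M. if \<phi> \<in> parent_maps G r then 1 else 0)"
  proof (rule sum.cong)
    fix \<phi> assume \<phi>: "\<phi> \<in> ?M"
    then have into: "\<And>w. w \<in> set ws \<Longrightarrow> \<phi> w \<in> insert r (set ws)" using ws by auto
    have "(\<Prod>w\<in>set ws. adj_fun G w (\<phi> w)) = (if \<forall>w\<in>set ws. {w, \<phi> w} \<in> edges G then 1 else 0)"
      unfolding adj_fun_def by (auto intro: prod_zero)
    moreover have "det (fun_mat ws (?N \<phi>)) = (if well_founded_map (set ws) \<phi> then 1 else 0)"
      using det_parent_map_wf[OF dist] det_parent_map_not_wf[OF dist _ into] ws by auto
    ultimately show "(\<Prod>w\<in>set ws. adj_fun G w (\<phi> w)) * det (fun_mat ws (?N \<phi>)) = (if \<phi> \<in> parent_maps G r then 1 else 0)"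
      using \<phi> unfolding parent_maps_def ws by simp
  qed simp
  also have "\<dots> = real (card (?M \<inter> parent_maps G r))"
    using fin by (subst sum.If_cases) (auto intro: finite_PiE)
  also have "?M \<inter> parent_maps G r = parent_maps G r" unfolding parent_maps_def ws by auto
  finally show ?thesis by (simp add: card_parent_maps[OF sg r])
qed

section \<open>Products of eigenvalues and characteristic polynomials at 0\<close>

lemma mat_delete_fun_mat:
  assumes "i < length vs"
  shows "mat_delete (fun_mat vs f) i i = fun_mat (take i vs @ drop (Suc i) vs) f"
proof -
  let ?ws = "take i vs @ drop (Suc i) vs"
  have len: "length ?ws = length vs - 1" using assms by simp
  have nth: "?ws ! a = vs ! (if a < i then a else Suc a)" if "a < length vs - 1" for a
    using assms that by (simp add: nth_append)
  show ?thesis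
    unfolding mat_delete_def fun_mat_def len
    by (rule eq_matI) (use assms in \<open>simp_all add: nth\<close>)
qed

lemma poly_char_poly_0:
  fixes A :: "real mat"
  assumes A: "A \<in> carrier_mat n n"
  shows "poly (char_poly A) 0 = (-1) ^ n * det A"
proof -
  have "- char_matrix A 0 = (-1) \<cdot>\<^sub>m A"
    unfolding char_matrix_def using A by (intro eq_matI) auto
  then show ?thesis unfolding char_poly_matrix[OF A] using A by simp
qed

text \<open>The derivative of a characteristic polynomial is the sum of the characteristic
  polynomials of the matrices with one row and the same column deleted. At 0 each of these is, up to
  sign, the determinant of a reduced Laplacian, and all of them count the spanning trees.\<close>

lemma laplacian_char_poly_deriv:
  assumes sg: "simple_graph G" and dist: "distinct vs" and vs: "set vs = verts G"
  shows "poly (pderiv (char_poly (fun_mat vs (laplace_fun G)))) 0 =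
    real (length vs) * ((-1) ^ (length vs - 1) * real (num_spanning_trees G))"
proof -
  let ?n = "length vs" and ?L = "fun_mat vs (laplace_fun G)"
  have "poly (char_poly (mat_delete ?L i i)) 0 = (-1) ^ (?n - 1) * real (num_spanning_trees G)"
    if i: "i < ?n" for i
  proof -
    let ?ws = "take i vs @ drop (Suc i) vs"
    have split: "vs = take i vs @ vs ! i # drop (Suc i) vs" using i by (rule id_take_nth_drop)
    have "distinct (take i vs @ vs ! i # drop (Suc i) vs)" using dist by (simp only: split[symmetric])
    then have d: "distinct ?ws" and ni: "vs ! i \<notin> set ?ws"
      unfolding distinct_append distinct.simps set_append list.set by blast+
    have "set (take i vs @ vs ! i # drop (Suc i) vs) = verts G" using vs by (simp only: split[symmetric])
    then have s: "set ?ws = verts G - {vs ! i}"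
      using ni unfolding set_append list.set by blast
    have len: "length ?ws = ?n - 1" using i by simp
    have "det (fun_mat ?ws (laplace_fun G)) = real (num_spanning_trees G)"
      by (rule matrix_tree[OF sg _ d s]) (simp only: vs[symmetric] nth_mem[OF i])
    then show ?thesis
      unfolding mat_delete_fun_mat[OF i] poly_char_poly_0[OF fun_mat_carrier] len by (rule arg_cong)
  qed
  then show ?thesis
    unfolding pderiv_char_poly[OF fun_mat_carrier] poly_sum by simp
qed

lemma prod_nth_list: "(\<Prod>a\<leftarrow>xs. g a) = (\<Prod>k<length xs. g (xs ! k))"
  by (simp add: prod.list_conv_set_nth atLeast0LessThan)

context symmetric_form
begin

lemma prod_eigenvalues: "(\<Prod>k<n. es ! k) = det (fun_mat vs f)"
proof -
  have "(-1) ^ n * det (fun_mat vs f) = poly (char_poly (fun_mat vs f)) 0"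
    by (simp add: poly_char_poly_0[OF fun_mat_carrier])
  also have "\<dots> = (\<Prod>a\<leftarrow>es. - a)"
    by (subst es_facts(1)) (auto simp: poly_prod_list o_def)
  also have "\<dots> = (\<Prod>k<n. (-1) * es ! k)"
    unfolding prod_nth_list es_facts(2) by simp
  also have "\<dots> = (-1) ^ n * (\<Prod>k<n. es ! k)"
    unfolding prod.distrib by simp
  finally show ?thesis by simp
qed

text \<open>A last root 0 splits off the factor X, so the derivative at 0 is the value at 0 of the
  cofactor, whose roots are the other eigenvalues.\<close>

lemma prod_eigenvalues_deriv:
  assumes n: "n \<ge> 1" and last: "es ! (n - 1) = 0"
  shows "poly (pderiv (char_poly (fun_mat vs f))) 0 = (-1) ^ (n - 1) * (\<Prod>k<n - 1. es ! k)"
proof -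
  define bs where "bs = butlast es"
  have len: "length es = n" by (rule es_facts(2))
  then have ne: "es \<noteq> []" using n by auto
  then have es: "es = bs @ [0]" using last len unfolding bs_def
    by (metis append_butlast_last_id last_conv_nth)
  have bslen: "length bs = n - 1" unfolding bs_def using len by simp
  have "char_poly (fun_mat vs f) = (\<Prod>a\<leftarrow>es. [:- a, 1:])" by (rule es_facts(1))
  also have "\<dots> = (\<Prod>a\<leftarrow>bs. [:- a, 1:]) * [:0, 1:]" unfolding es by simp
  finally have "poly (pderiv (char_poly (fun_mat vs f))) 0 = (\<Prod>a\<leftarrow>bs. - a)"
    by (simp only: pderiv_mult) (simp add: pderiv_pCons poly_prod_list o_def)
  also have "\<dots> = (\<Prod>k<n - 1. (-1) * bs ! k)" unfolding prod_nth_list bslen by simp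
  also have "\<dots> = (-1) ^ (n - 1) * (\<Prod>k<n - 1. bs ! k)" unfolding prod.distrib by simp
  also have "(\<Prod>k<n - 1. bs ! k) = (\<Prod>k<n - 1. es ! k)"
    unfolding bs_def using len by (intro prod.cong refl) (simp add: nth_butlast)
  finally show ?thesis .
qed

end

text \<open>Adding the second block row to the first and then subtracting the first block column
  from the second clears the upper right block and leaves \<open>X + Y\<close> and
  \<open>X - Y\<close> on the diagonal. Both operations are multiplications by matrices of
  determinant 1.\<close>

lemma char_poly_symmetric_block:
  fixes P R :: "real mat"
  assumes P: "P \<in> carrier_mat n n" and R: "R \<in> carrier_mat n n"
  shows "char_poly (four_block_mat P R R P) = char_poly (P + R) * char_poly (P - R)"
proof -
  define X where "X = char_poly_matrix P"
  define Y where "Y = map_mat (\<lambda>a. [:- a:]) R"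
  let ?O = "1\<^sub>m n :: real poly mat" and ?Z = "0\<^sub>m n n :: real poly mat"
  have X: "X \<in> carrier_mat n n" unfolding X_def using P by simp
  have Y: "Y \<in> carrier_mat n n" unfolding Y_def using R by simp
  have M: "char_poly_matrix (four_block_mat P R R P) = four_block_mat X Y Y X"
    unfolding X_def Y_def char_poly_matrix_def using P R by (intro eq_matI) (auto simp: one_poly_def)
  have XY: "char_poly_matrix (P + R) = X + Y" "char_poly_matrix (P - R) = X - Y"
    unfolding X_def Y_def char_poly_matrix_def using P R by (auto intro!: eq_matI)
  let ?U = "four_block_mat ?O ?O ?Z ?O" and ?U' = "four_block_mat ?O (- ?O) ?Z ?O"
  let ?M = "four_block_mat X Y Y X"
  have U: "?U \<in> carrier_mat (n + n) (n + n)" "?U' \<in> carrier_mat (n + n) (n + n)"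
    "?M \<in> carrier_mat (n + n) (n + n)" using X Y by auto
  have dU: "det ?U = 1" "det ?U' = 1"
    by (subst det_four_block_mat_lower_left_zero[of _ n _ n]; simp)+
  have "?U * ?M = four_block_mat (X + Y) (X + Y) Y X"
    using X Y by (subst mult_four_block_mat[of _ n n _ n _ n _ _ n _ n]) (auto simp: comm_add_mat[of Y n n X])
  moreover have "\<dots> * ?U' = four_block_mat (X + Y) ?Z Y (X - Y)"
  proof -
    have "(X + Y) * (- ?O) + (X + Y) * ?O = ?Z" "Y * (- ?O) + X * ?O = X - Y"
      using X Y by (auto intro!: eq_matI simp: scalar_prod_def)
    then show ?thesis
      using X Y by (subst mult_four_block_mat[of _ n n _ n _ n _ _ n _ n]) auto
  qed
  ultimately have "?U * ?M * ?U' = four_block_mat (X + Y) ?Z Y (X - Y)" by simp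
  then have "det (?U * ?M * ?U') = det (X + Y) * det (X - Y)"
    using X Y by (subst det_four_block_mat_upper_right_zero[of _ n _ n, symmetric]) auto
  moreover have "det (?U * ?M * ?U') = det ?M"
  proof -
    have "det (?U * ?M * ?U') = det (?U * ?M) * det ?U'"
      by (rule det_mult[OF mult_carrier_mat[OF U(1,3)] U(2)])
    also have "det (?U * ?M) = det ?U * det ?M" by (rule det_mult[OF U(1,3)])
    finally show ?thesis unfolding dU by simp
  qed
  ultimately show ?thesis unfolding char_poly_def M XY by simp
qed

lemma vertex_list:
  assumes "simple_graph G"
  shows "distinct (vertex_list G)" "set (vertex_list G) = verts G" "length (vertex_list G) = card (verts G)"
proof -
  have "\<exists>vs. distinct vs \<and> set vs = verts G"
    using assms finite_distinct_list unfolding simple_graph_def by metis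
  then have "distinct (vertex_list G) \<and> set (vertex_list G) = verts G"
    unfolding vertex_list_def by (rule someI_ex)
  then show "distinct (vertex_list G)" "set (vertex_list G) = verts G" "length (vertex_list G) = card (verts G)"
    by (auto simp: distinct_card[symmetric])
qed

lemma laplacian_fun_mat:
  assumes "simple_graph G"
  shows "laplacian G = fun_mat (vertex_list G) (laplace_fun G)"
    and "signless_laplacian G = fun_mat (vertex_list G) (signless_fun G)"
  using vertex_list[OF assms]
  unfolding laplacian_def signless_laplacian_def degree_matrix_def adjacency_matrix_def Let_def
    fun_mat_def laplace_fun_def signless_fun_def adj_fun_def
  by (auto intro!: eq_matI simp: nth_eq_iff_index_eq)

lemma laplace_fun_commute: "laplace_fun G u v = laplace_fun G v u"
  unfolding laplace_fun_def using adj_fun_commute[of G u v] by simp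

lemma signless_fun_commute: "signless_fun G u v = signless_fun G v u"
  unfolding signless_fun_def using adj_fun_commute[of G u v] by simp

lemma symmetric_form_laplace:
  assumes "simple_graph G"
  shows "symmetric_form (vertex_list G) (laplace_fun G)"
    and "symmetric_form (vertex_list G) (signless_fun G)"
  using vertex_list[OF assms] by (unfold_locales, auto intro: laplace_fun_commute signless_fun_commute)

section \<open>The bipartite double cover\<close>

lemma tensor_product_K2_edge:
  "{(u, x), (v, y)} \<in> edges (tensor_product G K2) \<longleftrightarrow> {u, v} \<in> edges G \<and> x \<noteq> y"
proof
  assume "{(u, x), (v, y)} \<in> edges (tensor_product G K2)"
  then obtain u' v' x' y' where "{(u, x), (v, y)} = {(u', x'), (v', y')}" "{u', v'} \<in> edges G" "x' \<noteq> y'"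
    unfolding tensor_product_def K2_def by (auto simp: doubleton_eq_iff)
  then show "{u, v} \<in> edges G \<and> x \<noteq> y" by (auto simp: doubleton_eq_iff insert_commute)
next
  assume a: "{u, v} \<in> edges G \<and> x \<noteq> y"
  then have "{x, y} \<in> edges K2" unfolding K2_def by (cases x; cases y) auto
  then show "{(u, x), (v, y)} \<in> edges (tensor_product G K2)"
    using a unfolding tensor_product_def by auto
qed

lemma verts_tensor_product_K2: "verts (tensor_product G K2) = verts G \<times> UNIV"
  unfolding tensor_product_def K2_def by simp

lemma simple_graph_tensor_product_K2:
  assumes "simple_graph G"
  shows "simple_graph (tensor_product G K2)"
proof -
  have "e \<in> {{a, b} | a b. a \<in> verts G \<times> UNIV \<and> b \<in> verts G \<times> UNIV \<and> a \<noteq> b}"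
    if "e \<in> edges (tensor_product G K2)" for e
  proof -
    obtain u x v y where e: "e = {(u, x), (v, y)}" "{u, v} \<in> edges G"
      using \<open>e \<in> _\<close> unfolding tensor_product_def by auto
    then show ?thesis using edge_verts[OF assms e(2)] by blast
  qed
  then show ?thesis
    using assms unfolding simple_graph_def verts_tensor_product_K2 by (simp add: subset_iff)
qed

lemma laplace_fun_tensor_product_K2:
  assumes sg: "simple_graph G"
  shows "laplace_fun (tensor_product G K2) (u, x) (v, y) =
    (if x = y then if u = v then real (vdegree G u) else 0 else - adj_fun G u v)"
proof -
  have nb: "nbrs (tensor_product G K2) (u, x) = (\<lambda>v. (v, \<not> x)) ` nbrs G u" for u x
    unfolding nbrs_def verts_tensor_product_K2 by (auto simp: tensor_product_K2_edge)
  have "vdegree (tensor_product G K2) (u, x) = vdegree G u" for u x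
    unfolding vdegree_eq_card_nbrs[OF sg] vdegree_eq_card_nbrs[OF simple_graph_tensor_product_K2[OF sg]] nb
    by (simp add: card_image inj_on_def)
  then show ?thesis
    unfolding laplace_fun_def adj_fun_def by (simp add: tensor_product_K2_edge)
qed

lemma det_laplacian_eq_0:
  assumes sg: "simple_graph G" and vs: "distinct vs" "set vs = verts G" "vs \<noteq> []"
  shows "det (fun_mat vs (laplace_fun G)) = 0"
proof -
  let ?x = "vec (length vs) (\<lambda>_. 1 :: real)"
  have fin: "finite (verts G)" using sg unfolding simple_graph_def by simp
  have row: "(\<Sum>v\<in>verts G. laplace_fun G u v) = 0" if "u \<in> verts G" for u
    unfolding laplace_fun_def sum_subtractf sum_adj_fun[OF sg] using fin that by simp
  have "fun_mat vs (laplace_fun G) *\<^sub>v ?x = 0\<^sub>v (length vs)"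
  proof (rule eq_vecI)
    fix i assume "i < dim_vec (0\<^sub>v (length vs) :: real vec)"
    then have i: "i < length vs" by simp
    have "(fun_mat vs (laplace_fun G) *\<^sub>v ?x) $ i = (\<Sum>j<length vs. laplace_fun G (vs ! i) (vs ! j))"
      using i by (simp add: fun_mat_def scalar_prod_def atLeast0LessThan)
    also have "\<dots> = (\<Sum>v\<in>set vs. laplace_fun G (vs ! i) v)"
      by (rule sum_set_conv_nth[OF vs(1), symmetric])
    also have "\<dots> = 0" unfolding vs(2) using nth_mem[OF i] vs(2) by (intro row) simp
    finally show "(fun_mat vs (laplace_fun G) *\<^sub>v ?x) $ i = 0\<^sub>v (length vs) $ i" using i by simp
  qed (simp add: fun_mat_def)
  moreover have "?x \<noteq> 0\<^sub>v (length vs)"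
  proof
    assume x: "?x = 0\<^sub>v (length vs)"
    have "0 < length vs" using vs(3) by simp
    then show False using arg_cong[OF x, of "\<lambda>x. x $ 0"] by simp
  qed
  moreover have "?x \<in> carrier_vec (length vs)" by simp
  ultimately show ?thesis
    unfolding det_0_iff_vec_prod_zero[OF fun_mat_carrier[of vs "laplace_fun G"]] by (intro exI[of _ ?x] conjI)
qed

text \<open>The Laplacian of the cover has blocks D and -A, so its characteristic polynomial is the
  product of those of L = D - A and Q = D + A. The first vanishes at 0, hence the derivative of the
  product at 0 is the value for Q times the derivative for L. The cover has twice as many vertices,
  which is the origin of the factor 2.\<close>

theorem spanning_trees_double_cover:
  assumes sg: "simple_graph G" and vs: "distinct vs" "set vs = verts G" "vs \<noteq> []"
  shows "2 * real (num_spanning_trees (tensor_product G K2)) =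
    real (num_spanning_trees G) * det (fun_mat vs (signless_fun G))"
proof -
  let ?n = "length vs" and ?T = "tensor_product G K2"
  let ?L = "fun_mat vs (laplace_fun G)" and ?Q = "fun_mat vs (signless_fun G)"
  let ?D = "fun_mat vs (\<lambda>u v. if u = v then real (vdegree G u) else 0)"
  let ?A = "fun_mat vs (\<lambda>u v. - adj_fun G u v)"
  let ?t = "real (num_spanning_trees G)" and ?t' = "real (num_spanning_trees ?T)"
  define ws where "ws = map (\<lambda>v. (v, False)) vs @ map (\<lambda>v. (v, True)) vs"
  have len: "length ws = ?n + ?n" unfolding ws_def by simp
  have dws: "distinct ws" unfolding ws_def using vs(1) by (auto simp: distinct_map inj_on_def)
  have sws: "set ws = verts ?T"
    unfolding verts_tensor_product_K2 ws_def vs(2)[symmetric] by (auto simp: image_iff)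
  have "fun_mat ws (laplace_fun ?T) = four_block_mat ?D ?A ?A ?D"
  proof (rule eq_matI)
    fix i j assume "i < dim_row (four_block_mat ?D ?A ?A ?D)" "j < dim_col (four_block_mat ?D ?A ?A ?D)"
    then have ij: "i < ?n + ?n" "j < ?n + ?n" by (auto simp: fun_mat_def)
    have nth: "ws ! k = (if k < ?n then (vs ! k, False) else (vs ! (k - ?n), True))" if "k < ?n + ?n" for k
      using that unfolding ws_def by (auto simp: nth_append)
    show "fun_mat ws (laplace_fun ?T) $$ (i, j) = four_block_mat ?D ?A ?A ?D $$ (i, j)"
      using ij unfolding fun_mat_def len
      by (auto simp: nth laplace_fun_tensor_product_K2[OF sg])
  qed (auto simp: fun_mat_def len)
  moreover have "?D + ?A = ?L" "?D - ?A = ?Q"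
    unfolding fun_mat_def laplace_fun_def signless_fun_def by (auto intro!: eq_matI)
  ultimately have cp: "char_poly (fun_mat ws (laplace_fun ?T)) = char_poly ?L * char_poly ?Q"
    using char_poly_symmetric_block[of ?D ?n ?A] by simp
  have "poly (pderiv (char_poly (fun_mat ws (laplace_fun ?T)))) 0
      = poly (char_poly ?L) 0 * poly (pderiv (char_poly ?Q)) 0 + poly (char_poly ?Q) 0 * poly (pderiv (char_poly ?L)) 0"
    unfolding cp pderiv_mult by simp
  also have "poly (char_poly ?L) 0 = 0"
    unfolding poly_char_poly_0[OF fun_mat_carrier] det_laplacian_eq_0[OF sg vs] by simp
  finally have "real (length ws) * ((-1) ^ (length ws - 1) * ?t') =
      ((-1) ^ ?n * det ?Q) * (real ?n * ((-1) ^ (?n - 1) * ?t))"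
    unfolding laplacian_char_poly_deriv[OF simple_graph_tensor_product_K2[OF sg] dws sws]
      laplacian_char_poly_deriv[OF sg vs(1,2)] poly_char_poly_0[OF fun_mat_carrier] by simp
  \<comment> \<open>Removes the truncated subtractions; both sides then carry the sign of the odd
    exponent 2m + 1.\<close>
  moreover obtain m where m: "?n = Suc m" using vs(3) by (cases ?n) auto
  ultimately have "2 * real (Suc m) * ((-1) ^ (Suc m + m) * ?t') = ((-1) ^ Suc m * det ?Q) * (real (Suc m) * ((-1) ^ m * ?t))"
    unfolding len m by simp
  then have "real (Suc m) * (2 * ?t') = real (Suc m) * (?t * det ?Q)"
    by (simp add: power_add algebra_simps flip: power_mult_distrib)
  then show ?thesis by simp
qed

text \<open>Conjugation with the diagonal matrix of signs +1 and -1 on the two classes changes the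
  sign of every entry at an edge and fixes the diagonal.\<close>

lemma bipartite_eigenvalue_list:
  assumes sg: "simple_graph G" and bip: "bipartite G"
  shows "eigenvalue_list (signless_laplacian G) = eigenvalue_list (laplacian G)"
proof -
  let ?vs = "vertex_list G" let ?n = "length ?vs"
  obtain X Y where "X \<union> Y = verts G \<and> X \<inter> Y = {} \<and> (\<forall>e\<in>edges G. \<exists>x\<in>X. \<exists>y\<in>Y. e = {x, y})"
    using bip unfolding bipartite_def by (elim exE)
  then have XY: "X \<inter> Y = {}" "\<forall>e\<in>edges G. \<exists>x\<in>X. \<exists>y\<in>Y. e = {x, y}" by blast+
  define s where "s v = (if v \<in> X then 1 else - 1 :: real)" for v
  have ss: "s v * s v = 1" for v unfolding s_def by simp
  have se: "s u * s v = - 1" if "{u, v} \<in> edges G" for u v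
  proof -
    obtain x y where xy: "x \<in> X" "y \<in> Y" "{u, v} = {x, y}" using bspec[OF XY(2) \<open>{u, v} \<in> edges G\<close>] by (elim bexE)
    moreover have "y \<notin> X" using xy(2) XY(1) by blast
    ultimately show ?thesis unfolding s_def by (fastforce simp: doubleton_eq_iff)
  qed
  define S where "S = mat_diag ?n (\<lambda>i. s (?vs ! i))"
  let ?L = "fun_mat ?vs (laplace_fun G)" and ?Q = "fun_mat ?vs (signless_fun G)"
  have S: "S \<in> carrier_mat ?n ?n" unfolding S_def by simp
  have SS: "S * S = 1\<^sub>m ?n" unfolding S_def mat_diag_diag ss by simp
  have LQ: "s u * laplace_fun G u v * s v = signless_fun G u v" for u v
  proof (cases "u = v")
    case True
    then show ?thesis
      unfolding laplace_fun_def signless_fun_def True adj_fun_self[OF sg] by (simp add: s_def)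
  next
    case False
    then show ?thesis
      unfolding laplace_fun_def signless_fun_def adj_fun_def by (simp add: se)
  qed
  have "S * ?L * S = ?Q"
    unfolding S_def mat_diag_mult_left[OF fun_mat_carrier]
    by (subst mat_diag_mult_right[of _ ?n], simp, rule eq_matI) (simp_all add: fun_mat_def LQ)
  then have "?Q = S * ?L * S" by (rule sym)
  then have "similar_mat_wit ?Q ?L S S"
    by (rule similar_mat_witI[OF SS SS _ fun_mat_carrier fun_mat_carrier S S])
  then have "similar_mat ?Q ?L" unfolding similar_mat_def by blast
  then have "char_poly ?Q = char_poly ?L" by (rule char_poly_similar)
  then show ?thesis
    unfolding eigenvalue_list_def laplacian_fun_mat[OF sg] by (simp only:)
qed

section \<open>Inequalities for means and powers\<close>

text \<open>Polya's proof: with the mean \<open>A\<close>, each \<open>x i / A\<close> is at most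
  \<open>exp (x i / A - 1)\<close>, and the exponents sum to 0. Division by \<open>A\<close> is the
  reason for treating a vanishing term separately.\<close>

lemma amgm:
  fixes x :: "'i \<Rightarrow> real"
  assumes fin: "finite I" and ne: "I \<noteq> {}" and nn: "\<And>i. i \<in> I \<Longrightarrow> x i \<ge> 0"
  shows "(\<Prod>i\<in>I. x i) \<le> ((\<Sum>i\<in>I. x i) / real (card I)) ^ card I"
proof (cases "\<exists>i\<in>I. x i = 0")
  case True
  then have "(\<Prod>i\<in>I. x i) = 0" using fin by (simp add: prod_zero_iff)
  then show ?thesis using nn by (simp add: sum_nonneg)
next
  case False
  then have pos: "x i > 0" if "i \<in> I" for i using nn[OF that] that by force
  define A where "A = (\<Sum>i\<in>I. x i) / real (card I)"
  have card: "card I > 0" using fin ne by (simp add: card_gt_0_iff)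
  have "(\<Sum>i\<in>I. x i) > 0" using fin ne pos by (intro sum_pos) auto
  then have A: "A > 0" unfolding A_def using card by simp
  have "(\<Prod>i\<in>I. x i / A) \<le> (\<Prod>i\<in>I. exp (x i / A - 1))"
    using pos A exp_ge_add_one_self[of "x _ / A - 1"]
    by (intro prod_mono) (auto simp: less_imp_le)
  also have "\<dots> = exp (\<Sum>i\<in>I. (x i / A - 1))" using fin by (simp add: exp_sum)
  also have "(\<Sum>i\<in>I. (x i / A - 1)) = (\<Sum>i\<in>I. x i) / A - real (card I)"
    by (simp add: sum_subtractf sum_divide_distrib)
  also have "\<dots> = 0" using \<open>(\<Sum>i\<in>I. x i) > 0\<close> card unfolding A_def by simp
  finally have "(\<Prod>i\<in>I. x i) / A ^ card I \<le> 1" by (simp add: prod_dividef)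
  then show ?thesis using A unfolding A_def[symmetric] by (simp add: field_simps)
qed

lemma amgm_root:
  fixes x :: "'i \<Rightarrow> real"
  assumes fin: "finite I" and ne: "I \<noteq> {}" and nn: "\<And>i. i \<in> I \<Longrightarrow> x i \<ge> 0"
  shows "real (card I) * (\<Prod>i\<in>I. x i) powr (1 / real (card I)) \<le> (\<Sum>i\<in>I. x i)"
proof -
  let ?c = "card I"
  have card: "?c > 0" using fin ne by (simp add: card_gt_0_iff)
  have S: "(\<Sum>i\<in>I. x i) / real ?c \<ge> 0" using nn by (simp add: sum_nonneg)
  have "(\<Prod>i\<in>I. x i) powr (1 / real ?c) \<le> (((\<Sum>i\<in>I. x i) / real ?c) ^ ?c) powr (1 / real ?c)"
    using amgm[OF assms] nn by (intro powr_mono2) (auto intro: prod_nonneg)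
  also have "\<dots> = (\<Sum>i\<in>I. x i) / real ?c"
  proof -
    have "(M ^ ?c) powr (1 / real ?c) = M" if "M \<ge> 0" for M :: real
    proof (cases "M = 0")
      case False
      then have "M > 0" using that by simp
      then show ?thesis using card by (simp add: powr_realpow[symmetric] powr_powr)
    qed (use card in simp)
    then show ?thesis using S .
  qed
  finally show ?thesis using card by (simp add: field_simps)
qed

text \<open>Replacing the first and the last term by their geometric mean \<open>\<surd>ab\<close> keeps the product
  and lowers the sum by \<open>a + b - 2\<surd>ab = (\<surd>a - \<surd>b)\<^sup>2\<close>.\<close>

lemma amgm_refined:
  fixes x :: "nat \<Rightarrow> real"
  assumes N: "N \<ge> 1" and nn: "\<And>i. i \<in> {1..N} \<Longrightarrow> x i \<ge> 0"
  shows "real N * (\<Prod>i\<in>{1..N}. x i) powr (1 / real N) + (sqrt (x 1) - sqrt (x N))\<^sup>2 \<le> (\<Sum>i\<in>{1..N}. x i)"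
proof (cases "N = 1")
  case True
  then show ?thesis using nn[of 1] by simp
next
  case False
  then have N2: "N \<ge> 2" using N by simp
  define g where "g = sqrt (x 1 * x N)"
  define y where "y i = (if i = 1 \<or> i = N then g else x i)" for i
  have x1: "x 1 \<ge> 0" and xN: "x N \<ge> 0" using nn N by auto
  have split: "{1..N} = insert 1 (insert N {2..<N})" using N2 by auto
  have sx: "(\<Sum>i\<in>{1..N}. x i) = x 1 + x N + (\<Sum>i\<in>{2..<N}. x i)"
    unfolding split using N2 by simp
  have "(\<Sum>i\<in>{2..<N}. y i) = (\<Sum>i\<in>{2..<N}. x i)" by (rule sum.cong) (auto simp: y_def)
  then have sy: "(\<Sum>i\<in>{1..N}. y i) = 2 * g + (\<Sum>i\<in>{2..<N}. x i)"
    unfolding split using N2 by (simp add: y_def)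
  have px: "(\<Prod>i\<in>{1..N}. x i) = x 1 * x N * (\<Prod>i\<in>{2..<N}. x i)"
    unfolding split using N2 by simp
  have "(\<Prod>i\<in>{2..<N}. y i) = (\<Prod>i\<in>{2..<N}. x i)" by (rule prod.cong) (auto simp: y_def)
  then have py: "(\<Prod>i\<in>{1..N}. y i) = g * g * (\<Prod>i\<in>{2..<N}. x i)"
    unfolding split using N2 by (simp add: y_def)
  have gg: "g * g = x 1 * x N" unfolding g_def using x1 xN by simp
  have "real N * (\<Prod>i\<in>{1..N}. y i) powr (1 / real N) \<le> (\<Sum>i\<in>{1..N}. y i)"
    using amgm_root[of "{1..N}" y] N nn x1 xN by (auto simp: y_def g_def)
  moreover have "(sqrt (x 1) - sqrt (x N))\<^sup>2 = x 1 + x N - 2 * g"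
    using x1 xN unfolding g_def by (simp add: power2_diff real_sqrt_mult)
  ultimately show ?thesis unfolding sx px sy py gg by simp
qed

lemma powr_gap:
  fixes q T R :: real
  assumes T: "T > 0" and q: "q \<ge> T" and N: "N > 0" and R: "R \<ge> 0" "R \<le> T powr (N + 1)"
  shows "sqrt T + N * (R / T) powr (1 / (2 * N)) \<le> sqrt q + N * (R / q) powr (1 / (2 * N))"
    and "q > T \<Longrightarrow> sqrt T + N * (R / T) powr (1 / (2 * N)) < sqrt q + N * (R / q) powr (1 / (2 * N))"
proof -
  define s where "s = sqrt (q / T)"
  define g where "g = (R / T) powr (1 / (2 * N))"
  have s1: "s \<ge> 1" unfolding s_def using T q by simp
  have q_eq: "sqrt q = sqrt T * s" unfolding s_def using T q by (simp add: real_sqrt_divide)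
  have "R / T \<le> T powr N"
    using R(2) T by (simp add: powr_add field_simps)
  then have "g \<le> (T powr N) powr (1 / (2 * N))"
    unfolding g_def using R(1) T N by (intro powr_mono2) auto
  also have "\<dots> = sqrt T" using T N by (simp add: powr_powr powr_half_sqrt)
  finally have g: "g \<le> sqrt T" "g \<ge> 0" unfolding g_def by auto
  define y where "y = ln s / N"
  have y: "y \<ge> 0" unfolding y_def using s1 N by simp
  have "s > 0" using s1 by simp
  have "(R / q) powr (1 / (2 * N)) = ((R / T) * (1 / s\<^sup>2)) powr (1 / (2 * N))"
    unfolding s_def using T q by (simp add: field_simps)
  also have "\<dots> = g * (1 / s\<^sup>2) powr (1 / (2 * N))"
    unfolding g_def using R T by (subst powr_mult) auto
  also have "(1 / s\<^sup>2) powr (1 / (2 * N)) = exp (- y)"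
    using \<open>s > 0\<close> N unfolding y_def powr_def
    by (simp add: ln_div ln_realpow field_simps)
  finally have Rq: "(R / q) powr (1 / (2 * N)) = g * exp (- y)" .
  have e: "1 - exp (- y) \<le> y" using exp_ge_add_one_self[of "- y"] by simp
  have "N * g * (1 - exp (- y)) \<le> N * g * y" using e g N by (intro mult_left_mono) auto
  also have "\<dots> = g * ln s" unfolding y_def using N by simp
  also have "\<dots> \<le> sqrt T * ln s" using g s1 by (intro mult_right_mono) auto
  finally have key: "N * g * (1 - exp (- y)) \<le> sqrt T * ln s" .
  have "ln s \<le> s - 1" using \<open>s > 0\<close> by (rule ln_le_minus_one)
  then have "sqrt T * ln s \<le> sqrt T * (s - 1)" using T by (intro mult_left_mono) auto
  then show "sqrt T + N * (R / T) powr (1 / (2 * N)) \<le> sqrt q + N * (R / q) powr (1 / (2 * N))"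
    using key unfolding Rq q_eq g_def[symmetric] by (simp add: algebra_simps)
  assume "q > T"
  then have "s > 1" unfolding s_def using T by simp
  then have "ln s < s - 1" using ln_eq_minus_one[of s] ln_le_minus_one[of s] by fastforce
  then have "sqrt T * ln s < sqrt T * (s - 1)" using T by (intro mult_strict_left_mono) auto
  then show "sqrt T + N * (R / T) powr (1 / (2 * N)) < sqrt q + N * (R / q) powr (1 / (2 * N))"
    using key unfolding Rq q_eq g_def[symmetric] by (simp add: algebra_simps)
qed

lemma sqrt_sqrt_powr: "x \<ge> 0 \<Longrightarrow> sqrt (sqrt x) = x powr (1 / 4)" for x :: real
  by (simp add: powr_half_sqrt[symmetric] powr_powr)

lemma prod_sqrt: "(\<Prod>i\<in>I. sqrt (x i)) = sqrt (\<Prod>i\<in>I. x i)"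
  by (induction I rule: infinite_finite_induct) (auto simp: real_sqrt_mult)

lemma sum_sqrt_lower_bound:
  fixes e :: "nat \<Rightarrow> real"
  assumes N: "N \<ge> 1" and nn: "\<And>i. i \<le> N \<Longrightarrow> e i \<ge> 0" and q: "e 0 > 0" and R: "R = (\<Prod>i\<le>N. e i)"
  shows "sqrt (e 0) + real N * (R / e 0) powr (1 / (2 * real N)) + (e 1 powr (1/4) - e N powr (1/4))\<^sup>2
    \<le> (\<Sum>i\<le>N. sqrt (e i))"
proof -
  have split: "{..N} = insert 0 {1..N}" by auto
  have "R = e 0 * (\<Prod>i\<in>{1..N}. e i)" unfolding R split by simp
  then have Rq: "R / e 0 = (\<Prod>i\<in>{1..N}. e i)" using q by simp
  have P: "(\<Prod>i\<in>{1..N}. e i) \<ge> 0" using nn by (intro prod_nonneg) auto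
  have "(R / e 0) powr (1 / (2 * real N)) = (\<Prod>i\<in>{1..N}. sqrt (e i)) powr (1 / real N)"
    unfolding Rq prod_sqrt using P by (simp add: powr_half_sqrt[symmetric] powr_powr)
  moreover have "real N * (\<Prod>i\<in>{1..N}. sqrt (e i)) powr (1 / real N) + (sqrt (sqrt (e 1)) - sqrt (sqrt (e N)))\<^sup>2
      \<le> (\<Sum>i\<in>{1..N}. sqrt (e i))"
    using N nn by (intro amgm_refined) auto
  moreover have "sqrt (sqrt (e 1)) = e 1 powr (1/4)" "sqrt (sqrt (e N)) = e N powr (1/4)"
    using nn N by (auto intro!: sqrt_sqrt_powr)
  ultimately show ?thesis unfolding split by simp
qed

text \<open>Turns a bound on the trace into the hypothesis on \<open>R\<close> of
  \<open>powr_gap\<close>.\<close>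

lemma eigenvalue_product_bound:
  fixes e :: "nat \<Rightarrow> real"
  assumes nn: "\<And>i. i \<le> N \<Longrightarrow> e i \<ge> 0" and S: "(\<Sum>i\<le>N. e i) \<le> (real N + 1) * T" and T: "T > 0"
  shows "(\<Prod>i\<le>N. e i) \<le> T powr (real N + 1)"
proof -
  have "(\<Prod>i\<le>N. e i) \<le> ((\<Sum>i\<le>N. e i) / real (card {..N})) ^ card {..N}"
    using nn by (intro amgm) auto
  also have "\<dots> \<le> T ^ card {..N}"
    using S nn by (intro power_mono) (auto simp: field_simps intro!: divide_nonneg_nonneg sum_nonneg)
  also have "\<dots> = T powr (real N + 1)" using powr_realpow[OF T, of "Suc N"] by (simp add: add.commute)
  finally show ?thesis .
qed

lemma quarter_diff_mono:
  fixes a b x y :: real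
  assumes "0 \<le> y" "y \<le> b" "b \<le> a" "a \<le> x"
  shows "(a powr (1/4) - b powr (1/4))\<^sup>2 \<le> (x powr (1/4) - y powr (1/4))\<^sup>2"
proof (rule power_mono)
  have "a powr (1/4) \<le> x powr (1/4)" "y powr (1/4) \<le> b powr (1/4)" "b powr (1/4) \<le> a powr (1/4)"
    using assms by (auto intro!: powr_mono2)
  then show "a powr (1/4) - b powr (1/4) \<le> x powr (1/4) - y powr (1/4)" "0 \<le> a powr (1/4) - b powr (1/4)"
    by auto
qed

section \<open>Eigenvalue bounds from test vectors\<close>

lemma graph_qforms:
  assumes fin: "finite V"
  shows "qform V (signless_fun G) x = (\<Sum>v\<in>V. real (vdegree G v) * (x v)\<^sup>2) + (\<Sum>u\<in>V. \<Sum>v\<in>V. adj_fun G u v * (x u * x v))"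
    and "qform V (laplace_fun G) x = (\<Sum>v\<in>V. real (vdegree G v) * (x v)\<^sup>2) - (\<Sum>u\<in>V. \<Sum>v\<in>V. adj_fun G u v * (x u * x v))"
proof -
  have diag: "(\<Sum>v\<in>V. (if u = v then real (vdegree G u) else 0) * x u * x v) = real (vdegree G u) * (x u)\<^sup>2"
    if "u \<in> V" for u
  proof -
    have "(\<Sum>v\<in>V. (if u = v then real (vdegree G u) else 0) * x u * x v) = (\<Sum>v\<in>V. if u = v then real (vdegree G u) * (x u)\<^sup>2 else 0)"
      by (intro sum.cong) (auto simp: power2_eq_square)
    then show ?thesis using fin that by simp
  qed
  show "qform V (signless_fun G) x = (\<Sum>v\<in>V. real (vdegree G v) * (x v)\<^sup>2) + (\<Sum>u\<in>V. \<Sum>v\<in>V. adj_fun G u v * (x u * x v))"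
    unfolding qform_def signless_fun_def by (simp add: distrib_right sum.distrib diag[unfolded mult.assoc] mult.assoc)
  show "qform V (laplace_fun G) x = (\<Sum>v\<in>V. real (vdegree G v) * (x v)\<^sup>2) - (\<Sum>u\<in>V. \<Sum>v\<in>V. adj_fun G u v * (x u * x v))"
    unfolding qform_def laplace_fun_def by (simp add: left_diff_distrib sum_subtractf diag[unfolded mult.assoc] mult.assoc)
qed

lemma degree_form:
  assumes sg: "simple_graph G"
  shows "(\<Sum>v\<in>verts G. real (vdegree G v) * g v) = (\<Sum>u\<in>verts G. \<Sum>v\<in>verts G. adj_fun G u v * g u)"
    and "(\<Sum>v\<in>verts G. real (vdegree G v) * g v) = (\<Sum>u\<in>verts G. \<Sum>v\<in>verts G. adj_fun G u v * g v)"
proof -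
  show a: "(\<Sum>v\<in>verts G. real (vdegree G v) * g v) = (\<Sum>u\<in>verts G. \<Sum>v\<in>verts G. adj_fun G u v * g u)"
    unfolding sum_adj_fun[OF sg, symmetric] sum_distrib_right ..
  show "(\<Sum>v\<in>verts G. real (vdegree G v) * g v) = (\<Sum>u\<in>verts G. \<Sum>v\<in>verts G. adj_fun G u v * g v)"
    unfolding a by (subst sum.swap) (simp add: adj_fun_commute)
qed

lemma simple_finite: "simple_graph G \<Longrightarrow> finite (verts G)"
  unfolding simple_graph_def by simp

lemma qform_edges:
  assumes sg: "simple_graph G"
  shows "2 * qform (verts G) (signless_fun G) x = (\<Sum>u\<in>verts G. \<Sum>v\<in>verts G. adj_fun G u v * (x u + x v)\<^sup>2)"
    and "2 * qform (verts G) (laplace_fun G) x = (\<Sum>u\<in>verts G. \<Sum>v\<in>verts G. adj_fun G u v * (x u - x v)\<^sup>2)"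
proof -
  let ?V = "verts G"
  let ?D = "\<Sum>v\<in>?V. real (vdegree G v) * (x v)\<^sup>2"
  let ?C = "\<Sum>u\<in>?V. \<Sum>v\<in>?V. adj_fun G u v * (x u * x v)"
  have "(\<Sum>u\<in>?V. \<Sum>v\<in>?V. adj_fun G u v * (x u + x v)\<^sup>2) =
    (\<Sum>u\<in>?V. \<Sum>v\<in>?V. adj_fun G u v * (x u)\<^sup>2 + adj_fun G u v * (x v)\<^sup>2 + 2 * (adj_fun G u v * (x u * x v)))"
    by (intro sum.cong refl) (simp add: power2_sum algebra_simps)
  also have "\<dots> = ?D + ?D + 2 * ?C"
    unfolding sum.distrib sum_distrib_left[symmetric] degree_form[OF sg, symmetric] ..
  finally show "2 * qform ?V (signless_fun G) x = (\<Sum>u\<in>?V. \<Sum>v\<in>?V. adj_fun G u v * (x u + x v)\<^sup>2)"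
    unfolding graph_qforms[OF simple_finite[OF sg]] by simp
  have "(\<Sum>u\<in>?V. \<Sum>v\<in>?V. adj_fun G u v * (x u - x v)\<^sup>2) =
    (\<Sum>u\<in>?V. \<Sum>v\<in>?V. adj_fun G u v * (x u)\<^sup>2 + adj_fun G u v * (x v)\<^sup>2 - 2 * (adj_fun G u v * (x u * x v)))"
    by (intro sum.cong refl) (simp add: power2_diff algebra_simps)
  also have "\<dots> = ?D + ?D - 2 * ?C"
    unfolding sum.distrib sum_subtractf sum_distrib_left[symmetric] degree_form[OF sg, symmetric] ..
  finally show "2 * qform ?V (laplace_fun G) x = (\<Sum>u\<in>?V. \<Sum>v\<in>?V. adj_fun G u v * (x u - x v)\<^sup>2)"
    unfolding graph_qforms[OF simple_finite[OF sg]] by simp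
qed

lemma adj_fun_nonneg: "adj_fun G u v \<ge> 0"
  unfolding adj_fun_def by simp

lemma qform_nonneg:
  assumes sg: "simple_graph G"
  shows "qform (verts G) (signless_fun G) x \<ge> 0" "qform (verts G) (laplace_fun G) x \<ge> 0"
proof -
  have "(\<Sum>u\<in>verts G. \<Sum>v\<in>verts G. adj_fun G u v * (x u + x v)\<^sup>2) \<ge> 0"
    by (intro sum_nonneg mult_nonneg_nonneg adj_fun_nonneg) auto
  then show "qform (verts G) (signless_fun G) x \<ge> 0" using qform_edges(1)[OF sg, of x] by simp
  have "(\<Sum>u\<in>verts G. \<Sum>v\<in>verts G. adj_fun G u v * (x u - x v)\<^sup>2) \<ge> 0"
    by (intro sum_nonneg mult_nonneg_nonneg adj_fun_nonneg) auto
  then show "qform (verts G) (laplace_fun G) x \<ge> 0" using qform_edges(2)[OF sg, of x] by simp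
qed

text \<open>\<open>S\<close> is a choice of some edges with one orientation each, while the double
  sum meets every edge in both orientations, hence the factor 2. Test vectors can thus be evaluated
  on a star or a double star whatever other edges the graph has.\<close>

lemma sum_edges_ge:
  fixes g :: "'a \<Rightarrow> 'a \<Rightarrow> real"
  assumes sg: "simple_graph G" and S: "\<And>p q. (p, q) \<in> S \<Longrightarrow> {p, q} \<in> edges G"
    and orient: "\<And>p q. (p, q) \<in> S \<Longrightarrow> (q, p) \<notin> S"
    and g: "\<And>u v. g u v \<ge> 0" "\<And>u v. g u v = g v u"
  shows "2 * (\<Sum>(p, q)\<in>S. g p q) \<le> (\<Sum>u\<in>verts G. \<Sum>v\<in>verts G. adj_fun G u v * g u v)"
proof -
  let ?V = "verts G"
  let ?h = "\<lambda>(u, v). adj_fun G u v * g u v"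
  have sub: "S \<union> S\<inverse> \<subseteq> ?V \<times> ?V" using S edge_verts[OF sg] by fast
  have fin: "finite (?V \<times> ?V)" using simple_finite[OF sg] by simp
  have fS: "finite S" by (rule finite_subset[OF _ fin]) (use sub in blast)
  have one: "(\<Sum>e\<in>S. ?h e) = (\<Sum>(p, q)\<in>S. g p q)"
    by (rule sum.cong) (auto simp: adj_fun_def dest: S)
  have "(\<Sum>e\<in>S\<inverse>. ?h e) = (\<Sum>e\<in>S. ?h (prod.swap e))"
    by (rule sum.reindex_bij_witness[of _ prod.swap prod.swap]) auto
  also have "\<dots> = (\<Sum>e\<in>S. ?h e)"
    by (rule sum.cong) (auto simp: adj_fun_commute g(2))
  finally have two: "(\<Sum>e\<in>S\<inverse>. ?h e) = (\<Sum>(p, q)\<in>S. g p q)" using one by simp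
  have "(\<Sum>e\<in>S \<union> S\<inverse>. ?h e) = (\<Sum>e\<in>S. ?h e) + (\<Sum>e\<in>S\<inverse>. ?h e)"
    by (rule sum.union_disjoint) (use fS orient in auto)
  moreover have "(\<Sum>e\<in>S \<union> S\<inverse>. ?h e) \<le> (\<Sum>e\<in>?V \<times> ?V. ?h e)"
    by (rule sum_mono2[OF fin sub]) (auto intro!: mult_nonneg_nonneg g(1) adj_fun_nonneg)
  ultimately show ?thesis unfolding one two sum.cartesian_product by simp
qed

definition two_point :: "'a \<Rightarrow> 'a \<Rightarrow> real \<Rightarrow> real \<Rightarrow> 'a \<Rightarrow> real" where
  "two_point u w \<alpha> \<beta> v = (if v = u then \<alpha> else if v = w then \<beta> else 0)"

lemma sum_two_point:
  assumes "finite V" "u \<in> V" "w \<in> V" "u \<noteq> w" "\<And>v. v \<in> V \<Longrightarrow> v \<noteq> u \<Longrightarrow> v \<noteq> w \<Longrightarrow> h v = 0"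
  shows "(\<Sum>v\<in>V. h v) = h u + (h w :: real)"
proof -
  have "(\<Sum>v\<in>V. h v) = (\<Sum>v\<in>{u, w}. h v)"
    using assms by (intro sum.mono_neutral_right) auto
  then show ?thesis using assms(4) by simp
qed

context symmetric_form
begin

lemma two_point_forms:
  assumes "u \<in> V" "w \<in> V" "u \<noteq> w"
  shows "qform V f (two_point u w \<alpha> \<beta>) = \<alpha>\<^sup>2 * f u u + 2 * \<alpha> * \<beta> * f u w + \<beta>\<^sup>2 * f w w"
    and "sqnorm V (two_point u w \<alpha> \<beta>) = \<alpha>\<^sup>2 + \<beta>\<^sup>2"
proof -
  let ?x = "two_point u w \<alpha> \<beta>"
  have x: "?x u = \<alpha>" "?x w = \<beta>" using assms unfolding two_point_def by auto
  have x0: "?x v = 0" if "v \<noteq> u" "v \<noteq> w" for v using that unfolding two_point_def by auto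
  have "(\<Sum>v\<in>V. f u' v * ?x u' * ?x v) = f u' u * ?x u' * \<alpha> + f u' w * ?x u' * \<beta>" for u'
    using sum_two_point[OF finite_set assms, of "\<lambda>v. f u' v * ?x u' * ?x v"] x0 x by simp
  then have "qform V f ?x = (\<Sum>u'\<in>V. f u' u * ?x u' * \<alpha> + f u' w * ?x u' * \<beta>)"
    unfolding qform_def by simp
  also have "\<dots> = (f u u * \<alpha> * \<alpha> + f u w * \<alpha> * \<beta>) + (f w u * \<beta> * \<alpha> + f w w * \<beta> * \<beta>)"
    using sum_two_point[OF finite_set assms, of "\<lambda>u'. f u' u * ?x u' * \<alpha> + f u' w * ?x u' * \<beta>"] x0 x by simp
  finally show "qform V f ?x = \<alpha>\<^sup>2 * f u u + 2 * \<alpha> * \<beta> * f u w + \<beta>\<^sup>2 * f w w"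
    using symf[OF assms(2,1)] by (simp add: power2_eq_square algebra_simps)
  show "sqnorm V ?x = \<alpha>\<^sup>2 + \<beta>\<^sup>2"
    unfolding sqnorm_def using sum_two_point[OF finite_set assms, of "\<lambda>v. (?x v)\<^sup>2"] x0 x by simp
qed

lemma length_ge_2:
  assumes "u \<in> V" "w \<in> V" "u \<noteq> w"
  shows "n \<ge> 2"
proof -
  have "card {u, w} \<le> card V" using assms by (intro card_mono) auto
  then show ?thesis using assms(3) distinct_card[OF dist] by simp
qed

lemma second_largest_eigenvalue_two_point:
  assumes uw: "u \<in> V" "w \<in> V" "u \<noteq> w"
    and form: "\<And>\<alpha> \<beta>. \<alpha>\<^sup>2 * f u u + 2 * \<alpha> * \<beta> * f u w + \<beta>\<^sup>2 * f w w \<ge> C * (\<alpha>\<^sup>2 + \<beta>\<^sup>2)"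
  shows "es ! 1 \<ge> C"
proof (rule second_largest_eigenvalue_ge[of "two_point u w 1 0" "two_point u w 0 1"])
  have lin: "(\<lambda>v. a * two_point u w 1 0 v + b * two_point u w 0 1 v) = two_point u w a b" for a b
    using uw(3) by (auto simp: two_point_def)
  show "n \<ge> 2" by (rule length_ge_2[OF uw])
  show "sqnorm V (\<lambda>v. a * two_point u w 1 0 v + b * two_point u w 0 1 v) > 0" if "(a, b) \<noteq> (0, 0)" for a b
    unfolding lin two_point_forms[OF uw] using that by (auto simp: sum_power2_gt_zero_iff)
  show "qform V f (\<lambda>v. a * two_point u w 1 0 v + b * two_point u w 0 1 v)
      \<ge> C * sqnorm V (\<lambda>v. a * two_point u w 1 0 v + b * two_point u w 0 1 v)" for a b
    unfolding lin two_point_forms[OF uw] by (rule form)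
qed

lemma smallest_eigenvalue_two_point:
  assumes uw: "u \<in> V" "w \<in> V" "u \<noteq> w" and "\<alpha>\<^sup>2 + \<beta>\<^sup>2 > 0"
    and "\<alpha>\<^sup>2 * f u u + 2 * \<alpha> * \<beta> * f u w + \<beta>\<^sup>2 * f w w \<le> C * (\<alpha>\<^sup>2 + \<beta>\<^sup>2)"
  shows "es ! (n - 1) \<le> C"
  by (rule smallest_eigenvalue_le[of "two_point u w \<alpha> \<beta>"]) (use assms two_point_forms[OF uw] in auto)

end

section \<open>Degrees in a connected graph\<close>

locale connected_simple_graph =
  fixes G :: "'a ugraph"
  assumes sg: "simple_graph G" and conn: "connected_graph G" and card3: "card (verts G) \<ge> 3"
begin

abbreviation "V \<equiv> verts G"
abbreviation "E \<equiv> edges G"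
abbreviation "deg v \<equiv> real (vdegree G v)"
abbreviation "qs \<equiv> eigenvalue_list (signless_laplacian G)"
abbreviation "ls \<equiv> eigenvalue_list (laplacian G)"

definition "\<Delta> = real (max_degree G)"
definition "\<Delta>' = real (second_max_degree G)"
definition "\<delta> = real (min_degree G)"

lemma finV: "finite V" by (rule simple_finite[OF sg])

sublocale Q: symmetric_form "vertex_list G" "signless_fun G"
  by (rule symmetric_form_laplace(2)[OF sg])

sublocale L: symmetric_form "vertex_list G" "laplace_fun G"
  by (rule symmetric_form_laplace(1)[OF sg])

lemmas vl = vertex_list[OF sg]
lemmas mats = laplacian_fun_mat[OF sg]
lemmas deg_card = vdegree_eq_card_nbrs[OF sg]

lemma delta_le: "v \<in> V \<Longrightarrow> \<delta> \<le> deg v"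
  unfolding \<delta>_def min_degree_def using finV by simp

lemma Delta_ge: "v \<in> V \<Longrightarrow> deg v \<le> \<Delta>"
  unfolding \<Delta>_def max_degree_def using finV by simp

lemma V_ne: "V \<noteq> {}" using card3 by auto

lemma min_vertex: obtains v where "v \<in> V" "deg v = \<delta>"
proof -
  have "Min (vdegree G ` V) \<in> vdegree G ` V" using finV V_ne by (intro Min_in) auto
  then show ?thesis using that unfolding \<delta>_def min_degree_def by auto
qed

text \<open>Sorting the vertices by degree, instead of the multiset of degrees, yields two distinct
  vertices that carry the first two entries of the degree sequence, also when these entries
  agree.\<close>

lemma top_vertices:
  obtains u w where "u \<in> V" "w \<in> V" "u \<noteq> w" "deg u = \<Delta>" "deg w = \<Delta>'"
    "\<And>v. v \<in> V \<Longrightarrow> v \<noteq> u \<Longrightarrow> deg v \<le> \<Delta>'"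
proof -
  define xs where "xs = rev (sort_key (vdegree G) (vertex_list G))"
  have xs: "distinct xs" "set xs = V" using vl unfolding xs_def by auto
  have len: "length xs = card V" using xs by (metis distinct_card)
  have s: "sorted (rev (map (vdegree G) xs))" unfolding xs_def rev_map by simp
  have "mset_set V = mset xs" using xs by (metis mset_set_set)
  then have "image_mset (vdegree G) (mset_set V) = mset (rev (map (vdegree G) xs))" by simp
  then have "degree_sequence G = rev (sorted_list_of_multiset (mset (rev (map (vdegree G) xs))))"
    unfolding degree_sequence_def by simp
  also have "\<dots> = map (vdegree G) xs"
    using s by (simp only: sorted_list_of_multiset_mset sorted_sort_id rev_rev_ident)
  finally have d2: "\<Delta>' = deg (xs ! 1)" unfolding \<Delta>'_def second_max_degree_def using len card3 by simp
  have mono: "vdegree G (xs ! j) \<le> vdegree G (xs ! i)" if "i \<le> j" "j < length xs" for i j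
    using s that sorted_rev_iff_nth_mono[of "map (vdegree G) xs"] by simp
  show ?thesis
  proof (rule that[of "xs ! 0" "xs ! 1"])
    show a: "xs ! 0 \<in> V" "xs ! 1 \<in> V" using xs(2) len card3 nth_mem[of 0 xs] nth_mem[of 1 xs] by auto
    show "xs ! 0 \<noteq> xs ! 1" using nth_eq_iff_index_eq[OF xs(1), of 0 1] len card3 by simp
    show "deg (xs ! 1) = \<Delta>'" using d2 by simp
    have le: "deg v \<le> deg (xs ! 0)" if "v \<in> V" for v
      using that mono[of 0] unfolding xs(2)[symmetric] by (auto simp: in_set_conv_nth)
    have "Max (vdegree G ` V) = vdegree G (xs ! 0)"
      using finV a(1) le by (intro Max_eqI) auto
    then show "deg (xs ! 0) = \<Delta>" unfolding \<Delta>_def max_degree_def by simp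
    show "deg v \<le> \<Delta>'" if v: "v \<in> V" "v \<noteq> xs ! 0" for v
    proof -
      obtain j where j: "j < length xs" "v = xs ! j" using v(1) unfolding xs(2)[symmetric] by (auto simp: in_set_conv_nth)
      then have "1 \<le> j" using v(2) by (cases j) auto
      then show ?thesis unfolding d2 using mono[of 1 j] j by simp
    qed
  qed
qed

lemma nbr_ex:
  assumes "v \<in> V"
  shows "nbrs G v \<noteq> {}"
proof -
  have "V \<noteq> {v}" using card3 by auto
  then obtain w where w: "w \<in> V" "w \<noteq> v" using assms by blast
  have "(v, w) \<in> {(x, y). {x, y} \<in> E}\<^sup>*" using conn assms w unfolding connected_graph_def by blast
  then obtain y where "{v, y} \<in> E" using w(2) by (cases rule: converse_rtranclE) auto
  then show ?thesis unfolding nbrs_def using edge_verts[OF sg] by blast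
qed

lemma deg_ge_1: "v \<in> V \<Longrightarrow> deg v \<ge> 1"
  unfolding deg_card using nbr_ex[of v] finite_nbrs[OF sg, of v] by (simp add: Suc_leI card_gt_0_iff)

lemma delta_ge_1: "\<delta> \<ge> 1"
  using min_vertex deg_ge_1 by metis

lemma nbrs_sub: "nbrs G v \<subseteq> V - {v}"
  unfolding nbrs_def using edge_verts(3)[OF sg] by blast

lemma deg_le: "v \<in> V \<Longrightarrow> deg v \<le> real (card V) - 1"
proof -
  assume v: "v \<in> V"
  have "card (nbrs G v) \<le> card (V - {v})" by (rule card_mono) (use finV nbrs_sub in auto)
  also have "\<dots> = card V - 1" using v finV by simp
  finally show ?thesis unfolding deg_card using card3 by simp
qed

end

section \<open>Star vectors and vectors on two vertices\<close>

context connected_simple_graph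
begin

text \<open>The larger eigenvalue of the 2 x 2 matrix with diagonal \<Delta>, \<delta> and
  off-diagonal entries sqrt \<Delta>: the signless form of the star in the orthonormal coordinates
  given by the centre and the normalized sum of the leaves.\<close>

definition "T = 1 / 2 * (\<Delta> + \<delta> + sqrt ((\<Delta> - \<delta>)\<^sup>2 + 4 * \<Delta>))"

lemma delta_le_Delta: "\<delta> \<le> \<Delta>"
  using min_vertex Delta_ge by metis

lemma T_bounds: "T \<ge> \<Delta> + 1" "(T - \<Delta>) * (T - \<delta>) = \<Delta>"
proof -
  let ?r = "sqrt ((\<Delta> - \<delta>)\<^sup>2 + 4 * \<Delta>)"
  have D: "\<Delta> \<ge> 1" using delta_le_Delta delta_ge_1 by simp
  \<comment> \<open>Expanded, this is just \<delta> \<ge> 1.\<close>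
  have "(\<Delta> - \<delta> + 2)\<^sup>2 \<le> (\<Delta> - \<delta>)\<^sup>2 + 4 * \<Delta>"
    using delta_ge_1 by (simp add: power2_eq_square algebra_simps)
  then have "\<Delta> - \<delta> + 2 \<le> ?r" by (rule real_le_rsqrt)
  then show "T \<ge> \<Delta> + 1" unfolding T_def by simp
  have r: "?r * ?r = (\<Delta> - \<delta>)\<^sup>2 + 4 * \<Delta>" using D by simp
  have "4 * ((T - \<Delta>) * (T - \<delta>)) = (?r - (\<Delta> - \<delta>)) * (?r + (\<Delta> - \<delta>))"
    unfolding T_def by (simp add: algebra_simps)
  also have "\<dots> = 4 * \<Delta>" using r by (simp add: algebra_simps power2_eq_square)
  finally show "(T - \<Delta>) * (T - \<delta>) = \<Delta>" by simp
qed

text \<open>The eigenvector of the form on a star that belongs to \<open>T\<close>, perturbed by \<open>\<epsilon>\<close> at a further vertex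
  \<open>q\<close>; the choice \<open>q = c\<close> encodes the unperturbed vector.\<close>

definition star_vec :: "'a \<Rightarrow> 'a \<Rightarrow> real \<Rightarrow> 'a \<Rightarrow> real" where
  "star_vec c q \<epsilon> v = (if v = c then \<Delta> else if v \<in> nbrs G c then T - \<Delta> else if v = q then \<epsilon> else 0)"

lemma star_vec_sums:
  assumes c: "c \<in> V" "deg c = \<Delta>" and q: "q \<in> V" "q = c \<or> q \<notin> nbrs G c \<and> q \<noteq> c" "q = c \<Longrightarrow> \<epsilon> = 0" and e: "\<epsilon> \<ge> 0"
  shows "sqnorm V (star_vec c q \<epsilon>) = \<Delta>\<^sup>2 + \<Delta> * (T - \<Delta>)\<^sup>2 + \<epsilon>\<^sup>2"
    and "(\<Sum>v\<in>V. deg v * (star_vec c q \<epsilon> v)\<^sup>2) \<ge> \<Delta> * \<Delta>\<^sup>2 + \<delta> * (\<Delta> * (T - \<Delta>)\<^sup>2)"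
proof -
  let ?N = "nbrs G c" and ?x = "star_vec c q \<epsilon>"
  have cN: "c \<notin> ?N" using nbrs_sub by blast
  have fN: "finite ?N" by (rule finite_nbrs[OF sg])
  have NV: "?N \<subseteq> V" using nbrs_sub by blast
  have cardN: "real (card ?N) = \<Delta>" using c(2) deg_card by simp
  have split: "(\<Sum>v\<in>V. h v) = h c + (\<Sum>v\<in>?N. h v) + (\<Sum>v\<in>V - insert c ?N. h v)" for h :: "'a \<Rightarrow> real"
  proof -
    have "(\<Sum>v\<in>V. h v) = (\<Sum>v\<in>V - insert c ?N. h v) + (\<Sum>v\<in>insert c ?N. h v)"
      by (rule sum.subset_diff) (use NV c finV in auto)
    then show ?thesis using fN cN by simp
  qed
  have xc: "?x c = \<Delta>" unfolding star_vec_def by simp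
  have xN: "?x v = T - \<Delta>" if "v \<in> ?N" for v using that cN unfolding star_vec_def by auto
  have "(\<Sum>v\<in>V - insert c ?N. (?x v)\<^sup>2) = (\<Sum>v\<in>V - insert c ?N. if v = q then \<epsilon>\<^sup>2 else 0)"
    by (rule sum.cong) (auto simp: star_vec_def)
  also have "\<dots> = \<epsilon>\<^sup>2" using q finV by auto
  finally show "sqnorm V ?x = \<Delta>\<^sup>2 + \<Delta> * (T - \<Delta>)\<^sup>2 + \<epsilon>\<^sup>2"
    unfolding sqnorm_def split xc using xN cardN by simp
  have "(\<Sum>v\<in>?N. \<delta> * (T - \<Delta>)\<^sup>2) \<le> (\<Sum>v\<in>?N. deg v * (?x v)\<^sup>2)"
    by (intro sum_mono) (use delta_le NV xN in \<open>auto intro!: mult_right_mono\<close>)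
  then have "\<delta> * (\<Delta> * (T - \<Delta>)\<^sup>2) \<le> (\<Sum>v\<in>?N. deg v * (?x v)\<^sup>2)" using cardN by (simp add: mult_ac)
  moreover have "(\<Sum>v\<in>V - insert c ?N. deg v * (?x v)\<^sup>2) \<ge> 0" by (intro sum_nonneg) auto
  ultimately show "(\<Sum>v\<in>V. deg v * (?x v)\<^sup>2) \<ge> \<Delta> * \<Delta>\<^sup>2 + \<delta> * (\<Delta> * (T - \<Delta>)\<^sup>2)"
    unfolding split[of "\<lambda>v. deg v * (?x v)\<^sup>2"] xc c(2) by linarith
qed

lemma star_value:
  "\<Delta> * \<Delta>\<^sup>2 + \<delta> * (\<Delta> * (T - \<Delta>)\<^sup>2) + 2 * (\<Delta> * (\<Delta> * (T - \<Delta>))) = T * (\<Delta>\<^sup>2 + \<Delta> * (T - \<Delta>)\<^sup>2)"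
proof -
  define \<tau> where "\<tau> = T - \<Delta>"
  have T: "T = \<Delta> + \<tau>" unfolding \<tau>_def by simp
  have eq: "\<Delta> = \<tau> * (\<tau> + \<Delta> - \<delta>)" using T_bounds(2) unfolding T by (simp add: algebra_simps)
  have "\<Delta> * \<Delta>\<^sup>2 + \<delta> * (\<Delta> * \<tau>\<^sup>2) + 2 * (\<Delta> * (\<Delta> * \<tau>)) - (\<Delta> + \<tau>) * (\<Delta>\<^sup>2 + \<Delta> * \<tau>\<^sup>2)
     = \<Delta> * \<tau> * (\<Delta> - \<tau> * (\<tau> + \<Delta> - \<delta>))"
    by (simp add: power2_eq_square algebra_simps)
  also have "\<dots> = 0" using eq by simp
  finally show ?thesis unfolding T by simp
qed

text \<open>\<open>F\<close> holds at most one edge away from the centre. This edge brings the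
  surplus that makes the bound for the largest eigenvalue strict.\<close>

lemma star_vec_form:
  assumes c: "c \<in> V" "deg c = \<Delta>" and q: "q \<in> V" "q = c \<or> q \<notin> nbrs G c \<and> q \<noteq> c" "q = c \<Longrightarrow> \<epsilon> = 0" and e: "\<epsilon> \<ge> 0"
    and F: "F = {} \<or> (\<exists>a b. F = {(a, b)} \<and> {a, b} \<in> E \<and> a \<noteq> c \<and> b \<noteq> c)"
  shows "qform V (signless_fun G) (star_vec c q \<epsilon>) \<ge>
    T * (\<Delta>\<^sup>2 + \<Delta> * (T - \<Delta>)\<^sup>2) + 2 * (\<Sum>(a, b)\<in>F. star_vec c q \<epsilon> a * star_vec c q \<epsilon> b)"
proof -
  let ?N = "nbrs G c" and ?x = "star_vec c q \<epsilon>"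
  have T: "T \<ge> \<Delta>" "\<Delta> \<ge> 0" using T_bounds(1) delta_le_Delta delta_ge_1 by auto
  have xnn: "?x v \<ge> 0" for v unfolding star_vec_def using T e by auto
  have cN: "c \<notin> ?N" using nbrs_sub by blast
  have fN: "finite ?N" by (rule finite_nbrs[OF sg])
  have fF: "finite F" using F by auto
  let ?S = "{c} \<times> ?N \<union> F"
  have "2 * (\<Sum>(p, q)\<in>?S. ?x p * ?x q) \<le> (\<Sum>u\<in>V. \<Sum>v\<in>V. adj_fun G u v * (?x u * ?x v))"
  proof (rule sum_edges_ge[OF sg])
    show "\<And>p q. (p, q) \<in> ?S \<Longrightarrow> {p, q} \<in> E" using F unfolding nbrs_def by auto
    show "(q, p) \<notin> ?S" if pq: "(p, q) \<in> ?S" for p q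
    proof -
      have ne: "p \<noteq> q" using pq F cN edge_verts(3)[OF sg] by auto
      then show ?thesis using pq F cN by auto
    qed
  qed (auto simp: xnn mult.commute)
  moreover have "(\<Sum>(p, q)\<in>?S. ?x p * ?x q) = (\<Sum>(p, q)\<in>{c} \<times> ?N. ?x p * ?x q) + (\<Sum>(p, q)\<in>F. ?x p * ?x q)"
    by (rule sum.union_disjoint) (use F fN fF in auto)
  moreover have "(\<Sum>(p, q)\<in>{c} \<times> ?N. ?x p * ?x q) = (\<Sum>q\<in>?N. \<Delta> * (T - \<Delta>))"
  proof -
    have "(\<Sum>(p, q)\<in>{c} \<times> ?N. ?x p * ?x q) = (\<Sum>q\<in>?N. ?x c * ?x q)"
      by (subst sum.cartesian_product[symmetric]) simp
    also have "\<dots> = (\<Sum>q\<in>?N. \<Delta> * (T - \<Delta>))"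
      by (rule sum.cong) (use cN in \<open>auto simp: star_vec_def\<close>)
    finally show ?thesis .
  qed
  moreover have "(\<Sum>q\<in>?N. \<Delta> * (T - \<Delta>)) = \<Delta> * (\<Delta> * (T - \<Delta>))" using c(2) deg_card by simp
  ultimately show ?thesis
    using star_vec_sums(2)[OF c q e] star_value unfolding graph_qforms(1)[OF finV] by linarith
qed

lemma qs_0_ge_T: "qs ! 0 \<ge> T"
proof -
  obtain c where c: "c \<in> V" "deg c = \<Delta>" using top_vertices by metis
  have D: "\<Delta> \<ge> 1" using delta_le_Delta delta_ge_1 by simp
  have n: "sqnorm V (star_vec c c 0) = \<Delta>\<^sup>2 + \<Delta> * (T - \<Delta>)\<^sup>2"
    using star_vec_sums(1)[OF c c(1), of 0] by simp
  have f: "qform V (signless_fun G) (star_vec c c 0) \<ge> T * (\<Delta>\<^sup>2 + \<Delta> * (T - \<Delta>)\<^sup>2)"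
    using star_vec_form[OF c c(1), of 0 "{}"] by simp
  have p: "\<Delta>\<^sup>2 + \<Delta> * (T - \<Delta>)\<^sup>2 > 0" using D by (simp add: add_pos_nonneg)
  show ?thesis
    using Q.largest_eigenvalue_ge[of "star_vec c c 0" T] n f p unfolding mats vl(2) by simp
qed

lemma bipartite_if_edges_meet:
  assumes c: "c \<in> V" and "\<And>a b. {a, b} \<in> E \<Longrightarrow> a = c \<or> b = c"
  shows "bipartite G"
  unfolding bipartite_def
proof (rule exI[of _ "{c}"], rule exI[of _ "V - {c}"], intro conjI ballI)
  fix e assume e: "e \<in> E"
  then obtain a b where ab: "e = {a, b}" "a \<in> V" "b \<in> V" "a \<noteq> b" using sg unfolding simple_graph_def by blast
  then have "a = c \<or> b = c" using assms(2) e by blast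
  then show "\<exists>x\<in>{c}. \<exists>y\<in>V - {c}. e = {x, y}" using ab by (auto simp: insert_commute)
qed (use c in auto)

text \<open>If the star covers all vertices, a non-bipartite graph has an edge between two leaves,
  and it adds to the form without changing the norm. Otherwise connectivity gives an edge from a
  leaf to a vertex \<open>b\<close> outside the star, and a small positive entry at \<open>b\<close>
  raises the quotient.\<close>

lemma qs_0_gt_T:
  assumes nb: "\<not> bipartite G"
  shows "qs ! 0 > T"
proof -
  obtain c where c: "c \<in> V" "deg c = \<Delta>" using top_vertices by metis
  have D: "\<Delta> \<ge> 1" using delta_le_Delta delta_ge_1 by simp
  let ?N = "nbrs G c" and ?\<tau> = "T - \<Delta>"
  have \<tau>: "?\<tau> \<ge> 1" using T_bounds(1) by simp
  have T: "T > 0" using T_bounds(1) D by simp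
  have p: "\<Delta>\<^sup>2 + \<Delta> * ?\<tau>\<^sup>2 > 0" using D by (simp add: add_pos_nonneg)
  have cN: "c \<notin> ?N" using nbrs_sub by blast
  show ?thesis
  proof (cases "V \<subseteq> insert c ?N")
    case True
    obtain a b where ab: "{a, b} \<in> E" "a \<noteq> c" "b \<noteq> c" using bipartite_if_edges_meet[OF c(1)] nb by blast
    then have N: "a \<in> ?N" "b \<in> ?N" using True edge_verts[OF sg ab(1)] by auto
    let ?x = "star_vec c c 0"
    have "?x a = ?\<tau>" "?x b = ?\<tau>" using N ab unfolding star_vec_def by auto
    then have f: "qform V (signless_fun G) ?x \<ge> T * (\<Delta>\<^sup>2 + \<Delta> * ?\<tau>\<^sup>2) + 2 * (?\<tau> * ?\<tau>)"
      using star_vec_form[OF c c(1), of 0 "{(a, b)}"] ab by simp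
    have n: "sqnorm V ?x = \<Delta>\<^sup>2 + \<Delta> * ?\<tau>\<^sup>2"
      using star_vec_sums(1)[OF c c(1), of 0] by simp
    have "?\<tau> * ?\<tau> > 0" using \<tau> by simp
    then show ?thesis
      using Q.largest_eigenvalue_gt[of ?x T] n f p unfolding mats vl(2) by simp
  next
    case False
    then obtain w where w: "w \<in> V" "w \<notin> insert c ?N" by blast
    have "(c, w) \<in> {(x, y). {x, y} \<in> E}\<^sup>*" using conn c w unfolding connected_graph_def by blast
    then have "w \<notin> insert c ?N \<longrightarrow> (\<exists>a b. {a, b} \<in> E \<and> a \<in> insert c ?N \<and> b \<notin> insert c ?N)"
      by (induction rule: rtrancl_induct) auto
    then obtain a b where ab: "{a, b} \<in> E" "a \<in> insert c ?N" "b \<notin> insert c ?N" using w by blast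
    have bV: "b \<in> V" using edge_verts[OF sg ab(1)] by simp
    have "a \<noteq> c" using ab bV unfolding nbrs_def by auto
    then have a: "a \<in> ?N" using ab by simp
    \<comment> \<open>Maximizes the gain \<open>2 * \<tau> * \<epsilon>\<close> from the new edge
      minus the cost \<open>T * \<epsilon>^2\<close> of the longer vector, where \<tau> = T -
      \<Delta>; the net gain is \<open>\<tau> * \<epsilon>\<close>.\<close>
    define \<epsilon> where "\<epsilon> = ?\<tau> / T"
    have \<epsilon>: "\<epsilon> > 0" unfolding \<epsilon>_def using \<tau> T by simp
    let ?x = "star_vec c b \<epsilon>"
    have q: "b = c \<or> b \<notin> ?N \<and> b \<noteq> c" "b = c \<Longrightarrow> \<epsilon> = 0" using ab by auto
    have "?x a = ?\<tau>" "?x b = \<epsilon>" using a \<open>a \<noteq> c\<close> ab unfolding star_vec_def by auto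
    then have f: "qform V (signless_fun G) ?x \<ge> T * (\<Delta>\<^sup>2 + \<Delta> * ?\<tau>\<^sup>2) + 2 * (?\<tau> * \<epsilon>)"
      using star_vec_form[OF c bV q, of "{(a, b)}"] ab \<open>a \<noteq> c\<close> \<epsilon> by simp
    have n: "sqnorm V ?x = \<Delta>\<^sup>2 + \<Delta> * ?\<tau>\<^sup>2 + \<epsilon>\<^sup>2"
      using star_vec_sums(1)[OF c bV q] \<epsilon> by simp
    have "T * \<epsilon>\<^sup>2 = ?\<tau> * \<epsilon>" unfolding \<epsilon>_def using T by (simp add: power2_eq_square)
    moreover have "?\<tau> * \<epsilon> > 0" using \<tau> \<epsilon> by simp
    ultimately have "T * sqnorm V ?x < qform V (signless_fun G) ?x" using f unfolding n by (simp add: algebra_simps)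
    moreover have "sqnorm V ?x > 0" unfolding n using p by (simp add: add_pos_nonneg)
    ultimately show ?thesis using Q.largest_eigenvalue_gt[of ?x T] unfolding mats vl(2) by simp
  qed
qed

lemma signless_diag: "signless_fun G v v = deg v"
  unfolding signless_fun_def using adj_fun_self[OF sg] by simp

lemma laplace_diag: "laplace_fun G v v = deg v"
  unfolding laplace_fun_def using adj_fun_self[OF sg] by simp

text \<open>Tested on all vectors supported on the two vertices of largest degree. The mixed term of
  a possible edge between them is at least minus the squared norm, which costs the 1.\<close>

lemma qs_1_ge: "qs ! 1 \<ge> \<Delta>' - 1"
proof -
  obtain u w where uw: "u \<in> V" "w \<in> V" "u \<noteq> w" "deg u = \<Delta>" "deg w = \<Delta>'"
    "\<And>v. v \<in> V \<Longrightarrow> v \<noteq> u \<Longrightarrow> deg v \<le> \<Delta>'" by (rule top_vertices, rule that)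
  have le: "deg w \<le> deg u" using Delta_ge[OF uw(2)] uw(4) by simp
  have "eigenvalue_list (fun_mat (vertex_list G) (signless_fun G)) ! 1 \<ge> deg w - 1"
  proof (rule Q.second_largest_eigenvalue_two_point[of u w])
    fix \<alpha> \<beta> :: real
    define a where "a = signless_fun G u w"
    have a: "a = 0 \<or> a = 1" unfolding a_def signless_fun_def adj_fun_def using uw(3) by simp
    have "(deg w - 1) * (\<alpha>\<^sup>2 + \<beta>\<^sup>2) \<le> deg u * \<alpha>\<^sup>2 + deg w * \<beta>\<^sup>2 - (\<alpha>\<^sup>2 + \<beta>\<^sup>2)"
      using mult_right_mono[OF le, of "\<alpha>\<^sup>2"] by (simp add: algebra_simps)
    also have "\<dots> \<le> deg u * \<alpha>\<^sup>2 + deg w * \<beta>\<^sup>2 + 2 * \<alpha> * \<beta> * a"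
      using a zero_le_power2[of "\<alpha> + \<beta>"] zero_le_power2[of \<alpha>] zero_le_power2[of \<beta>]
      by (auto simp: power2_sum)
    finally show "(deg w - 1) * (\<alpha>\<^sup>2 + \<beta>\<^sup>2) \<le> \<alpha>\<^sup>2 * signless_fun G u u + 2 * \<alpha> * \<beta> * signless_fun G u w + \<beta>\<^sup>2 * signless_fun G w w"
      unfolding signless_diag a_def by (simp add: mult_ac)
  qed (use uw vl in auto)
  then show ?thesis unfolding mats uw(5) .
qed

lemma second_eigenvalue_nonadjacent:
  assumes uw: "u \<in> V" "w \<in> V" "u \<noteq> w" "{u, w} \<notin> E" and C: "C \<le> deg u" "C \<le> deg w"
  shows "qs ! 1 \<ge> C" "ls ! 1 \<ge> C"
proof -
  have z: "signless_fun G u w = 0" "laplace_fun G u w = 0"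
    unfolding signless_fun_def laplace_fun_def adj_fun_def using uw by auto
  have ge: "C * (\<alpha>\<^sup>2 + \<beta>\<^sup>2) \<le> \<alpha>\<^sup>2 * deg u + \<beta>\<^sup>2 * deg w" for \<alpha> \<beta> :: real
    using mult_right_mono[OF C(1), of "\<alpha>\<^sup>2"] mult_right_mono[OF C(2), of "\<beta>\<^sup>2"] by (simp add: algebra_simps)
  show "qs ! 1 \<ge> C" unfolding mats
    by (rule Q.second_largest_eigenvalue_two_point[of u w]) (use uw vl ge in \<open>auto simp: z signless_diag\<close>)
  show "ls ! 1 \<ge> C" unfolding mats
    by (rule L.second_largest_eigenvalue_two_point[of u w]) (use uw vl ge in \<open>auto simp: z laplace_diag\<close>)
qed

lemma qs_last_le: "qs ! (card V - 1) \<le> \<delta>"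
proof -
  obtain v where v: "v \<in> V" "deg v = \<delta>" by (rule min_vertex)
  have "V \<noteq> {v}" using card3 by auto
  then obtain w where w: "w \<in> V" "w \<noteq> v" using v by blast
  show ?thesis unfolding mats vl(3)[symmetric]
    by (rule Q.smallest_eigenvalue_two_point[of v w 1 0]) (use v w vl signless_diag[of v] in auto)
qed

text \<open>With the values 1 and -1 at the ends of the edge, the form is 2 \<delta> - 2 and the
  squared norm is 2.\<close>

lemma qs_last_adjacent:
  assumes "{u, w} \<in> E" "deg u = \<delta>" "deg w = \<delta>"
  shows "qs ! (card V - 1) \<le> \<delta> - 1"
proof -
  have uw: "u \<in> V" "w \<in> V" "u \<noteq> w" using edge_verts[OF sg assms(1)] by auto
  have "signless_fun G u w = 1" using uw assms(1) unfolding signless_fun_def adj_fun_def by simp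
  then show ?thesis unfolding mats vl(3)[symmetric]
    by (intro Q.smallest_eigenvalue_two_point[of u w 1 "-1"]) (use assms uw vl signless_diag in auto)
qed

end

section \<open>Laplacian eigenvalues of bipartite graphs\<close>

context connected_simple_graph
begin

lemma bipartite_no_triangle:
  assumes "bipartite G" "{a, b} \<in> E" "{b, c} \<in> E" "{a, c} \<in> E"
  shows False
proof -
  obtain X Y where "X \<union> Y = V \<and> X \<inter> Y = {} \<and> (\<forall>e\<in>E. \<exists>x\<in>X. \<exists>y\<in>Y. e = {x, y})"
    using assms(1) unfolding bipartite_def by (elim exE)
  then have XY: "X \<inter> Y = {}" "\<forall>e\<in>E. \<exists>x\<in>X. \<exists>y\<in>Y. e = {x, y}" by blast+
  have "(u \<in> X \<and> v \<in> Y) \<or> (u \<in> Y \<and> v \<in> X)" if uv: "{u, v} \<in> E" for u v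
  proof -
    obtain x y where "x \<in> X" "y \<in> Y" "{u, v} = {x, y}" using bspec[OF XY(2) uv] by (elim bexE)
    then show ?thesis by (auto simp: doubleton_eq_iff)
  qed
  from this[OF assms(2)] this[OF assms(3)] this[OF assms(4)] show False using XY(1) by blast
qed

lemma vl_length: "length (vertex_list G) \<ge> 2"
  using vl(3) card3 by simp

lemma ls_nonneg: "k < card V \<Longrightarrow> ls ! k \<ge> 0"
  unfolding mats using L.eigenvalues_nonneg[of k] qform_nonneg(2)[OF sg] vl by simp

lemma qs_nonneg: "k < card V \<Longrightarrow> qs ! k \<ge> 0"
  unfolding mats using Q.eigenvalues_nonneg[of k] qform_nonneg(1)[OF sg] vl by simp

lemma ls_last: "ls ! (card V - 1) = 0"
proof -
  have "2 * qform V (laplace_fun G) (\<lambda>_. 1) = 0"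
    unfolding qform_edges(2)[OF sg] by simp
  moreover have "sqnorm V (\<lambda>_. 1 :: real) > 0" unfolding sqnorm_def using card3 by simp
  ultimately have "ls ! (card V - 1) \<le> 0"
    using L.smallest_eigenvalue_le[of "\<lambda>_. 1" 0] unfolding mats vl(2,3) by simp
  then show ?thesis using ls_nonneg[of "card V - 1"] card3 by simp
qed

text \<open>The edges of a symmetric double star around \<open>{u, w}\<close> already give a plane on which the Laplacian
  form is at least \<open>k + 1\<close> times the squared norm: \<open>f\<close> is the eigenvector of the double star for the
  eigenvalue \<open>k + 1\<close>, and \<open>g\<close> is antisymmetric under the exchange of \<open>u\<close> and \<open>w\<close>.\<close>

lemma double_star:
  assumes bip: "bipartite G" and uw: "{u, w} \<in> E" and k: "k \<ge> 1"
    and du: "real k + 1 \<le> deg u" and dw: "real k + 1 \<le> deg w"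
  shows "ls ! 1 \<ge> real k + 1"
proof -
  have uwV: "u \<in> V" "w \<in> V" "u \<noteq> w" using edge_verts[OF sg uw] by auto
  have wu: "{w, u} \<in> E" using uw by (simp add: insert_commute)
  have "k \<le> card (nbrs G u - {w})" using du unfolding deg_card
    using uw uwV finite_nbrs[OF sg] by (subst card_Diff_singleton) (auto simp: nbrs_def)
  then obtain A where A: "A \<subseteq> nbrs G u - {w}" "card A = k" "finite A"
    by (rule obtain_subset_with_card_n)
  have "k \<le> card (nbrs G w - {u})" using dw unfolding deg_card
    using wu uwV finite_nbrs[OF sg] by (subst card_Diff_singleton) (auto simp: nbrs_def)
  then obtain B where B: "B \<subseteq> nbrs G w - {u}" "card B = k" "finite B"
    by (rule obtain_subset_with_card_n)
  have AE: "{u, p} \<in> E" "p \<in> V" if "p \<in> A" for p using that A(1) unfolding nbrs_def by auto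
  have BE: "{w, p} \<in> E" "p \<in> V" if "p \<in> B" for p using that B(1) unfolding nbrs_def by auto
  have uA: "u \<notin> A" using A(1) nbrs_sub[of u] by blast
  have wA: "w \<notin> A" using A(1) by blast
  have wB: "w \<notin> B" using B(1) nbrs_sub[of w] by blast
  have uB: "u \<notin> B" using B(1) by blast
  have AB: "A \<inter> B = {}"
  proof (rule ccontr)
    assume "A \<inter> B \<noteq> {}"
    then obtain p where "p \<in> A" "p \<in> B" by blast
    then show False using bipartite_no_triangle[OF bip uw BE(1) AE(1)] by blast
  qed
  let ?\<kappa> = "real k"
  have \<kappa>: "?\<kappa> > 0" using k by simp
  define f where "f v = (if v = u \<or> v = w then 1 else if v \<in> A \<union> B then - 1 / ?\<kappa> else 0)" for v
  define g where "g v = (if v = u then 1 else if v = w then - 1 else 0 :: real)" for v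
  define x where "x a b v = a * f v + b * g v" for a b v
  have xu: "x a b u = a + b" for a b unfolding x_def f_def g_def by simp
  have xw: "x a b w = a - b" for a b unfolding x_def f_def g_def using uwV by simp
  have xA: "x a b p = - a / ?\<kappa>" if "p \<in> A" for a b p unfolding x_def f_def g_def using that uA wA by auto
  have xB: "x a b p = - a / ?\<kappa>" if "p \<in> B" for a b p unfolding x_def f_def g_def using that uB wB by auto
  have x0: "x a b p = 0" if "p \<notin> insert u (insert w (A \<union> B))" for a b p
    unfolding x_def f_def g_def using that by auto
  have norm: "sqnorm V (x a b) = (a + b)\<^sup>2 + (a - b)\<^sup>2 + 2 * a\<^sup>2 / ?\<kappa>" for a b
  proof -
    have "sqnorm V (x a b) = (\<Sum>v\<in>insert u (insert w (A \<union> B)). (x a b v)\<^sup>2)"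
      unfolding sqnorm_def using finV uwV AE BE x0 by (intro sum.mono_neutral_right) auto
    also have "\<dots> = (a + b)\<^sup>2 + ((a - b)\<^sup>2 + ((\<Sum>v\<in>A. (x a b v)\<^sup>2) + (\<Sum>v\<in>B. (x a b v)\<^sup>2)))"
      using uA uB wA wB uwV A B AB by (simp add: xu xw sum.union_disjoint)
    also have "\<dots> = (a + b)\<^sup>2 + (a - b)\<^sup>2 + 2 * a\<^sup>2 / ?\<kappa>"
      using \<kappa> A(2) B(2) by (simp add: xA xB power2_eq_square)
    finally show ?thesis .
  qed
  have form: "(?\<kappa> + 1) * sqnorm V (x a b) \<le> qform V (laplace_fun G) (x a b)" for a b
  proof -
    let ?S = "insert (u, w) ({u} \<times> A \<union> {w} \<times> B)"
    let ?h = "\<lambda>p q. (x a b p - x a b q)\<^sup>2"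
    have "2 * (\<Sum>(p, q)\<in>?S. ?h p q) \<le> (\<Sum>p\<in>V. \<Sum>q\<in>V. adj_fun G p q * ?h p q)"
    proof (rule sum_edges_ge[OF sg])
      show "\<And>p q. (p, q) \<in> ?S \<Longrightarrow> {p, q} \<in> E" using uw AE BE by auto
      show "\<And>p q. (p, q) \<in> ?S \<Longrightarrow> (q, p) \<notin> ?S" using uA uB wA wB uwV by auto
    qed (auto simp: power2_commute)
    then have "(\<Sum>(p, q)\<in>?S. ?h p q) \<le> qform V (laplace_fun G) (x a b)"
      using qform_edges(2)[OF sg, of "x a b"] by simp
    moreover have "(\<Sum>(p, q)\<in>?S. ?h p q) = ?h u w + ((\<Sum>(p, q)\<in>{u} \<times> A. ?h p q) + (\<Sum>(p, q)\<in>{w} \<times> B. ?h p q))"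
    proof -
      have "(u, w) \<notin> {u} \<times> A \<union> {w} \<times> B" using wA uwV by auto
      moreover have "finite ({u} \<times> A \<union> {w} \<times> B)" using A(3) B(3) by simp
      moreover have "({u} \<times> A) \<inter> ({w} \<times> B) = {}" using uwV by auto
      ultimately show ?thesis
        using sum.union_disjoint[of "{u} \<times> A" "{w} \<times> B" "\<lambda>(p, q). ?h p q"] A(3) B(3) by simp
    qed
    moreover have "(\<Sum>(p, q)\<in>{u} \<times> A. ?h p q) = (\<Sum>q\<in>A. ?h u q)" "(\<Sum>(p, q)\<in>{w} \<times> B. ?h p q) = (\<Sum>q\<in>B. ?h w q)"
      by (subst sum.cartesian_product[symmetric]; simp)+
    moreover have "(\<Sum>q\<in>A. ?h u q) = ?\<kappa> * (a + b + a / ?\<kappa>)\<^sup>2" "(\<Sum>q\<in>B. ?h w q) = ?\<kappa> * (a - b + a / ?\<kappa>)\<^sup>2"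
      using A(2) B(2) by (simp_all add: xu xw xA xB)
    moreover have "?h u w = 4 * b\<^sup>2" unfolding xu xw by (simp add: power2_eq_square algebra_simps)
    \<comment> \<open>On these edges \<open>f\<close> has the quotient k + 1 exactly, while the
      antisymmetric \<open>g\<close> has k + 2; the latter accounts for the excess of twice the
      square of \<open>b\<close>.\<close>
    moreover have "4 * b\<^sup>2 + (?\<kappa> * (a + b + a / ?\<kappa>)\<^sup>2 + ?\<kappa> * (a - b + a / ?\<kappa>)\<^sup>2)
        = (?\<kappa> + 1) * ((a + b)\<^sup>2 + (a - b)\<^sup>2 + 2 * a\<^sup>2 / ?\<kappa>) + 2 * b\<^sup>2"
      using \<kappa> by (simp add: power2_eq_square field_simps)
    ultimately show ?thesis unfolding norm using zero_le_power2[of b] by linarith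
  qed
  have pos: "sqnorm V (x a b) > 0" if "(a, b) \<noteq> (0, 0)" for a b
  proof -
    have eq: "(a + b)\<^sup>2 + (a - b)\<^sup>2 = 2 * (a\<^sup>2 + b\<^sup>2)" by (simp add: power2_eq_square algebra_simps)
    have "a\<^sup>2 + b\<^sup>2 > 0" using that by (auto simp: sum_power2_gt_zero_iff)
    then have "(a + b)\<^sup>2 + (a - b)\<^sup>2 > 0" unfolding eq by simp
    then show ?thesis unfolding norm by (rule add_pos_nonneg) simp
  qed
  show ?thesis unfolding mats
    using L.second_largest_eigenvalue_ge[of f g "?\<kappa> + 1"] vl_length pos form
    unfolding vl(2) x_def by blast
qed

text \<open>Only adjacent top vertices need the double star, and its vector divides by the number k
  = \<Delta>' - 1 of leaves. If \<Delta>' = 1, then \<open>w\<close> has the single neighbour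
  \<open>u\<close>, and any third vertex, of degree at least 1, is a non-neighbour to pair with
  \<open>w\<close>.\<close>

lemma ls_1_ge:
  assumes bip: "bipartite G"
  shows "ls ! 1 \<ge> \<Delta>'"
proof -
  obtain u w where uw: "u \<in> V" "w \<in> V" "u \<noteq> w" "deg u = \<Delta>" "deg w = \<Delta>'"
    "\<And>v. v \<in> V \<Longrightarrow> v \<noteq> u \<Longrightarrow> deg v \<le> \<Delta>'" by (rule top_vertices, rule that)
  have le: "deg w \<le> deg u" using Delta_ge[OF uw(2)] uw(4) by simp
  show ?thesis
  proof (cases "{u, w} \<in> E")
    case False
    then show ?thesis using second_eigenvalue_nonadjacent(2)[OF uw(1-3) _ le] uw(5) by simp
  next
    case adj: True
    show ?thesis
    proof (cases "vdegree G w = 1")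
      case True
      have "card {u, w} < card V" using card3 uw(3) by simp
      then obtain z where z: "z \<in> V" "z \<noteq> u" "z \<noteq> w"
        by (metis card_mono finite.emptyI finite.insertI insertCI insert_subset linorder_not_less subsetI)
      have "nbrs G w = {u}"
      proof -
        have "card (nbrs G w) = 1" using True deg_card by simp
        then obtain y where "nbrs G w = {y}" by (auto simp: card_1_singleton_iff)
        moreover have "u \<in> nbrs G w" using adj uw(1) unfolding nbrs_def by (simp add: insert_commute)
        ultimately show ?thesis by auto
      qed
      then have "{w, z} \<notin> E" using z unfolding nbrs_def by auto
      then show ?thesis
        using second_eigenvalue_nonadjacent(2)[OF uw(2) z(1) z(3)[symmetric], of 1] deg_ge_1 z(1) uw(2,5) True by simp
    next
      case False
      then have "vdegree G w \<ge> 2" using deg_ge_1[OF uw(2)] by simp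
      then obtain k where k: "k \<ge> 1" "vdegree G w = k + 1" by (intro that[of "vdegree G w - 1"]) auto
      then show ?thesis using double_star[OF bip adj k(1)] le uw(5) by simp
    qed
  qed
qed

text \<open>Let \<open>v\<close> have minimum degree and let \<open>R\<close> be its r
  non-neighbours. The vector \<open>x\<close> that is r at \<open>v\<close>, 0 on the neighbours and
  -1 on \<open>R\<close> is orthogonal to the constants. Edges at \<open>v\<close> contribute
  \<open>\<delta> * r^2\<close>, those between the neighbours and \<open>R\<close> at most
  \<open>\<delta> * r\<close>, all others 0; the total is at most \<delta> times the squared norm
  \<open>r^2 + r\<close>. Adding a constant changes only the norm.\<close>

lemma ls_second_last_le:
  assumes bip: "bipartite G"
  shows "ls ! (card V - 2) \<le> \<delta>"
proof -
  obtain v where v: "v \<in> V" "deg v = \<delta>" by (rule min_vertex)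
  let ?N = "nbrs G v"
  define R where "R = V - insert v ?N"
  have NV: "?N \<subseteq> V" and vN: "v \<notin> ?N" using nbrs_sub by blast+
  have fN: "finite ?N" by (rule finite_nbrs[OF sg])
  have fR: "finite R" unfolding R_def using finV by simp
  have cardN: "real (card ?N) = \<delta>" using v deg_card by simp
  \<comment> \<open>If \<open>R\<close> were empty, the minimum degree would be n - 1, so the graph
    would be complete and would contain a triangle.\<close>
  have R: "R \<noteq> {}"
  proof
    assume "R = {}"
    then have N: "?N = V - {v}" using NV vN unfolding R_def by blast
    then have c: "card ?N = card V - 1" using v finV by simp
    obtain a where a: "a \<in> ?N" using nbr_ex[OF v(1)] by blast
    then have aV: "a \<in> V" "a \<noteq> v" using N by auto
    have "real (card V) - 1 \<le> deg a" using delta_le[OF aV(1)] cardN c card3 by simp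
    then have ca: "card (nbrs G a) \<ge> card V - 1" unfolding deg_card by simp
    have "nbrs G a = V - {a}"
      using card_subset_eq[OF _ nbrs_sub[of a]] ca card_mono[OF _ nbrs_sub[of a]] finV aV by simp
    moreover have "card {v, a} < card V" using card3 aV by simp
    then obtain b where b: "b \<in> V" "b \<noteq> v" "b \<noteq> a"
      by (metis card_mono finite.emptyI finite.insertI insertCI insert_subset linorder_not_less subsetI)
    ultimately have "{a, b} \<in> E" unfolding nbrs_def by blast
    moreover have "{v, a} \<in> E" "{v, b} \<in> E" using N a b unfolding nbrs_def by blast+
    ultimately show False using bipartite_no_triangle[OF bip, of v a b] by blast
  qed
  let ?r = "real (card R)"
  have r: "?r > 0" using R fR by (simp add: card_gt_0_iff)
  have split: "(\<Sum>p\<in>V. h p) = h v + (\<Sum>p\<in>?N. h p) + (\<Sum>p\<in>R. h p)" for h :: "'a \<Rightarrow> real"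
  proof -
    have "(\<Sum>p\<in>V. h p) = (\<Sum>p\<in>R. h p) + (\<Sum>p\<in>insert v ?N. h p)"
      unfolding R_def by (rule sum.subset_diff) (use NV v finV in auto)
    then show ?thesis using fN vN by simp
  qed
  define x where "x p = (if p = v then ?r else if p \<in> ?N then 0 else - 1)" for p
  have xv: "x v = ?r" unfolding x_def by simp
  have xN: "x p = 0" if "p \<in> ?N" for p using that vN unfolding x_def by auto
  have xR: "x p = - 1" if "p \<in> R" for p using that unfolding x_def R_def by auto
  have vR: "adj_fun G v p = 0" "adj_fun G p v = 0" if "p \<in> R" for p
    using that adj_fun_commute[of G v p] unfolding R_def nbrs_def adj_fun_def by auto
  have sum_x: "(\<Sum>p\<in>V. x p) = 0" unfolding split xv using xN xR by simp
  have norm_x: "sqnorm V x = ?r\<^sup>2 + ?r" unfolding sqnorm_def split xv using xN xR by simp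
  have "(\<Sum>p\<in>V. \<Sum>q\<in>V. adj_fun G p q * (x p * x q)) = (\<Sum>p\<in>R. \<Sum>q\<in>R. adj_fun G p q)"
    unfolding split using xN xR xv vR adj_fun_self[OF sg, of v] by simp
  moreover have "(\<Sum>p\<in>V. deg p * (x p)\<^sup>2) = \<delta> * ?r\<^sup>2 + (\<Sum>p\<in>R. deg p)"
    unfolding split xv using xN xR v(2) by simp
  moreover have "(\<Sum>p\<in>R. deg p) = (\<Sum>p\<in>R. \<Sum>q\<in>?N. adj_fun G p q) + (\<Sum>p\<in>R. \<Sum>q\<in>R. adj_fun G p q)"
    unfolding sum_adj_fun[OF sg, symmetric] split sum.distrib[symmetric]
    by (rule sum.cong) (simp_all add: vR)
  moreover have "(\<Sum>p\<in>R. \<Sum>q\<in>?N. adj_fun G p q) \<le> (\<Sum>p\<in>R. \<Sum>q\<in>?N. 1)"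
    by (intro sum_mono) (simp add: adj_fun_def)
  ultimately have "qform V (laplace_fun G) x \<le> \<delta> * ?r\<^sup>2 + ?r * \<delta>"
    unfolding graph_qforms[OF finV] using cardN by simp
  then have form_x: "qform V (laplace_fun G) x \<le> \<delta> * sqnorm V x" unfolding norm_x by (simp add: algebra_simps)
  have norm: "sqnorm V (\<lambda>p. a * x p + b * 1) = a\<^sup>2 * sqnorm V x + b\<^sup>2 * real (card V)" for a b
  proof -
    have "sqnorm V (\<lambda>p. a * x p + b * 1) = (\<Sum>p\<in>V. a\<^sup>2 * (x p)\<^sup>2 + 2 * a * b * x p + b\<^sup>2)"
      unfolding sqnorm_def by (intro sum.cong) (auto simp: power2_eq_square algebra_simps)
    also have "\<dots> = a\<^sup>2 * sqnorm V x + 2 * a * b * (\<Sum>p\<in>V. x p) + b\<^sup>2 * real (card V)"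
      unfolding sqnorm_def sum.distrib sum_distrib_left by simp
    finally show ?thesis using sum_x by simp
  qed
  have form: "qform V (laplace_fun G) (\<lambda>p. a * x p + b * 1) = a\<^sup>2 * qform V (laplace_fun G) x" for a b
  proof -
    have "2 * qform V (laplace_fun G) (\<lambda>p. a * x p + b * 1) = (\<Sum>p\<in>V. \<Sum>q\<in>V. a\<^sup>2 * (adj_fun G p q * (x p - x q)\<^sup>2))"
      unfolding qform_edges(2)[OF sg] by (intro sum.cong refl) (simp add: power2_eq_square algebra_simps)
    also have "\<dots> = a\<^sup>2 * (2 * qform V (laplace_fun G) x)"
      unfolding qform_edges(2)[OF sg] sum_distrib_left ..
    finally show ?thesis by simp
  qed
  have nx: "sqnorm V x > 0" unfolding norm_x using r by (simp add: add_pos_pos)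
  have cV: "real (card V) > 0" using card3 by simp
  have pos: "sqnorm V (\<lambda>p. a * x p + b * 1) > 0" if "(a, b) \<noteq> (0, 0)" for a b
  proof (cases "a = 0")
    case True
    then show ?thesis unfolding norm using that cV by simp
  next
    case False
    then show ?thesis unfolding norm using nx cV by (intro add_pos_nonneg) auto
  qed
  have le: "qform V (laplace_fun G) (\<lambda>p. a * x p + b * 1) \<le> \<delta> * sqnorm V (\<lambda>p. a * x p + b * 1)" for a b
  proof -
    have "a\<^sup>2 * qform V (laplace_fun G) x \<le> a\<^sup>2 * (\<delta> * sqnorm V x)" using form_x by (intro mult_left_mono) auto
    moreover have "\<delta> * (b\<^sup>2 * real (card V)) \<ge> 0" using delta_ge_1 by simp
    ultimately show ?thesis unfolding form norm by (simp add: algebra_simps)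
  qed
  show ?thesis unfolding mats vl(3)[symmetric]
    using L.second_smallest_eigenvalue_le[of x "\<lambda>_. 1" \<delta>] vl_length pos le unfolding vl(2) by blast
qed

end

section \<open>The numerical estimate for complete graphs\<close>

text \<open>Bernoulli's inequality for the square of \<open>w\<close> with the exponent N/2, which
  need not be an integer; hence the induction on \<open>N\<close> itself.\<close>

lemma power_ge_quadratic:
  fixes w :: real
  assumes "w \<ge> 1" "N \<ge> 2"
  shows "1 + real N / 2 * (w\<^sup>2 - 1) \<le> w ^ N"
  using assms(2)
proof (induction N rule: dec_induct)
  case base
  then show ?case by simp
next
  case (step N)
  have "w * (1 + real N / 2 * (w\<^sup>2 - 1)) - (1 + real (Suc N) / 2 * (w\<^sup>2 - 1))
      = (w - 1)\<^sup>2 * (real N / 2 * (w + 1) - 1 / 2)"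
    by (simp add: power2_eq_square field_simps)
  moreover have "real N / 2 * (w + 1) \<ge> 1 * (1 + 1)"
    using step(1) assms(1) by (intro mult_mono) auto
  then have "(w - 1)\<^sup>2 * (real N / 2 * (w + 1) - 1 / 2) \<ge> 0" by (intro mult_nonneg_nonneg) auto
  ultimately have "1 + real (Suc N) / 2 * (w\<^sup>2 - 1) \<le> w * (1 + real N / 2 * (w\<^sup>2 - 1))" by linarith
  also have "\<dots> \<le> w * w ^ N" using step.IH assms(1) by (intro mult_left_mono) auto
  finally show ?case by simp
qed

lemma quarter_powr_power4: "x > 0 \<Longrightarrow> (x powr (1 / 4)) ^ 4 = x" for x :: real
  by (simp add: powr_realpow[symmetric] powr_powr)

text \<open>\<open>powr_gap\<close> made quantitative. With \<open>s\<close> the fourth root of q/T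
  and \<open>w\<close> the \<open>d\<close>-th root of \<open>s\<close>, passing from
  \<open>T\<close> to \<open>q\<close> gains at least \<open>2 * (s - 1) * sqrt T\<close> and loses
  at most \<open>2 * (s - 1) * sqrt (d - 1)\<close>. The net gain is at least s - 1 \<ge> 0.04,
  while the last term stays below 0.04.\<close>

lemma complete_graph_gap:
  fixes d :: nat and q R T :: real
  assumes d: "d \<ge> 2" and q: "q \<ge> 2 * real d" and T: "T = real d + sqrt (real d)" and R: "R \<ge> 0"
    and h: "(R / q) powr (1 / (2 * real d)) \<le> sqrt (real d - 1)"
  shows "sqrt T + real d * (R / T) powr (1 / (2 * real d)) + ((real d - 1) powr (1/4) - real d powr (1/4))\<^sup>2
    < sqrt q + real d * (R / q) powr (1 / (2 * real d))"
proof -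
  let ?d = "real d"
  define h' where "h' = (R / q) powr (1 / (2 * ?d))"
  define w where "w = (q / T) powr (1 / (4 * ?d))"
  define s where "s = (q / T) powr (1 / 4)"
  have d2: "?d \<ge> 2" using d by simp
  \<comment> \<open>The ratio 2d/T = 2 / (1 + 1 / sqrt d) is smallest for d = 2, where it is about
    1.1716; the rounded root of 2 still gives 1.17.\<close>
  have sd: "sqrt ?d \<ge> 1.414" using d2 by (intro real_le_rsqrt) (simp add: power2_eq_square)
  have Tpos: "T > 0" unfolding T using d2 by (simp add: add_pos_nonneg)
  have qpos: "q > 0" using q d2 by simp
  have h'0: "h' \<ge> 0" unfolding h'_def by simp
  have dd: "?d = sqrt ?d * sqrt ?d" by simp
  have "1.414 * sqrt ?d \<le> sqrt ?d * sqrt ?d" using sd by (intro mult_right_mono) auto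
  then have "1.17 * T \<le> 2 * ?d" unfolding T using sd by simp
  then have r: "q / T \<ge> 1.17" using q Tpos by (simp add: field_simps)
  have qT: "q / T > 0" using qpos Tpos by simp
  have "1 \<le> (1.17 :: real)" by simp
  then have "1 \<le> q / T" using r by (rule order_trans)
  then have w1: "w \<ge> 1" unfolding w_def by (rule ge_one_powr_ge_zero) (use d2 in simp)
  have wd: "w ^ d = s"
  proof -
    have "w > 0" using w1 by simp
    then have "w ^ d = w powr ?d" by (simp add: powr_realpow)
    also have "\<dots> = s" unfolding w_def s_def powr_powr using d2 by simp
    finally show ?thesis .
  qed
  have s2: "s * s = sqrt (q / T)"
    unfolding s_def powr_add[symmetric] using qT by (simp add: powr_half_sqrt)
  have "s ^ 4 = q / T"
    unfolding s_def by (rule quarter_powr_power4[OF qT])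
  \<comment> \<open>The fourth power of 1.04 is about 1.1699, just below 1.17.\<close>
  then have "s ^ 4 \<ge> 1.04 ^ 4" using r by (simp add: power4_eq_xxxx)
  then have s: "s \<ge> 1.04" using power_mono_iff[of "1.04" s 4] unfolding s_def by simp
  have RT: "(R / T) powr (1 / (2 * ?d)) = h' * w\<^sup>2"
  proof -
    have "R / T = (R / q) * (q / T)" using qpos by simp
    then have "(R / T) powr (1 / (2 * ?d)) = h' * (q / T) powr (1 / (2 * ?d))"
      unfolding h'_def using R qpos qT by (subst powr_mult[symmetric]) auto
    also have "(q / T) powr (1 / (2 * ?d)) = w * w"
      unfolding w_def powr_add[symmetric] by (simp add: field_simps)
    finally show ?thesis by (simp add: power2_eq_square)
  qed
  have "?d * (w\<^sup>2 - 1) \<le> 2 * (s - 1)" using power_ge_quadratic[OF w1 d] wd by simp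
  then have "h' * (?d * (w\<^sup>2 - 1)) \<le> h' * (2 * (s - 1))" using h'0 by (intro mult_left_mono) auto
  also have "\<dots> \<le> sqrt (?d - 1) * (2 * (s - 1))" using h s unfolding h'_def by (intro mult_right_mono) auto
  finally have A: "?d * (h' * w\<^sup>2) - ?d * h' \<le> 2 * (s - 1) * sqrt (?d - 1)" by (simp add: algebra_simps)
  have "sqrt q = sqrt T * (s * s)" unfolding s2 real_sqrt_mult[symmetric] using Tpos by simp
  then have "sqrt q - sqrt T = sqrt T * ((s - 1) * (s + 1))" by (simp add: algebra_simps)
  also have "\<dots> \<ge> sqrt T * ((s - 1) * 2)" using s Tpos by (intro mult_left_mono) auto
  finally have B: "sqrt q - sqrt T \<ge> 2 * (s - 1) * sqrt T" by (simp add: mult_ac)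
  \<comment> \<open>The margin 1/2 cancels the factor 2 in front of s - 1.\<close>
  have "sqrt (?d - 1) + 1 / 2 \<le> sqrt T"
  proof (rule real_le_rsqrt)
    have "sqrt (?d - 1) \<le> sqrt ?d" by simp
    moreover have "(sqrt (?d - 1))\<^sup>2 = ?d - 1" using d2 by simp
    moreover have "(sqrt (?d - 1) + 1 / 2)\<^sup>2 = (sqrt (?d - 1))\<^sup>2 + sqrt (?d - 1) + 1 / 4"
      by (simp add: power2_eq_square algebra_simps)
    ultimately show "(sqrt (?d - 1) + 1 / 2)\<^sup>2 \<le> T" unfolding T by linarith
  qed
  then have "2 * (s - 1) * (1 / 2) \<le> 2 * (s - 1) * (sqrt T - sqrt (?d - 1))" using s by (intro mult_left_mono) auto
  then have gain: "0.04 \<le> sqrt q - sqrt T - (?d * (h' * w\<^sup>2) - ?d * h')"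
    using A B s by (simp add: algebra_simps)
  define a where "a = ?d powr (1/4)"
  define b where "b = (?d - 1) powr (1/4)"
  have b1: "b \<ge> 1" unfolding b_def using d2 by (intro ge_one_powr_ge_zero) auto
  have ab: "b \<le> a" unfolding a_def b_def using d2 by (intro powr_mono2) auto
  have a4: "a ^ 4 = ?d" and b4: "b ^ 4 = ?d - 1"
    unfolding a_def b_def using d2 by (auto intro!: quarter_powr_power4)
  \<comment> \<open>The fourth powers of \<open>a\<close> and \<open>b\<close> differ by 1. A gap of
    1/5 above b \<ge> 1 would make them differ by at least 671/625. The square of 1/5 is the 0.04 to
    be beaten.\<close>
  have "a - b < 1 / 5"
  proof (rule ccontr)
    assume "\<not> a - b < 1 / 5"
    then have c: "a - b \<ge> 1 / 5" "a \<ge> 6 / 5" using b1 by auto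
    have "(6 / 5)\<^sup>2 \<le> a\<^sup>2" "1\<^sup>2 \<le> b\<^sup>2" using c b1 by (intro power_mono; simp)+
    then have "(1 / 5) * ((11 / 5) * (61 / 25)) \<le> (a - b) * ((a + b) * (a\<^sup>2 + b\<^sup>2))"
      using c b1 by (intro mult_mono) (auto simp: power2_eq_square)
    moreover have "(a - b) * ((a + b) * (a\<^sup>2 + b\<^sup>2)) = a ^ 4 - b ^ 4"
      by (simp add: power4_eq_xxxx power2_eq_square algebra_simps)
    ultimately show False unfolding a4 b4 by simp
  qed
  then have "(a - b)\<^sup>2 < (1 / 5)\<^sup>2" using ab by (intro power_strict_mono) auto
  then have "(b - a)\<^sup>2 < 0.04" unfolding power2_commute[of b a] by (simp add: power2_eq_square)
  then show ?thesis using gain unfolding RT h'_def[symmetric] a_def[symmetric] b_def[symmetric] by linarith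
qed

section \<open>The bounds for both cases\<close>

context connected_simple_graph
begin

lemma sum_degrees_le: "(\<Sum>v\<in>V. deg v) \<le> real (card V) * \<Delta>"
proof -
  have "(\<Sum>v\<in>V. deg v) \<le> (\<Sum>v\<in>V. \<Delta>)" by (rule sum_mono) (rule Delta_ge)
  then show ?thesis by simp
qed

lemma T_pos: "T > 0"
  using T_bounds(1) delta_le_Delta delta_ge_1 by simp

lemma prod_ls: "(\<Prod>k<card V - 1. ls ! k) = real (card V) * real (num_spanning_trees G)"
proof -
  let ?n = "card V"
  have ne: "length (vertex_list G) \<ge> 1" using vl(3) card3 by simp
  have "(-1) ^ (?n - 1) * (\<Prod>k<?n - 1. ls ! k) = real ?n * ((-1) ^ (?n - 1) * real (num_spanning_trees G))"
    using L.prod_eigenvalues_deriv[OF ne] laplacian_char_poly_deriv[OF sg vl(1,2)] ls_last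
    unfolding mats vl(3) by simp
  then have "(-1) ^ (?n - 1) * (\<Prod>k<?n - 1. ls ! k) = (-1) ^ (?n - 1) * (real ?n * real (num_spanning_trees G))"
    by (simp add: mult_ac)
  then show ?thesis by simp
qed

lemma prod_qs:
  "2 * real (num_spanning_trees (tensor_product G K2)) = real (num_spanning_trees G) * (\<Prod>k<card V. qs ! k)"
proof -
  have "vertex_list G \<noteq> []" using vl(3) card3 by auto
  then show ?thesis
    using spanning_trees_double_cover[OF sg vl(1,2)] Q.prod_eigenvalues unfolding mats vl(3) by simp
qed

lemma laplacian_bound:
  assumes bip: "bipartite G"
  shows "incidence_energy G = laplacian_energy_like G"
    and "laplacian_energy_like G \<ge> sqrt T
      + (real (card V) - 2) * (real (card V) * real (num_spanning_trees G) / T) powr (1 / (2 * (real (card V) - 2)))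
      + (\<Delta>' powr (1/4) - \<delta> powr (1/4))\<^sup>2"
proof -
  let ?n = "card V"
  \<comment> \<open>Indices 0 to \<open>N\<close> run over all Laplacian eigenvalues except the last
    one, which is 0; \<open>N\<close> of them remain after splitting off the largest.\<close>
  define N where "N = ?n - 2"
  have N: "N \<ge> 1" "?n = Suc (Suc N)" and rN: "real ?n - 2 = real N" unfolding N_def using card3 by auto
  have ql: "qs = ls" by (rule bipartite_eigenvalue_list[OF sg bip])
  have "incidence_energy G = (\<Sum>i<?n - 1. sqrt (ls ! i)) + sqrt (ls ! (?n - 1))"
    unfolding incidence_energy_def ql N(2) by simp
  then show "incidence_energy G = laplacian_energy_like G"
    unfolding laplacian_energy_like_def ls_last by simp
  let ?e = "\<lambda>i. ls ! i"
  let ?R = "real ?n * real (num_spanning_trees G)"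
  have set: "{..<?n - 1} = {..N}" unfolding N(2) by auto
  have R: "?R = (\<Prod>i\<le>N. ?e i)" using prod_ls unfolding set by simp
  have nn: "?e i \<ge> 0" if "i \<le> N" for i using ls_nonneg[of i] that N(2) by simp
  have q: "?e 0 \<ge> T" using qs_0_ge_T unfolding ql .
  have "(\<Sum>i\<le>N. ?e i) = (\<Sum>i<?n. ?e i)" unfolding N(2) using ls_last N(2) by (simp add: lessThan_Suc_atMost)
  also have "\<dots> = (\<Sum>v\<in>V. deg v)" using L.sum_eigenvalues unfolding mats[symmetric] vl(2,3) laplace_diag .
  also have "\<dots> \<le> real ?n * \<Delta>" by (rule sum_degrees_le)
  \<comment> \<open>There are n degrees but only n - 1 eigenvalues: n \<Delta> \<le> (n -
    1)(\<Delta> + 1) is equivalent to \<Delta> \<le> n - 1.\<close>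
  also have "\<dots> \<le> (real N + 1) * (\<Delta> + 1)"
  proof -
    obtain c where "c \<in> V" "deg c = \<Delta>" using top_vertices by metis
    then have "\<Delta> \<le> real ?n - 1" using deg_le[of c] by simp
    then show ?thesis unfolding N(2) by (simp add: algebra_simps)
  qed
  also have "\<dots> \<le> (real N + 1) * T" using T_bounds(1) by (intro mult_left_mono) auto
  finally have Rb: "(\<Prod>i\<le>N. ?e i) \<le> T powr (real N + 1)"
    by (intro eigenvalue_product_bound nn T_pos)
  have "sqrt T + real N * (?R / T) powr (1 / (2 * real N)) \<le> sqrt (?e 0) + real N * (?R / ?e 0) powr (1 / (2 * real N))"
    by (rule powr_gap(1)[OF T_pos q]) (use N Rb in \<open>auto simp: R[symmetric]\<close>)
  moreover have "(\<Delta>' powr (1/4) - \<delta> powr (1/4))\<^sup>2 \<le> (?e 1 powr (1/4) - ?e N powr (1/4))\<^sup>2"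
  proof (rule quarter_diff_mono)
    show "0 \<le> ?e N" by (rule nn) simp
    show "?e N \<le> \<delta>" using ls_second_last_le[OF bip] unfolding N_def .
    show "\<Delta>' \<le> ?e 1" by (rule ls_1_ge[OF bip])
    show "\<delta> \<le> \<Delta>'" using top_vertices delta_le by metis
  qed
  moreover have "sqrt (?e 0) + real N * (?R / ?e 0) powr (1 / (2 * real N)) + (?e 1 powr (1/4) - ?e N powr (1/4))\<^sup>2
      \<le> (\<Sum>i\<le>N. sqrt (?e i))"
    by (rule sum_sqrt_lower_bound[OF N(1) nn _ R]) (use q T_pos in auto)
  moreover have "laplacian_energy_like G = (\<Sum>i\<le>N. sqrt (?e i))"
    unfolding laplacian_energy_like_def set ..
  ultimately show "laplacian_energy_like G \<ge> sqrt T
      + (real ?n - 2) * (?R / T) powr (1 / (2 * (real ?n - 2))) + (\<Delta>' powr (1/4) - \<delta> powr (1/4))\<^sup>2"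
    unfolding rN by linarith
qed

lemma signless_bound_prod:
  assumes nb: "\<not> bipartite G"
  shows "incidence_energy G > sqrt T
      + (real (card V) - 1) * ((\<Prod>k<card V. qs ! k) / T) powr (1 / (2 * (real (card V) - 1)))
      + ((\<Delta>' - 1) powr (1/4) - \<delta> powr (1/4))\<^sup>2"
proof -
  let ?n = "card V"
  define N where "N = ?n - 1"
  have N: "N \<ge> 1" "?n = Suc N" "N \<ge> 2" and rN: "real ?n - 1 = real N" unfolding N_def using card3 by auto
  let ?e = "\<lambda>i. qs ! i"
  define R where "R = (\<Prod>i\<le>N. ?e i)"
  have set: "{..<?n} = {..N}" unfolding N(2) by auto
  have nn: "?e i \<ge> 0" if "i \<le> N" for i using qs_nonneg[of i] that N(2) by simp
  have R0: "R \<ge> 0" unfolding R_def by (intro prod_nonneg) (use nn in auto)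
  have q: "?e 0 > T" by (rule qs_0_gt_T[OF nb])
  have tr: "(\<Sum>i\<le>N. ?e i) = (\<Sum>v\<in>V. deg v)"
    using Q.sum_eigenvalues unfolding mats[symmetric] vl(2,3) signless_diag set .
  also have "\<dots> \<le> real ?n * \<Delta>" by (rule sum_degrees_le)
  also have "\<dots> \<le> (real N + 1) * T" using T_bounds(1) unfolding N(2) by (intro mult_mono) (auto simp: \<Delta>_def)
  finally have Rb: "R \<le> T powr (real N + 1)"
    unfolding R_def by (intro eigenvalue_product_bound nn T_pos)
  have gap: "sqrt T + real N * (R / T) powr (1 / (2 * real N)) < sqrt (?e 0) + real N * (R / ?e 0) powr (1 / (2 * real N))"
    by (rule powr_gap(2)[OF T_pos _ _ R0 Rb q]) (use q N in auto)
  have low: "sqrt (?e 0) + real N * (R / ?e 0) powr (1 / (2 * real N)) + (?e 1 powr (1/4) - ?e N powr (1/4))\<^sup>2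
      \<le> (\<Sum>i\<le>N. sqrt (?e i))"
    by (rule sum_sqrt_lower_bound[OF N(1) nn _ R_def]) (use q T_pos in auto)
  have IE: "incidence_energy G = (\<Sum>i\<le>N. sqrt (?e i))" unfolding incidence_energy_def set ..
  obtain u w where uw: "u \<in> V" "w \<in> V" "u \<noteq> w" "deg u = \<Delta>" "deg w = \<Delta>'"
    "\<And>v. v \<in> V \<Longrightarrow> v \<noteq> u \<Longrightarrow> deg v \<le> \<Delta>'" by (rule top_vertices, rule that)
  have last: "?e N \<le> \<delta>" using qs_last_le unfolding N_def .
  have goal: ?thesis if "((\<Delta>' - 1) powr (1/4) - \<delta> powr (1/4))\<^sup>2 \<le> (?e 1 powr (1/4) - ?e N powr (1/4))\<^sup>2"
    using gap low that unfolding IE rN set R_def[symmetric] by linarith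
  show ?thesis
  proof (cases "\<Delta>' = \<delta>")
    case False
    have "\<delta> \<le> \<Delta>'" using delta_le[OF uw(2)] uw(5) by simp
    then have "\<delta> \<le> \<Delta>' - 1" using False unfolding \<Delta>'_def \<delta>_def by simp
    then show ?thesis by (intro goal quarter_diff_mono nn last qs_1_ge) auto
  next
    case D: True
    \<comment> \<open>Every vertex other than \<open>u\<close> now has degree \<delta>, so an edge
      avoiding \<open>u\<close> joins two vertices of minimum degree. It exists since otherwise
      \<open>u\<close> alone would be one class of a bipartition.\<close>
    obtain a b where ab: "{a, b} \<in> E" "a \<noteq> u" "b \<noteq> u"
      using bipartite_if_edges_meet[OF uw(1)] nb by blast
    have "deg v = \<delta>" if "v \<in> V" "v \<noteq> u" for v using uw(6)[OF that] delta_le[OF that(1)] D by simp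
    then have "?e N \<le> \<delta> - 1"
      using qs_last_adjacent[OF ab(1)] edge_verts[OF sg ab(1)] ab unfolding N_def by simp
    show ?thesis
    proof (cases "\<exists>x\<in>V. \<exists>y\<in>V. x \<noteq> y \<and> {x, y} \<notin> E")
      case True
      then obtain x y where xy: "x \<in> V" "y \<in> V" "x \<noteq> y" "{x, y} \<notin> E" by blast
      have "\<delta> \<le> ?e 1"
        by (rule second_eigenvalue_nonadjacent(1)[OF xy delta_le[OF xy(1)] delta_le[OF xy(2)]])
      then have "(\<delta> powr (1/4) - (\<delta> - 1) powr (1/4))\<^sup>2 \<le> (?e 1 powr (1/4) - ?e N powr (1/4))\<^sup>2"
        using \<open>?e N \<le> \<delta> - 1\<close> by (intro quarter_diff_mono nn) auto
      \<comment> \<open>The claimed term has its arguments in increasing order, \<delta> - 1 before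
        \<delta>; the square allows swapping them to match the larger and the smaller
        eigenvalue.\<close>
      moreover have "((\<Delta>' - 1) powr (1/4) - \<delta> powr (1/4))\<^sup>2 = (\<delta> powr (1/4) - (\<delta> - 1) powr (1/4))\<^sup>2"
        unfolding D by (rule power2_commute)
      ultimately show ?thesis by (intro goal) (simp only:)
    next
      case False
      have degs: "deg v = real N" if "v \<in> V" for v
      proof -
        have "{v, x} \<in> E" if "x \<in> V - {v}" for x
          using False \<open>v \<in> V\<close> that by (metis DiffD1 DiffD2 singletonI)
        then have "nbrs G v = V - {v}" using nbrs_sub[of v] by (intro equalityI) (auto simp: nbrs_def)
        then show ?thesis using that finV unfolding deg_card N_def by simp
      qed
      have DN: "\<Delta> = real N" "\<delta> = real N" "\<Delta>' = real N"
        using degs[OF uw(1)] degs[OF uw(2)] uw(4,5) D by auto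
      have T: "T = real N + sqrt (real N)"
        unfolding T_def DN by (simp add: real_sqrt_mult)
      have "qform V (signless_fun G) (\<lambda>_. 1) = 2 * real N * sqnorm V (\<lambda>_. 1)"
        unfolding graph_qforms(1)[OF finV] sqnorm_def using degs by (simp add: sum_adj_fun[OF sg])
      moreover have "sqnorm V (\<lambda>_. 1) > 0" unfolding sqnorm_def using card3 by simp
      ultimately have q2: "?e 0 \<ge> 2 * real N"
        using Q.largest_eigenvalue_ge[of "\<lambda>_. 1" "2 * real N"] unfolding mats vl(2) by simp
      have split: "{..N} = insert 0 {1..N}" by auto
      have "(\<Sum>i\<le>N. ?e i) = real (Suc N) * real N" unfolding tr using degs N(2) by simp
      \<comment> \<open>The trace N (N + 1) minus the largest eigenvalue, which is at least 2 N,
        leaves a mean of at most N - 1. AM-GM turns this into the bound \<open>h\<close> on the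
        geometric mean.\<close>
      then have S: "(\<Sum>i\<in>{1..N}. ?e i) \<le> real N * (real N - 1)"
        using q2 unfolding split by (simp add: algebra_simps)
      have e0: "?e 0 > 0" using q2 N by simp
      have "R / ?e 0 = (\<Prod>i\<in>{1..N}. ?e i)" unfolding R_def split using e0 by simp
      also have "\<dots> \<le> ((\<Sum>i\<in>{1..N}. ?e i) / real (card {1..N})) ^ card {1..N}"
        using N nn by (intro amgm) auto
      also have "\<dots> \<le> (real N - 1) ^ N"
      proof -
        have "(\<Sum>i\<in>{1..N}. ?e i) / real N \<le> real N - 1" using S N by (simp add: field_simps)
        moreover have "(\<Sum>i\<in>{1..N}. ?e i) / real N \<ge> 0" using nn by (intro divide_nonneg_nonneg sum_nonneg) auto
        ultimately show ?thesis by (simp add: power_mono)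
      qed
      finally have "(R / ?e 0) powr (1 / (2 * real N)) \<le> ((real N - 1) ^ N) powr (1 / (2 * real N))"
        using R0 e0 by (intro powr_mono2) auto
      also have "\<dots> = sqrt (real N - 1)"
        using N by (simp add: powr_realpow[symmetric] powr_powr powr_half_sqrt)
      finally have h: "(R / ?e 0) powr (1 / (2 * real N)) \<le> sqrt (real N - 1)" .
      have "(?e 1 powr (1/4) - ?e N powr (1/4))\<^sup>2 \<ge> 0" by simp
      then show ?thesis
        using complete_graph_gap[OF N(3) q2 T R0 h] low
        unfolding IE rN set R_def[symmetric] DN by linarith
    qed
  qed
qed

lemma signless_bound:
  assumes nb: "\<not> bipartite G"
    and t1: "t1 = 2 * real (num_spanning_trees (tensor_product G K2)) / real (num_spanning_trees G)"
  shows "incidence_energy G > sqrt T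
      + (real (card V) - 1) * (t1 / T) powr (1 / (2 * (real (card V) - 1)))
      + ((\<Delta>' - 1) powr (1/4) - \<delta> powr (1/4))\<^sup>2"
proof -
  have P: "(\<Prod>k<card V. qs ! k) \<ge> 0" by (intro prod_nonneg) (use qs_nonneg in auto)
  \<comment> \<open>For a nonzero number of spanning trees this is an equality. Division by 0 would
    give \<open>t1 = 0\<close>, still at most the nonnegative product, so the existence of a
    spanning tree need not be established.\<close>
  have "t1 \<le> (\<Prod>k<card V. qs ! k)" "t1 \<ge> 0"
    unfolding t1 prod_qs using P by (cases "num_spanning_trees G = 0"; simp)+
  then have "(t1 / T) powr (1 / (2 * (real (card V) - 1))) \<le> ((\<Prod>k<card V. qs ! k) / T) powr (1 / (2 * (real (card V) - 1)))"
    using T_pos card3 by (intro powr_mono2) (auto simp: divide_right_mono)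
  then have "(real (card V) - 1) * (t1 / T) powr (1 / (2 * (real (card V) - 1)))
      \<le> (real (card V) - 1) * ((\<Prod>k<card V. qs ! k) / T) powr (1 / (2 * (real (card V) - 1)))"
    using card3 by (intro mult_left_mono) auto
  then show ?thesis using signless_bound_prod[OF nb] by linarith
qed

end

theorem corollary3p10:
  fixes G :: "'a ugraph" and n t :: nat and \<Delta>\<^sub>1 \<Delta>\<^sub>2 \<delta> t\<^sub>1 T :: real
  assumes "simple_graph G" and "connected_graph G"
    and "n = card (verts G)" and "n \<ge> 3"
    and "t = num_spanning_trees G"
    and "\<Delta>\<^sub>1 = real (max_degree G)"
    and "\<Delta>\<^sub>2 = real (second_max_degree G)"
    and "\<delta> = real (min_degree G)"
    and "t\<^sub>1 = 2 * real (num_spanning_trees (tensor_product G K2)) / real (num_spanning_trees G)"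
    and "T = 1 / 2 * (\<Delta>\<^sub>1 + \<delta> + sqrt ((\<Delta>\<^sub>1 - \<delta>)\<^sup>2 + 4 * \<Delta>\<^sub>1))"
  shows "(bipartite G \<longrightarrow>
            incidence_energy G = laplacian_energy_like G \<and>
            laplacian_energy_like G \<ge>
              sqrt T + (real n - 2) * (real n * real t / T) powr (1 / (2 * (real n - 2)))
                + (\<Delta>\<^sub>2 powr (1 / 4) - \<delta> powr (1 / 4))\<^sup>2) \<and>
         (\<not> bipartite G \<longrightarrow>
            incidence_energy G >
              sqrt T + (real n - 1) * (t\<^sub>1 / T) powr (1 / (2 * (real n - 1)))
                + ((\<Delta>\<^sub>2 - 1) powr (1 / 4) - \<delta> powr (1 / 4))\<^sup>2)"
proof -
  interpret g: connected_simple_graph G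
    using assms(1-4) by unfold_locales auto
  have eqs: "\<Delta>\<^sub>1 = g.\<Delta>" "\<Delta>\<^sub>2 = g.\<Delta>'" "\<delta> = g.\<delta>" "T = g.T"
    using assms(6-8,10) unfolding g.\<Delta>_def g.\<Delta>'_def g.\<delta>_def g.T_def by simp_all
  show ?thesis
    using g.laplacian_bound g.signless_bound[OF _ assms(9)]
    unfolding eqs assms(3,5) by blast
qed

end
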